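(* Let $X\in\mathbb{R}^d$ be elliptically symmetric and absolutely continuously distributed with $\mathbb{E}\|X\|^2<\infty$, mean $\mu_0$ and nonsingular covariance $\Sigma_0$; let $X_1,X_2,\dots$ be i.i.d. copies with law $P$, $\bar X_n$ and $\widehat\Sigma_n=n^{-1}\sum_{i=1}^n(X_i-\bar X_n)(X_i-\bar X_n)^\top$ the empirical mean and covariance, $\eta_0=(\Sigma_0^{-1/2},\mu_0)$, $\widehat\eta_n=(\widehat\Sigma_n^{-1/2},\bar X_n)$ (well defined a.s. for $n\ge d+1$). Then, with $\mathbb{G}_n f=\sqrt n(\mathbb{P}_n-P)f$, $$\sup_{\theta\in\Theta}\big|\mathbb{G}_n(f_{\theta,\widehat\eta_n}-f_{\theta,\eta_0})\big|\to0\quad\text{in probability as }n\to\infty.$$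
   Context: $X$ is elliptically symmetric if $X=\mu_0+\Sigma_0^{1/2}Y$ with $Y$ spherically symmetric (invariant in distribution under all orthogonal transformations). $\Theta=\mathcal{S}_{d-1}\times\mathcal{S}_{d-1}\times\mathbb{R}$ with $\mathcal{S}_{d-1}$ the Euclidean unit sphere. For $\theta=(u,v,c)\in\Theta$ and $\eta=(A,\mu)$ with $A$ a positive definite $d\times d$ matrix and $\mu\in\mathbb{R}^d$, $$f_{\theta,\eta}(x)=(v-(v^\top u)u)^\top A(x-\mu)\,\mathbf{1}_{\{u^\top A(x-\mu)\ge c\}}.$$ $\mathbb{P}_n$ is the empirical measure; $Pf_{\widehat\eta_n}$ means $\int f_{\widehat\eta_n}\,dP$ with $\widehat\eta_n$ held fixed. *)

theory Defs
  imports "HOL-Probability.Probability"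
begin

definition psd_mat :: "real^'d^'d \<Rightarrow> bool" where
  "psd_mat A \<longleftrightarrow> transpose A = A \<and> (\<forall>x. 0 \<le> x \<bullet> (A *v x))"

definition mat_sqrt :: "real^'d^'d \<Rightarrow> real^'d^'d" where
  "mat_sqrt A = (THE B. psd_mat B \<and> B ** B = A)"

definition mat_inv_sqrt :: "real^'d^'d \<Rightarrow> real^'d^'d" where
  "mat_inv_sqrt A = matrix_inv (mat_sqrt A)"

definition outer_prod :: "real^'d \<Rightarrow> real^'d \<Rightarrow> real^'d^'d" where
  "outer_prod x y = (\<chi> i j. x $ i * y $ j)"

definition spherically_symmetric :: "(real^'d) measure \<Rightarrow> bool" where
  "spherically_symmetric Q \<longleftrightarrow> prob_space Q \<and> sets Q = sets borel \<and>
     (\<forall>U. orthogonal_matrix U \<longrightarrow> distr Q borel (\<lambda>y. U *v y) = Q)"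

definition elliptically_symmetric :: "(real^'d) measure \<Rightarrow> bool" where
  "elliptically_symmetric P \<longleftrightarrow> (\<exists>m S Q. psd_mat S \<and> spherically_symmetric Q \<and>
     P = distr Q borel (\<lambda>y. m + mat_sqrt S *v y))"

definition mean_vec :: "(real^'d) measure \<Rightarrow> real^'d" where
  "mean_vec P = (\<integral>x. x \<partial>P)"

definition cov_mat :: "(real^'d) measure \<Rightarrow> real^'d^'d" where
  "cov_mat P = (\<chi> i j. \<integral>x. (x $ i - mean_vec P $ i) * (x $ j - mean_vec P $ j) \<partial>P)"

definition Theta :: "((real^'d) \<times> (real^'d) \<times> real) set" where
  "Theta = {(u, v, c). norm u = 1 \<and> norm v = 1}"

definition f_theta_eta ::
  "((real^'d) \<times> (real^'d) \<times> real) \<Rightarrow> ((real^'d^'d) \<times> (real^'d)) \<Rightarrow> real^'d \<Rightarrow> real" where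
  "f_theta_eta \<theta> \<eta> x = (case \<theta> of (u, v, c) \<Rightarrow> case \<eta> of (A, \<mu>) \<Rightarrow>
      (v - (v \<bullet> u) *\<^sub>R u) \<bullet> (A *v (x - \<mu>)) *
      (if u \<bullet> (A *v (x - \<mu>)) \<ge> c then 1 else 0))"

definition emp_mean :: "(nat \<Rightarrow> 'w \<Rightarrow> real^'d) \<Rightarrow> nat \<Rightarrow> 'w \<Rightarrow> real^'d" where
  "emp_mean X n \<omega> = (1 / real n) *\<^sub>R (\<Sum>i<n. X i \<omega>)"

definition emp_cov :: "(nat \<Rightarrow> 'w \<Rightarrow> real^'d) \<Rightarrow> nat \<Rightarrow> 'w \<Rightarrow> real^'d^'d" where
  "emp_cov X n \<omega> = (1 / real n) *\<^sub>R
     (\<Sum>i<n. outer_prod (X i \<omega> - emp_mean X n \<omega>) (X i \<omega> - emp_mean X n \<omega>))"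

text \<open>Empirical process G_n g = sqrt n (P_n g - P g), with g possibly depending on omega
  (P g computed with that g held fixed).\<close>
definition emp_proc ::
  "(real^'d) measure \<Rightarrow> (nat \<Rightarrow> 'w \<Rightarrow> real^'d) \<Rightarrow> nat \<Rightarrow> 'w \<Rightarrow> (real^'d \<Rightarrow> real) \<Rightarrow> real" where
  "emp_proc P X n \<omega> g = sqrt (real n) * ((1 / real n) * (\<Sum>i<n. g (X i \<omega>)) - (\<integral>x. g x \<partial>P))"

text \<open>Outer probability (convergence in probability of possibly non-measurable maps).\<close>
definition outer_prob :: "'w measure \<Rightarrow> 'w set \<Rightarrow> real" where
  "outer_prob M S = Inf {measure M B | B. B \<in> sets M \<and> S \<subseteq> B}"

end

theory Submission
  imports Defs "HOL-Real_Asymp.Real_Asymp"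
begin

text \<open>
  Writing \<open>f\<^sub>\<theta>\<^sub>,\<^sub>\<eta>\<close> as an affine function times the indicator of a half-space \<open>H\<^sub>\<theta>\<^sub>,\<^sub>\<eta>\<close>, the
  difference \<open>f\<^sub>\<theta>\<^sub>,\<^sub>\<eta> - f\<^sub>\<theta>\<^sub>,\<^sub>\<eta>\<^sub>0\<close> is a combination of functions \<open>g 1\<^sub>H\<close> with small coefficients and of
  functions \<open>g (1\<^sub>H - 1\<^sub>K)\<close> with \<open>P(g\<^sup>2 1\<^sub>H\<^sub>\<triangle>\<^sub>K)\<close> small, \<open>g\<close> being constant or a coordinate.
  The empirical process over the first kind is bounded in probability and over the second kind
  asymptotically equicontinuous: symmetrize, and chain conditionally on the sample, with covering
  numbers that are polynomial because half-spaces cut out polynomially many subsets of a finite set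
  (Sauer-Shelah and Radon). The radius \<open>P(g\<^sup>2 1\<^sub>H\<^sub>\<triangle>\<^sub>K)\<close> tends to zero uniformly in \<open>\<theta>\<close> because
  hyperplanes are null sets, and the estimated parameters converge because the inverse square
  root of a positive definite matrix is continuous and the law of large numbers holds.
\<close>

section \<open>The inverse square root of a positive definite matrix\<close>

text \<open>The parameter \<eta> is estimated from the very sample that enters the process, so the
  differences cannot be treated as fixed functions. The remedy is uniformity: on one event a bound
  holds for every pair of half-spaces at once, and the random pair is a mere instance of it; the
  random coefficients come out because the process is linear, with the estimated parameter held
  fixed.

  Two obstacles shape the estimates. Only second moments are available, so \<open>g\<close> is
  unbounded, and the empirical counterparts of the radii \<open>P(g^2 1)\<close> are under control
  only after truncation of \<open>g\<close>; the removed tail is paid for by a bound that holds for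
  arbitrary pairs. Moreover, suprema over uncountable families raise questions of measurability:
  expectations are taken only of maxima over finite families, Markov's inequality leads to a
  countable dense family, and pointwise convergence of indicators to all half-spaces, with
  measurable exceptional sets throughout.\<close>

lemma norm_matrix_vector_le:
  fixes A :: "real^'m^'n"
  shows "norm (A *v x) \<le> norm A * norm x"
proof -
  have "norm ((A *v x) $ i) \<le> norm (A $ i) * norm x" for i
    using Cauchy_Schwarz_ineq2[of "A $ i" x] by (simp add: matrix_vector_mul_component)
  then have "norm (A *v x) \<le> L2_set (\<lambda>i. norm (A $ i) * norm x) UNIV"
    unfolding norm_vec_def[of "A *v x"] by (intro L2_set_mono) auto
  also have "\<dots> = norm A * norm x"
    by (simp add: norm_vec_def[of A] L2_set_left_distrib)
  finally show ?thesis .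
qed

lemma abs_quadratic_form_le:
  fixes A :: "real^'n^'n"
  shows "\<bar>x \<bullet> (A *v x)\<bar> \<le> norm A * (x \<bullet> x)"
proof -
  have "\<bar>x \<bullet> (A *v x)\<bar> \<le> norm x * (norm A * norm x)"
    by (rule order_trans[OF Cauchy_Schwarz_ineq2 mult_left_mono[OF norm_matrix_vector_le]]) simp
  then show ?thesis by (simp add: dot_square_norm power2_eq_square algebra_simps)
qed

lemma norm_matrix_le_sum_entries:
  fixes A :: "real^'m^'n"
  shows "norm A \<le> (\<Sum>i\<in>UNIV. \<Sum>j\<in>UNIV. \<bar>A $ i $ j\<bar>)"
proof -
  have "norm A \<le> (\<Sum>i\<in>UNIV. norm (A $ i))"
    unfolding norm_vec_def by (rule L2_set_le_sum) simp
  also have "\<dots> \<le> (\<Sum>i\<in>UNIV. \<Sum>j\<in>UNIV. \<bar>A $ i $ j\<bar>)"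
    by (intro sum_mono norm_le_l1_cart)
  finally show ?thesis .
qed

text \<open>The norm of a matrix is the Euclidean norm of its entries. An operator bound controls
  every entry through the unit vectors, and summing all entries costs the dimensional factor. Only
  its finiteness matters, since it feeds continuity statements.\<close>

lemma norm_matrix_le_operator_bound:
  fixes A :: "real^'m^'n"
  assumes "\<And>x. norm (A *v x) \<le> c * norm x"
  shows "norm A \<le> c * (real CARD('n) * real CARD('m))"
proof -
  have "\<bar>A $ i $ j\<bar> \<le> c" for i j
  proof -
    have "A $ i $ j = (A *v axis j 1) $ i"
      by (simp add: matrix_vector_mul_component inner_axis)
    also have "\<bar>\<dots>\<bar> \<le> norm (A *v axis j 1)" by (rule component_le_norm_cart)
    also have "\<dots> \<le> c" using assms[of "axis j 1"] by simp
    finally show ?thesis .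
  qed
  then have "norm A \<le> (\<Sum>i\<in>(UNIV::'n set). \<Sum>j\<in>(UNIV::'m set). c)"
    by (intro order_trans[OF norm_matrix_le_sum_entries] sum_mono)
  then show ?thesis by (simp add: algebra_simps)
qed

lemma symmetric_matrix_inner:
  fixes A :: "real^'n^'n"
  assumes "transpose A = A"
  shows "x \<bullet> (A *v y) = (A *v x) \<bullet> y"
  by (metis assms dot_lmul_matrix transpose_matrix_vector)

text \<open>If \<open>C *v x\<close> were nonzero, a short move from \<open>x\<close> in the
  direction \<open>- (C *v x)\<close> would make the form negative: it starts at 0 and decreases to
  first order.\<close>

lemma psd_mat_quadratic_form_eq_0:
  fixes C :: "real^'n^'n"
  assumes "psd_mat C" and "x \<bullet> (C *v x) = 0"
  shows "C *v x = 0"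
proof (rule ccontr)
  assume "C *v x \<noteq> 0"
  define y where "y = C *v x"
  define m where "m = y \<bullet> y"
  define k where "k = y \<bullet> (C *v y)"
  \<comment> \<open>The minimiser of \<open>t * (2 * m + t * k)\<close> is \<open>- m / k\<close>;
    the \<open>+ 1\<close> covers \<open>k = 0\<close> and still leaves the second factor
    positive.\<close>
  define t where "t = - m / (k + 1)"
  have "m > 0" using \<open>C *v x \<noteq> 0\<close> by (simp add: m_def y_def)
  have "k \<ge> 0" using assms(1) by (simp add: k_def psd_mat_def)
  have "x \<bullet> (C *v y) = m"
    using assms(1) by (simp add: symmetric_matrix_inner psd_mat_def m_def y_def)
  then have "(x + t *\<^sub>R y) \<bullet> (C *v (x + t *\<^sub>R y)) = t * (2 * m + t * k)"
    using assms(2) by (simp add: matrix_vector_right_distrib matrix_vector_mult_scaleR inner_add_left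
        inner_add_right m_def k_def y_def algebra_simps power2_eq_square)
  then have "t * (2 * m + t * k) \<ge> 0"
    using assms(1) unfolding psd_mat_def by metis
  moreover have "t < 0" using \<open>m > 0\<close> \<open>k \<ge> 0\<close> by (simp add: t_def divide_neg_pos)
  moreover have "2 * m + t * k > 0"
  proof -
    have "m * (k / (k + 1)) \<le> m * 1"
      using \<open>m > 0\<close> \<open>k \<ge> 0\<close> by (intro mult_left_mono) auto
    then show ?thesis using \<open>m > 0\<close> by (simp add: t_def)
  qed
  ultimately show False by (simp add: zero_le_mult_iff)
qed

text \<open>Positive definiteness in quantitative form: \<open>a\<close> is a lower bound for the
  smallest eigenvalue, and the perturbation estimates below divide by it.\<close>

definition pos_def_bound :: "real \<Rightarrow> real^'n^'n \<Rightarrow> bool" where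
  "pos_def_bound a A \<longleftrightarrow> transpose A = A \<and> a > 0 \<and> (\<forall>x. a * (x \<bullet> x) \<le> x \<bullet> (A *v x))"

lemma pos_def_boundD:
  assumes "pos_def_bound a A"
  shows "transpose A = A" "a > 0" "a * (x \<bullet> x) \<le> x \<bullet> (A *v x)"
  using assms by (auto simp: pos_def_bound_def)

lemma pos_def_bound_psd: "pos_def_bound a A \<Longrightarrow> psd_mat A"
  unfolding pos_def_bound_def psd_mat_def
  by (meson inner_ge_zero less_imp_le mult_nonneg_nonneg order_trans)

lemma pos_def_bound_lower:
  assumes "pos_def_bound a A"
  shows "a * norm x \<le> norm (A *v x)"
proof (cases "x = 0")
  case False
  have "(a * norm x) * norm x \<le> x \<bullet> (A *v x)"
    using pos_def_boundD(3)[OF assms, of x] by (simp add: dot_square_norm power2_eq_square algebra_simps)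
  also have "\<dots> \<le> norm (A *v x) * norm x"
    by (metis mult.commute norm_cauchy_schwarz)
  finally show ?thesis using False by simp
qed simp

lemma pos_def_bound_invertible:
  assumes "pos_def_bound a A"
  shows "invertible A"
proof -
  have "x = 0" if "A *v x = 0" for x
    using pos_def_bound_lower[OF assms, of x] pos_def_boundD(2)[OF assms] that
    by (simp add: mult_le_0_iff)
  then show ?thesis
    by (metis invertible_left_inverse matrix_left_invertible_ker)
qed

text \<open>The form attains its minimum \<open>a\<close> on the compact unit sphere;
  \<open>a = 0\<close> would put the minimiser into the kernel. Homogeneity extends the bound to all
  vectors.\<close>

lemma psd_invertible_imp_pos_def_bound:
  fixes A :: "real^'n^'n"
  assumes "psd_mat A" "invertible A"
  obtains a where "pos_def_bound a A"
proof -
  have ne: "sphere (0::real^'n) 1 \<noteq> {}" by simp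
  have cont: "continuous_on (sphere 0 1) (\<lambda>x::real^'n. x \<bullet> (A *v x))"
    by (intro continuous_intros linear_continuous_on_compose[OF _ matrix_vector_mul_linear])
  obtain e where e: "norm e = 1" "\<And>y. norm y = 1 \<Longrightarrow> e \<bullet> (A *v e) \<le> y \<bullet> (A *v y)"
    using continuous_attains_inf[OF compact_sphere ne cont] by auto
  define a where "a = e \<bullet> (A *v e)"
  have "A *v e \<noteq> 0"
    by (metis assms(2) e(1) invertible_left_inverse matrix_left_invertible_ker norm_zero zero_neq_one)
  then have "a > 0"
    using psd_mat_quadratic_form_eq_0[OF assms(1)] assms(1)
    unfolding a_def psd_mat_def by (metis order_le_less)
  have "a * (x \<bullet> x) \<le> x \<bullet> (A *v x)" for x
  proof (cases "x = 0")
    case False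
    define y where "y = (1 / norm x) *\<^sub>R x"
    have x: "x = norm x *\<^sub>R y" using False by (simp add: y_def)
    have "norm y = 1" using False by (simp add: y_def)
    then have "a \<le> y \<bullet> (A *v y)" using e(2) by (simp add: a_def)
    then have "(norm x)\<^sup>2 * a \<le> (norm x)\<^sup>2 * (y \<bullet> (A *v y))"
      by (intro mult_left_mono) auto
    also have "\<dots> = x \<bullet> (A *v x)"
      by (subst (2 3) x) (simp add: matrix_vector_mult_scaleR power2_eq_square)
    finally show ?thesis by (simp add: dot_square_norm mult.commute)
  qed simp
  then show ?thesis
    using that[of a] \<open>a > 0\<close> assms(1) by (auto simp: pos_def_bound_def psd_mat_def)
qed

lemma pos_def_bound_perturb:
  fixes A B :: "real^'n^'n"
  assumes "pos_def_bound a A" "transpose B = B" "norm (B - A) \<le> a / 2"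
  shows "pos_def_bound (a / 2) B"
proof -
  have "a / 2 * (x \<bullet> x) \<le> x \<bullet> (B *v x)" for x
  proof -
    have "x \<bullet> (B *v x) = x \<bullet> (A *v x) + x \<bullet> ((B - A) *v x)"
      by (simp add: matrix_vector_mult_diff_rdistrib inner_diff_right)
    moreover have "\<bar>x \<bullet> ((B - A) *v x)\<bar> \<le> a / 2 * (x \<bullet> x)"
      by (rule order_trans[OF abs_quadratic_form_le mult_right_mono[OF assms(3)]]) simp
    moreover have "a * (x \<bullet> x) \<le> x \<bullet> (A *v x)" using pos_def_boundD[OF assms(1)] by blast
    moreover have "a * (x \<bullet> x) = a / 2 * (x \<bullet> x) + a / 2 * (x \<bullet> x)" by (simp add: field_simps)
    ultimately show ?thesis by linarith
  qed
  then show ?thesis using assms pos_def_boundD(2)[OF assms(1)] by (auto simp: pos_def_bound_def)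
qed

text \<open>Let \<open>e\<close> maximise the absolute value of the form on the unit sphere, with
  \<open>l\<close> the signed value there and \<open>s\<close> its sign. Then
  \<open>|l| I - s D\<close> is positive semidefinite and its form vanishes at \<open>e\<close>, so
  it annihilates \<open>e\<close>, which is the eigenvector equation. A single extremal eigenvector
  is enough to compare square roots; no diagonalisation is involved.\<close>

lemma symmetric_matrix_extremal_eigenvector:
  fixes D :: "real^'n^'n"
  assumes "transpose D = D"
  obtains e l where "norm e = 1" "D *v e = l *\<^sub>R e" "\<And>x. \<bar>x \<bullet> (D *v x)\<bar> \<le> \<bar>l\<bar> * (x \<bullet> x)"
proof -
  have ne: "sphere (0::real^'n) 1 \<noteq> {}" by simp
  have cont: "continuous_on (sphere 0 1) (\<lambda>x::real^'n. \<bar>x \<bullet> (D *v x)\<bar>)"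
    by (intro continuous_intros linear_continuous_on_compose[OF _ matrix_vector_mul_linear])
  obtain e where e: "norm e = 1" "\<And>y. norm y = 1 \<Longrightarrow> \<bar>y \<bullet> (D *v y)\<bar> \<le> \<bar>e \<bullet> (D *v e)\<bar>"
    using continuous_attains_sup[OF compact_sphere ne cont] by auto
  define l where "l = e \<bullet> (D *v e)"
  have bound: "\<bar>x \<bullet> (D *v x)\<bar> \<le> \<bar>l\<bar> * (x \<bullet> x)" for x
  proof (cases "x = 0")
    case False
    define y where "y = (1 / norm x) *\<^sub>R x"
    have x: "x = norm x *\<^sub>R y" using False by (simp add: y_def)
    have "norm y = 1" using False by (simp add: y_def)
    then have "\<bar>y \<bullet> (D *v y)\<bar> \<le> \<bar>l\<bar>" using e(2) by (simp add: l_def)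
    then have "(norm x)\<^sup>2 * \<bar>y \<bullet> (D *v y)\<bar> \<le> (norm x)\<^sup>2 * \<bar>l\<bar>"
      by (intro mult_left_mono) auto
    moreover have "\<bar>x \<bullet> (D *v x)\<bar> = (norm x)\<^sup>2 * \<bar>y \<bullet> (D *v y)\<bar>"
      by (subst (1 2) x) (simp add: matrix_vector_mult_scaleR power2_eq_square abs_mult)
    ultimately show ?thesis by (simp add: dot_square_norm mult.commute)
  qed simp
  define s :: real where "s = (if l \<ge> 0 then 1 else -1)"
  define C where "C = \<bar>l\<bar> *\<^sub>R mat 1 - s *\<^sub>R D"
  have C: "C *v x = \<bar>l\<bar> *\<^sub>R x - s *\<^sub>R (D *v x)" for x
    by (simp add: C_def matrix_vector_mult_diff_rdistrib scaleR_matrix_vector_assoc[symmetric])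
  have "transpose C = C"
    using assms by (simp add: C_def transpose_def mat_def vec_eq_iff)
  moreover have "0 \<le> x \<bullet> (C *v x)" for x
    using bound[of x] unfolding C by (auto simp: s_def inner_diff_right split: if_splits)
  ultimately have "psd_mat C" by (simp add: psd_mat_def)
  moreover have "e \<bullet> e = 1" using e(1) by (simp add: dot_square_norm)
  then have "e \<bullet> (C *v e) = 0"
    unfolding C using l_def by (auto simp: s_def inner_diff_right)
  ultimately have "C *v e = 0" by (rule psd_mat_quadratic_form_eq_0)
  then have "D *v e = l *\<^sub>R e"
    unfolding C by (auto simp: s_def split: if_splits)
  then show ?thesis using that e(1) bound by blast
qed

text \<open>With \<open>e\<close> an extremal unit eigenvector of \<open>D = B - C\<close>, \<open>D e = l e\<close>, one has
  \<open>e \<bullet> (B\<^sup>2 - C\<^sup>2) e = e \<bullet> (B D + D C) e = l (e \<bullet> B e + e \<bullet> C e)\<close>.\<close>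

lemma square_root_lipschitz:
  fixes B C :: "real^'n^'n"
  assumes C: "pos_def_bound c C" and B: "psd_mat B"
  shows "norm (B - C) \<le> norm (B ** B - C ** C) / c * (real CARD('n) * real CARD('n))"
proof -
  define D where "D = B - C"
  have symB: "transpose B = B" and symC: "transpose C = C"
    using B C by (auto simp: psd_mat_def pos_def_bound_def)
  have symD: "transpose D = D"
    using symB symC by (simp add: D_def transpose_def vec_eq_iff)
  obtain e l where e: "norm e = 1" "D *v e = l *\<^sub>R e" "\<And>x. \<bar>x \<bullet> (D *v x)\<bar> \<le> \<bar>l\<bar> * (x \<bullet> x)"
    using symmetric_matrix_extremal_eigenvector[OF symD] by blast
  have "(B ** B - C ** C) *v e = B *v (D *v e) + D *v (C *v e)"
    by (simp add: D_def matrix_vector_mult_diff_rdistrib matrix_vector_mult_diff_distrib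
        matrix_vector_mul_assoc[symmetric])
  then have "e \<bullet> ((B ** B - C ** C) *v e) = l * (e \<bullet> (B *v e) + e \<bullet> (C *v e))"
    using e(2) symmetric_matrix_inner[OF symD, of e "C *v e"]
    by (simp add: inner_add_right matrix_vector_mult_scaleR algebra_simps)
  moreover have "e \<bullet> (B *v e) \<ge> 0" using B by (simp add: psd_mat_def)
  moreover have ee: "e \<bullet> e = 1" using e(1) by (simp add: dot_square_norm)
  moreover have "e \<bullet> (C *v e) \<ge> c" using pos_def_boundD(3)[OF C, of e] ee by simp
  ultimately have "\<bar>l\<bar> * c \<le> \<bar>e \<bullet> ((B ** B - C ** C) *v e)\<bar>"
    by (simp add: abs_mult mult_left_mono)
  also have "\<dots> \<le> norm (B ** B - C ** C)"
    using abs_quadratic_form_le[of e "B ** B - C ** C"] ee by simp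
  finally have l: "\<bar>l\<bar> \<le> norm (B ** B - C ** C) / c"
    using pos_def_boundD(2)[OF C] by (simp add: field_simps)
  have "norm (D *v x) \<le> \<bar>l\<bar> * norm x" for x
  proof (cases "x = 0 \<or> D *v x = 0")
    case False
    \<comment> \<open>Polarization turns the bound on the form into one on the operator:
      \<open>y\<close> is \<open>D x\<close> rescaled to the length of \<open>x\<close>, so
      \<open>y \<bullet> D x = |x| |D x|\<close>, while the squared lengths of \<open>x + y\<close>
      and \<open>x - y\<close> add up to \<open>4 |x|^2\<close>.\<close>
    define y where "y = (norm x / norm (D *v x)) *\<^sub>R (D *v x)"
    have ny: "norm y = norm x" using False by (simp add: y_def)
    have yd: "y \<bullet> (D *v x) = norm x * norm (D *v x)"
      using False by (simp add: y_def dot_square_norm power2_eq_square)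
    have "(x + y) \<bullet> (D *v (x + y)) - (x - y) \<bullet> (D *v (x - y)) = 4 * (y \<bullet> (D *v x))"
      using symmetric_matrix_inner[OF symD, of x y]
      by (simp add: matrix_vector_right_distrib matrix_vector_mult_diff_distrib inner_add_left inner_add_right
          inner_diff_left inner_diff_right inner_commute)
    then have "4 * (norm x * norm (D *v x)) \<le> \<bar>l\<bar> * ((x + y) \<bullet> (x + y)) + \<bar>l\<bar> * ((x - y) \<bullet> (x - y))"
      using e(3)[of "x + y"] e(3)[of "x - y"] yd by linarith
    also have "\<dots> = \<bar>l\<bar> * (2 * (x \<bullet> x) + 2 * (y \<bullet> y))"
      by (simp add: inner_add_left inner_add_right inner_diff_left inner_diff_right inner_commute algebra_simps)
    also have "\<dots> = 4 * (norm x * (\<bar>l\<bar> * norm x))"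
      using ny by (simp add: dot_square_norm power2_eq_square algebra_simps)
    finally show ?thesis using False by simp
  qed auto
  then have "norm D \<le> \<bar>l\<bar> * (real CARD('n) * real CARD('n))"
    by (rule norm_matrix_le_operator_bound)
  also have "\<dots> \<le> norm (B ** B - C ** C) / c * (real CARD('n) * real CARD('n))"
    using l by (intro mult_right_mono) auto
  finally show ?thesis by (simp add: D_def)
qed

text \<open>For a small multiple \<open>A\<close> of the given matrix, a fixed point \<open>Y\<close> of \<open>Y \<mapsto> (I - A + Y\<^sup>2) / 2\<close>
  in the symmetric part of the unit ball of the operator norm satisfies \<open>(I - Y)\<^sup>2 = A\<close>.\<close>

lemma psd_square_root_exists:
  fixes A :: "real^'n^'n"
  assumes A: "pos_def_bound a A"
  obtains B where "psd_mat B" "B ** B = A"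
proof -
  \<comment> \<open>Expanding \<open>|N x|^2\<close> shows that \<open>N = I - A / c\<close> does
    not increase norms as soon as \<open>|A|^2 \<le> 2 a c\<close>.\<close>
  define c where "c = (norm A)\<^sup>2 / (2 * a) + 1"
  note a = pos_def_boundD(2)[OF A]
  have "c > 0" using a by (simp add: c_def add_nonneg_pos)
  define N where "N = mat 1 - (1 / c) *\<^sub>R A"
  define K where "K = {Y :: real^'n^'n. transpose Y = Y \<and> (\<forall>x. norm (Y *v x) \<le> norm x)}"
  define f where "f Y = (1 / 2) *\<^sub>R (N + Y ** Y)" for Y :: "real^'n^'n"
  have symN: "transpose N = N"
    using pos_def_boundD(1)[OF A] by (simp add: N_def transpose_def mat_def vec_eq_iff)
  have Nv: "N *v x = x - (1 / c) *\<^sub>R (A *v x)" for x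
    by (simp add: N_def matrix_vector_mult_diff_rdistrib scaleR_matrix_vector_assoc[symmetric])
  have N: "norm (N *v x) \<le> norm x" for x
  proof -
    have "(norm (A *v x))\<^sup>2 \<le> (norm A)\<^sup>2 * (norm x)\<^sup>2"
      using power_mono[OF norm_matrix_vector_le, of A x 2] by (simp add: power_mult_distrib)
    also have "\<dots> \<le> (2 * a * c) * (norm x)\<^sup>2"
      using a by (intro mult_right_mono) (auto simp: c_def field_simps)
    also have "\<dots> \<le> 2 * c * (x \<bullet> (A *v x))"
      using mult_left_mono[OF pos_def_boundD(3)[OF A, of x], of "2 * c"] \<open>c > 0\<close>
      by (simp add: dot_square_norm algebra_simps)
    finally have *: "(norm (A *v x))\<^sup>2 \<le> 2 * c * (x \<bullet> (A *v x))" .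
    have "(norm (N *v x))\<^sup>2 = (norm x)\<^sup>2 - 2 / c * (x \<bullet> (A *v x)) + (norm (A *v x))\<^sup>2 / c\<^sup>2"
      unfolding Nv power2_norm_eq_inner inner_diff_left inner_diff_right inner_scaleR_left
        inner_scaleR_right inner_commute[of "A *v x" x]
      using \<open>c > 0\<close> by (simp add: field_simps power2_eq_square)
    also have "\<dots> \<le> (norm x)\<^sup>2 - 2 / c * (x \<bullet> (A *v x)) + (2 * c * (x \<bullet> (A *v x))) / c\<^sup>2"
      using * by (intro add_left_mono divide_right_mono) auto
    also have "\<dots> = (norm x)\<^sup>2" using \<open>c > 0\<close> by (simp add: power2_eq_square field_simps)
    finally show ?thesis by (simp add: power2_le_iff_abs_le)
  qed
  have contmv: "continuous_on UNIV (\<lambda>Y::real^'n^'n. Y *v x)" for x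
    unfolding matrix_vector_mult_def by (intro continuous_intros)
  have "closed K"
  proof -
    have "K = {Y. transpose Y = Y} \<inter> (\<Inter>x. {Y. norm (Y *v x) \<le> norm x})" by (auto simp: K_def)
    moreover have "closed {Y :: real^'n^'n. transpose Y = Y}"
      unfolding transpose_def by (intro closed_Collect_eq continuous_intros)
    moreover have "closed {Y :: real^'n^'n. norm (Y *v x) \<le> norm x}" for x
      by (intro closed_Collect_le continuous_on_norm contmv continuous_intros)
    ultimately show ?thesis by auto
  qed
  moreover have "bounded K"
    using norm_matrix_le_operator_bound[where c = 1 and 'n = 'n and 'm = 'n]
    unfolding K_def bounded_iff by auto
  ultimately have "compact K" by (simp add: compact_eq_bounded_closed)
  moreover have "convex K"
  proof (rule convexI)
    fix Y Z :: "real^'n^'n" and u v :: real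
    assume YZ: "Y \<in> K" "Z \<in> K" and uv: "0 \<le> u" "0 \<le> v" "u + v = 1"
    have "norm ((u *\<^sub>R Y + v *\<^sub>R Z) *v x) \<le> norm x" for x
    proof -
      have "norm ((u *\<^sub>R Y + v *\<^sub>R Z) *v x) \<le> u * norm (Y *v x) + v * norm (Z *v x)"
        using uv norm_triangle_ineq[of "u *\<^sub>R (Y *v x)" "v *\<^sub>R (Z *v x)"]
        by (simp add: matrix_vector_mult_add_rdistrib scaleR_matrix_vector_assoc[symmetric])
      also have "\<dots> \<le> u * norm x + v * norm x"
        using YZ uv by (intro add_mono mult_left_mono) (auto simp: K_def)
      also have "\<dots> = norm x" using uv by (metis distrib_right mult_1)
      finally show ?thesis .
    qed
    moreover have "transpose (u *\<^sub>R Y + v *\<^sub>R Z) = u *\<^sub>R Y + v *\<^sub>R Z"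
      using YZ by (simp add: K_def transpose_def vec_eq_iff)
    ultimately show "u *\<^sub>R Y + v *\<^sub>R Z \<in> K" by (simp add: K_def)
  qed
  moreover have "N \<in> K" using symN N by (simp add: K_def)
  moreover have "continuous_on K f"
    unfolding f_def matrix_matrix_mult_def by (intro continuous_intros)
  moreover have "f Y \<in> K" if "Y \<in> K" for Y
  proof -
    have "norm (f Y *v x) \<le> norm x" for x
    proof -
      have "norm (Y *v (Y *v x)) \<le> norm x"
        using that unfolding K_def by (blast intro: order_trans)
      then have "norm (N *v x + Y *v (Y *v x)) \<le> norm x + norm x"
        using N by (intro norm_triangle_mono)
      then show ?thesis
        by (simp add: f_def scaleR_matrix_vector_assoc[symmetric] matrix_vector_mult_add_rdistrib
            matrix_vector_mul_assoc[symmetric] del: matrix_vector_mul_assoc)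
    qed
    moreover have "transpose (Y ** Y) = Y ** Y"
      using that by (simp add: K_def matrix_transpose_mul)
    then have "transpose (f Y) = f Y"
      using symN by (simp add: f_def transpose_def vec_eq_iff)
    ultimately show ?thesis by (simp add: K_def)
  qed
  \<comment> \<open>On \<open>K\<close> the map is merely nonexpansive for the operator norm, so the
    fixed point comes from compactness and convexity (Brouwer) and not from iteration.\<close>
  ultimately obtain Y where Y: "Y \<in> K" "f Y = Y"
    using brouwer[of K f] by (metis Pi_I empty_iff)
  define B where "B = sqrt c *\<^sub>R (mat 1 - Y)"
  have YY: "Y ** Y = Y + Y - N"
  proof -
    have "N + Y ** Y = f Y + f Y" by (simp add: f_def flip: scaleR_left_distrib)
    then show ?thesis using Y(2) by (simp add: eq_diff_eq add.commute)
  qed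
  have "(mat 1 - Y) ** (mat 1 - Z) = mat 1 - Y - Z + Y ** Z" for Z
    by (simp add: matrix_eq matrix_vector_mul_assoc[symmetric] matrix_vector_mult_diff_distrib
        matrix_vector_mult_diff_rdistrib matrix_vector_mult_add_rdistrib)
  then have "(mat 1 - Y) ** (mat 1 - Y) = mat 1 - Y - Y + Y ** Y" .
  also have "\<dots> = (1 / c) *\<^sub>R A" by (simp add: YY N_def)
  finally have "B ** B = A"
    using \<open>c > 0\<close> by (simp add: B_def scalar_matrix_assoc[symmetric] matrix_scalar_ac)
  moreover have "psd_mat B"
    unfolding psd_mat_def
  proof (intro conjI allI)
    show "transpose B = B"
      using Y(1) by (simp add: K_def B_def transpose_def mat_def vec_eq_iff)
    fix x
    have "x \<bullet> (Y *v x) \<le> norm x * norm (Y *v x)" by (rule norm_cauchy_schwarz)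
    also have "\<dots> \<le> norm x * norm x" using Y(1) by (intro mult_left_mono) (auto simp: K_def)
    finally have "x \<bullet> (Y *v x) \<le> x \<bullet> x" by (simp add: dot_square_norm power2_eq_square)
    moreover have "B *v x = sqrt c *\<^sub>R (x - Y *v x)"
      by (simp add: B_def matrix_vector_mult_diff_rdistrib scaleR_matrix_vector_assoc[symmetric])
    ultimately show "0 \<le> x \<bullet> (B *v x)"
      using \<open>c > 0\<close> by (simp add: inner_diff_right)
  qed
  ultimately show ?thesis using that by blast
qed

text \<open>Existence is the fixed-point construction; uniqueness among positive semidefinite roots
  is the Lipschitz estimate for two matrices with the same square. Together they make the
  description in \<open>mat_sqrt\<close> denote. The root is invertible because its square
  is.\<close>

lemma mat_sqrt_pos_def:
  fixes A :: "real^'n^'n"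
  assumes A: "pos_def_bound a A"
  obtains b where "pos_def_bound b (mat_sqrt A)" "mat_sqrt A ** mat_sqrt A = A"
proof -
  obtain B where B: "psd_mat B" "B ** B = A"
    using psd_square_root_exists[OF A] by blast
  have "invertible B"
  proof -
    have "x = 0" if "B *v x = 0" for x
    proof -
      have "A *v x = 0" using that B(2) matrix_vector_mul_assoc[of B B x] by simp
      then show ?thesis
        using pos_def_bound_invertible[OF A] by (metis invertible_left_inverse matrix_left_invertible_ker)
    qed
    then show ?thesis by (metis invertible_left_inverse matrix_left_invertible_ker)
  qed
  then obtain b where b: "pos_def_bound b B"
    using psd_invertible_imp_pos_def_bound[OF B(1)] by blast
  have "mat_sqrt A = B"
    unfolding mat_sqrt_def
  proof (rule the_equality)
    fix C assume C: "psd_mat C \<and> C ** C = A"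
    then have "norm (C - B) \<le> 0" using square_root_lipschitz[OF b, of C] B(2) by simp
    then show "C = B" by simp
  qed (use B in simp)
  then show ?thesis using that b B(2) by simp
qed

section \<open>Inversion and continuity of the inverse square root\<close>

lemma matrix_inv_works:
  fixes A :: "real^'n^'n"
  assumes "invertible A"
  shows "A ** matrix_inv A = mat 1" "matrix_inv A ** A = mat 1"
  using someI_ex[OF assms[unfolded invertible_def]] by (auto simp: matrix_inv_def)

text \<open>For fixed \<open>x\<close>, the solutions of \<open>B y = x\<close> and
  \<open>C z = x\<close> satisfy \<open>B (y - z) = - (B - C) z\<close>; the two lower bounds then
  control \<open>y - z\<close> and \<open>z\<close>.\<close>

lemma matrix_inv_perturbation:
  fixes B C :: "real^'n^'n"
  assumes C: "pos_def_bound c C" and B: "pos_def_bound b B"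
  shows "norm (matrix_inv B - matrix_inv C) \<le> norm (B - C) / (b * c) * (real CARD('n) * real CARD('n))"
proof (rule norm_matrix_le_operator_bound)
  fix x
  define y where "y = matrix_inv B *v x"
  define z where "z = matrix_inv C *v x"
  have inv: "invertible B" "invertible C" using B C pos_def_bound_invertible by blast+
  have By: "B *v y = x" and Cz: "C *v z = x"
    using matrix_inv_works(1)[OF inv(1)] matrix_inv_works(1)[OF inv(2)]
    by (simp_all add: y_def z_def matrix_vector_mul_assoc)
  note b = pos_def_boundD(2)[OF B] and c = pos_def_boundD(2)[OF C]
  have "B *v (y - z) = - ((B - C) *v z)"
    using By Cz by (simp add: matrix_vector_mult_diff_distrib matrix_vector_mult_diff_rdistrib)
  then have "b * norm (y - z) \<le> norm (B - C) * norm z"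
    using pos_def_bound_lower[OF B, of "y - z"] norm_matrix_vector_le[of "B - C" z] by simp
  also have "\<dots> \<le> norm (B - C) * (norm x / c)"
    using pos_def_bound_lower[OF C, of z] Cz c by (intro mult_left_mono) (auto simp: field_simps)
  finally have "norm (y - z) \<le> norm (B - C) / (b * c) * norm x"
    using b c by (simp add: field_simps)
  then show "norm ((matrix_inv B - matrix_inv C) *v x) \<le> norm (B - C) / (b * c) * norm x"
    by (simp add: y_def z_def matrix_vector_mult_diff_rdistrib)
qed

text \<open>Every positive semidefinite matrix close enough to \<open>A\<close> is positive
  definite, so semidefiniteness is all that is asked of \<open>S\<close>. This suits empirical
  covariances, which are semidefinite at every sample point but may be singular.\<close>

lemma mat_inv_sqrt_continuous:
  fixes A :: "real^'n^'n"
  assumes A: "psd_mat A" "invertible A" and e: "e > 0"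
  obtains d where "d > 0"
    "\<And>S. psd_mat S \<Longrightarrow> norm (S - A) < d \<Longrightarrow> norm (mat_inv_sqrt S - mat_inv_sqrt A) < e"
proof -
  obtain a where a: "pos_def_bound a A" using psd_invertible_imp_pos_def_bound[OF A] by blast
  obtain b where b: "pos_def_bound b (mat_sqrt A)" "mat_sqrt A ** mat_sqrt A = A"
    using mat_sqrt_pos_def[OF a] by blast
  define n where "n = real CARD('n) * real CARD('n)"
  have n: "n > 0" by (simp add: n_def)
  have a0: "a > 0" and b0: "b > 0" using a b pos_def_boundD by blast+
  \<comment> \<open>Tolerance for the square roots: \<open>b / 2\<close> preserves the lower bound
    \<open>b / 2\<close> for \<open>mat_sqrt S\<close>, and the other term brings the inverses
    within \<open>e / 2\<close>. The \<open>d\<close> below is a tolerance for \<open>S\<close> that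
    achieves this.\<close>
  define t where "t = min (b / 2) (e * (b / 2 * b) / (2 * n))"
  have t: "t > 0" using b0 e n by (simp add: t_def)
  define d where "d = min (a / 2) (t * b / n)"
  have "d > 0" using a0 b0 t n by (simp add: d_def)
  moreover have "norm (mat_inv_sqrt S - mat_inv_sqrt A) < e"
    if S: "psd_mat S" "norm (S - A) < d" for S
  proof -
    have "pos_def_bound (a / 2) S"
      using S by (intro pos_def_bound_perturb[OF a]) (auto simp: psd_mat_def d_def)
    then obtain b' where b': "pos_def_bound b' (mat_sqrt S)" "mat_sqrt S ** mat_sqrt S = S"
      using mat_sqrt_pos_def by blast
    have "norm (mat_sqrt S - mat_sqrt A) \<le> norm (S - A) / b * n"
      using square_root_lipschitz[OF b(1) pos_def_bound_psd[OF b'(1)]] b(2) b'(2) by (simp add: n_def)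
    also have "\<dots> \<le> (t * b / n) / b * n"
      using S(2) b0 n by (intro mult_right_mono divide_right_mono) (auto simp: d_def)
    also have "\<dots> = t" using b0 n by simp
    finally have le: "norm (mat_sqrt S - mat_sqrt A) \<le> t" .
    have B: "pos_def_bound (b / 2) (mat_sqrt S)"
      using le pos_def_boundD(1)[OF b'(1)] by (intro pos_def_bound_perturb[OF b(1)]) (auto simp: t_def)
    have "norm (mat_inv_sqrt S - mat_inv_sqrt A) \<le> norm (mat_sqrt S - mat_sqrt A) / (b / 2 * b) * n"
      using matrix_inv_perturbation[OF b(1) B] by (simp add: mat_inv_sqrt_def n_def)
    also have "\<dots> \<le> (e * (b / 2 * b) / (2 * n)) / (b / 2 * b) * n"
      using le b0 n by (intro mult_right_mono divide_right_mono) (auto simp: t_def)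
    also have "\<dots> = e / 2" using b0 n by simp
    also have "\<dots> < e" using e by simp
    finally show ?thesis .
  qed
  ultimately show ?thesis using that by blast
qed

lemma invertible_mat_inv_sqrt:
  fixes A :: "real^'n^'n"
  assumes "psd_mat A" "invertible A"
  shows "invertible (mat_inv_sqrt A)"
proof -
  obtain a where "pos_def_bound a A" using psd_invertible_imp_pos_def_bound[OF assms] by blast
  then obtain b where "pos_def_bound b (mat_sqrt A)" using mat_sqrt_pos_def by blast
  then have "invertible (mat_sqrt A)" by (rule pos_def_bound_invertible)
  then show ?thesis
    unfolding mat_inv_sqrt_def by (meson invertible_def matrix_inv_works)
qed

section \<open>Traces of half-spaces\<close>

definition shatters :: "'a set set \<Rightarrow> 'a set \<Rightarrow> bool" where
  "shatters F B \<longleftrightarrow> (\<forall>C\<subseteq>B. \<exists>S\<in>F. S \<inter> B = C)"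

text \<open>Pajor's form of the Sauer-Shelah lemma, by induction on the ground set. A point
  \<open>x\<close> splits \<open>F\<close> into the members avoiding it and the members containing
  it, with \<open>x\<close> deleted from the latter. A set shattered by either part is shattered by
  \<open>F\<close>. A set shattered by both is counted twice, and the second count is matched by the
  set with \<open>x\<close> added, which \<open>F\<close> shatters too.\<close>

lemma card_le_card_shattered:
  assumes "finite J" "F \<subseteq> Pow J"
  shows "card F \<le> card {B \<in> Pow J. shatters F B}"
  using assms
proof (induction J arbitrary: F rule: finite_induct)
  case empty
  then have "F = {} \<or> F = {{}}" by auto
  then show ?case
  proof
    assume "F = {{}}"
    then have "{B \<in> Pow {}. shatters F B} = {{}}" by (auto simp: shatters_def)
    then show ?thesis using \<open>F = {{}}\<close> by simp
  qed simp
next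
  case (insert x J)
  define F0 where "F0 = {S\<in>F. x \<notin> S}"
  define F1 where "F1 = (\<lambda>S. S - {x}) ` {S\<in>F. x \<in> S}"
  define Sh0 where "Sh0 = {B \<in> Pow J. shatters F0 B}"
  define Sh1 where "Sh1 = {B \<in> Pow J. shatters F1 B}"
  have "finite F" using insert.hyps insert.prems by (meson finite.insertI finite_Pow_iff finite_subset)
  have fin: "finite Sh0" "finite Sh1" using insert.hyps by (simp_all add: Sh0_def Sh1_def)
  have "card {S\<in>F. x \<in> S} = card F1"
    unfolding F1_def by (rule card_image[symmetric]) (auto simp: inj_on_def)
  moreover have "card F = card F0 + card {S\<in>F. x \<in> S}"
    unfolding F0_def using \<open>finite F\<close>
    by (subst card_Un_disjoint[symmetric]) (auto intro!: arg_cong[where f = card])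
  moreover have "card F0 \<le> card Sh0" "card F1 \<le> card Sh1"
    unfolding Sh0_def Sh1_def using insert.prems by (intro insert.IH; auto simp: F0_def F1_def)+
  moreover have "card Sh0 + card Sh1 = card (Sh0 \<union> Sh1) + card (Sh0 \<inter> Sh1)"
    by (rule card_Un_Int[OF fin])
  moreover have "card (Sh0 \<inter> Sh1) = card (insert x ` (Sh0 \<inter> Sh1))"
  proof (rule card_image[symmetric])
    show "inj_on (insert x) (Sh0 \<inter> Sh1)"
    proof (rule inj_onI)
      fix A B assume "A \<in> Sh0 \<inter> Sh1" "B \<in> Sh0 \<inter> Sh1" "insert x A = insert x B"
      moreover from this have "x \<notin> A" "x \<notin> B" using insert.hyps(2) by (auto simp: Sh0_def)
      ultimately show "A = B" by (simp add: insert_ident)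
    qed
  qed
  moreover have "card (Sh0 \<union> Sh1) + card (insert x ` (Sh0 \<inter> Sh1))
      = card ((Sh0 \<union> Sh1) \<union> insert x ` (Sh0 \<inter> Sh1))"
    using fin insert.hyps(2) by (intro card_Un_disjoint[symmetric]) (auto simp: Sh0_def Sh1_def)
  moreover have "card ((Sh0 \<union> Sh1) \<union> insert x ` (Sh0 \<inter> Sh1))
      \<le> card {B \<in> Pow (insert x J). shatters F B}"
  proof (rule card_mono)
    show "finite {B \<in> Pow (insert x J). shatters F B}" using insert.hyps by simp
    have sh0: "shatters F B" if "B \<in> Sh0" for B
      using that unfolding Sh0_def shatters_def F0_def by blast
    have sh1: "shatters F B" if B: "B \<in> Sh1" for B
    proof -
      have "x \<notin> B" using that insert.hyps(2) by (auto simp: Sh1_def)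
      show ?thesis
        unfolding shatters_def
      proof (intro allI impI)
        fix C assume "C \<subseteq> B"
        then obtain S where "S \<in> F" "(S - {x}) \<inter> B = C"
          using B unfolding Sh1_def shatters_def F1_def by blast
        then show "\<exists>S\<in>F. S \<inter> B = C" using \<open>x \<notin> B\<close> by blast
      qed
    qed
    have sh2: "shatters F (insert x B)" if B: "B \<in> Sh0 \<inter> Sh1" for B
      unfolding shatters_def
    proof (intro allI impI)
      have "x \<notin> B" using that insert.hyps(2) by (auto simp: Sh1_def)
      fix C assume C: "C \<subseteq> insert x B"
      show "\<exists>S\<in>F. S \<inter> insert x B = C"
      proof (cases "x \<in> C")
        case True
        have "C - {x} \<subseteq> B" using C by blast
        then obtain S where "S \<in> F" "x \<in> S" "(S - {x}) \<inter> B = C - {x}"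
          using B unfolding Sh1_def shatters_def F1_def by blast
        then have "S \<inter> insert x B = C" using True \<open>x \<notin> B\<close> by blast
        then show ?thesis using \<open>S \<in> F\<close> by blast
      next
        case False
        then have "C \<subseteq> B" using C by blast
        then obtain S where "S \<in> F" "x \<notin> S" "S \<inter> B = C"
          using B unfolding Sh0_def shatters_def F0_def by blast
        then show ?thesis by blast
      qed
    qed
    show "(Sh0 \<union> Sh1) \<union> insert x ` (Sh0 \<inter> Sh1) \<subseteq> {B \<in> Pow (insert x J). shatters F B}"
      using sh0 sh1 sh2 by (auto simp: Sh0_def Sh1_def)
  qed
  ultimately show ?case by linarith
qed

lemma card_subsets_bounded_card:
  assumes "finite J"
  shows "card {B \<in> Pow J. card B \<le> D} \<le> (card J + 1) ^ D"
proof (induction D)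
  case 0
  have "{B \<in> Pow J. card B \<le> 0} \<subseteq> {{}}"
    using assms by (auto dest: finite_subset)
  then show ?case using card_mono[of "{{}::'a set}"] by fastforce
next
  case (Suc D)
  define A where "A = {B \<in> Pow J. card B \<le> D}"
  have "finite A" using assms by (simp add: A_def)
  have "{B \<in> Pow J. card B \<le> Suc D} \<subseteq> A \<union> (\<lambda>(i, B). insert i B) ` (J \<times> A)"
  proof
    fix B assume B: "B \<in> {B \<in> Pow J. card B \<le> Suc D}"
    show "B \<in> A \<union> (\<lambda>(i, B). insert i B) ` (J \<times> A)"
    proof (cases "B = {}")
      case False
      then obtain i where i: "i \<in> B" by blast
      have "finite B" using B assms finite_subset by blast
      then have "card (B - {i}) \<le> D" using B i by (auto simp: card_Diff_singleton)
      then have "(i, B - {i}) \<in> J \<times> A" using B i by (auto simp: A_def)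
      moreover have "B = (\<lambda>(i, B). insert i B) (i, B - {i})" using i by auto
      ultimately show ?thesis by blast
    qed (simp add: A_def)
  qed
  then have "card {B \<in> Pow J. card B \<le> Suc D} \<le> card (A \<union> (\<lambda>(i, B). insert i B) ` (J \<times> A))"
    using assms \<open>finite A\<close> by (intro card_mono) auto
  also have "\<dots> \<le> card A + card ((\<lambda>(i, B). insert i B) ` (J \<times> A))" by (rule card_Un_le)
  also have "\<dots> \<le> card A + card (J \<times> A)"
    using assms \<open>finite A\<close> by (intro add_left_mono card_image_le) auto
  also have "\<dots> = (card J + 1) * card A" by (simp add: card_cartesian_product)
  also have "\<dots> \<le> (card J + 1) * (card J + 1) ^ D"
    using Suc by (intro mult_left_mono) (auto simp: A_def)
  finally show ?case by simp
qed

text \<open>A pair of normal and threshold, with the zero normal allowed: the empty set and the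
  whole space are then half-spaces as well, and a single half-space becomes a special pair.\<close>

definition halfspace :: "'a::real_inner \<times> real \<Rightarrow> 'a set" where
  "halfspace h = {x. snd h \<le> fst h \<bullet> x}"

text \<open>No half-space cuts one part out of a Radon partition of \<open>DIM('a) + 2\<close> points.\<close>

lemma halfspace_shattered_card_le:
  fixes x :: "'i \<Rightarrow> 'a::euclidean_space"
  assumes "finite J" "B \<subseteq> J" and sh: "shatters (range (\<lambda>h. {i\<in>J. x i \<in> halfspace h})) B"
  shows "card B \<le> DIM('a) + 1"
proof (rule ccontr)
  assume "\<not> card B \<le> DIM('a) + 1"
  have sep: "\<exists>h. \<forall>i\<in>B. x i \<in> halfspace h \<longleftrightarrow> i \<in> C" if C: "C \<subseteq> B" for C
  proof -
    obtain h where "{i\<in>J. x i \<in> halfspace h} \<inter> B = C"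
      using sh C unfolding shatters_def by blast
    then show ?thesis using assms(2) by blast
  qed
  \<comment> \<open>Radon's theorem speaks of points whereas \<open>B\<close> consists of indices;
    shattered singletons force the points to be distinct.\<close>
  have inj: "inj_on x B"
  proof (rule inj_onI)
    fix i j assume "i \<in> B" "j \<in> B" "x i = x j"
    then show "i = j" using sep[of "{i}"] by (metis bot_least insert_subset singleton_iff)
  qed
  have "finite B" using assms finite_subset by blast
  have "card (x ` B) \<ge> DIM('a) + 2"
    using \<open>\<not> card B \<le> DIM('a) + 1\<close> by (simp add: card_image[OF inj])
  then have "affine_dependent (x ` B)"
    using \<open>finite B\<close> by (intro affine_dependent_biggerset) auto
  then obtain M N where MN: "M \<subseteq> x ` B" "N \<subseteq> x ` B" "M \<inter> N = {}" "(convex hull M) \<inter> (convex hull N) \<noteq> {}"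
    using Radon by blast
  obtain h where h: "\<And>i. i \<in> B \<Longrightarrow> x i \<in> halfspace h \<longleftrightarrow> x i \<in> M"
    using sep[of "{i\<in>B. x i \<in> M}"] by auto
  have "M \<subseteq> {y. fst h \<bullet> y \<ge> snd h}" using h MN(1) by (auto simp: halfspace_def)
  then have 1: "convex hull M \<subseteq> {y. fst h \<bullet> y \<ge> snd h}"
    by (intro hull_minimal convex_halfspace_ge)
  have "N \<subseteq> {y. fst h \<bullet> y < snd h}" using h MN(2,3) by (fastforce simp: halfspace_def)
  then have 2: "convex hull N \<subseteq> {y. fst h \<bullet> y < snd h}"
    by (intro hull_minimal convex_halfspace_lt)
  show False using 1 2 MN(4) by fastforce
qed

lemma halfspace_trace_card_le:
  fixes x :: "'i \<Rightarrow> 'a::euclidean_space"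
  assumes "finite J"
  shows "card (range (\<lambda>h. {i\<in>J. x i \<in> halfspace h})) \<le> (card J + 1) ^ (DIM('a) + 1)"
proof -
  let ?F = "range (\<lambda>h. {i\<in>J. x i \<in> halfspace h})"
  have "card ?F \<le> card {B \<in> Pow J. shatters ?F B}"
    using assms by (intro card_le_card_shattered) auto
  also have "\<dots> \<le> card {B \<in> Pow J. card B \<le> DIM('a) + 1}"
    using assms halfspace_shattered_card_le[OF assms] by (intro card_mono) auto
  also have "\<dots> \<le> (card J + 1) ^ (DIM('a) + 1)"
    using assms by (rule card_subsets_bounded_card)
  finally show ?thesis .
qed

section \<open>Covering numbers of families with polynomially many traces\<close>

text \<open>If points were drawn at random with weights \<open>m\<close>, each draw would miss a
  given pair with probability at most \<open>1 - e\<close>, so \<open>k\<close> draws would leave on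
  average at most the fraction \<open>(1 - e) ^ k\<close> of the ordered pairs unseparated. The
  induction realises this draw by draw: by averaging over \<open>J\<close>, some point leaves at
  most the fraction \<open>1 - e\<close> of the pairs that remain.\<close>

lemma exists_separating_points:
  fixes m :: "'i \<Rightarrow> real"
  assumes J: "finite J" and m: "\<And>i. i \<in> J \<Longrightarrow> m i \<ge> 0" and W: "sum m J > 0"
    and G: "finite G" "G \<subseteq> Pow J" and e: "e \<le> 1"
    and sep: "\<And>S T. S \<in> G \<Longrightarrow> T \<in> G \<Longrightarrow> S \<noteq> T \<Longrightarrow> sum m (sym_diff S T) \<ge> e * sum m J"
  shows "\<exists>K\<subseteq>J. card K \<le> k \<and>
    real (card {(S, T) \<in> G \<times> G. S \<noteq> T \<and> S \<inter> K = T \<inter> K}) \<le> (1 - e) ^ k * (real (card G))\<^sup>2"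
proof (induction k)
  case 0
  have "card {(S, T) \<in> G \<times> G. S \<noteq> T \<and> S \<inter> {} = T \<inter> {}} \<le> card (G \<times> G)"
    using G by (intro card_mono) auto
  also have "\<dots> = card G * card G" by (rule card_cartesian_product)
  finally have "real (card {(S, T) \<in> G \<times> G. S \<noteq> T \<and> S \<inter> {} = T \<inter> {}}) \<le> real (card G * card G)"
    by (simp only: of_nat_le_iff)
  then show ?case by (intro exI[of _ "{}"] conjI) (simp_all add: power2_eq_square)
next
  case (Suc k)
  then obtain K where K: "K \<subseteq> J" "card K \<le> k"
    "real (card {(S, T) \<in> G \<times> G. S \<noteq> T \<and> S \<inter> K = T \<inter> K}) \<le> (1 - e) ^ k * (real (card G))\<^sup>2"
    by blast
  define U where "U = {(S, T) \<in> G \<times> G. S \<noteq> T \<and> S \<inter> K = T \<inter> K}"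
  define V where "V i = {(S, T) \<in> U. i \<notin> sym_diff S T}" for i
  have "finite U" using finite_subset[of U "G \<times> G"] G by (auto simp: U_def)
  have "\<exists>i\<in>J. real (card (V i)) \<le> (1 - e) * real (card U)"
  proof (rule ccontr)
    assume "\<not> ?thesis"
    then have big: "real (card (V i)) > (1 - e) * real (card U)" if "i \<in> J" for i using that by auto
    obtain j where j: "j \<in> J" "m j > 0" using W by (metis sum_nonpos not_less)
    have "(\<Sum>i\<in>J. m i * ((1 - e) * real (card U))) < (\<Sum>i\<in>J. m i * real (card (V i)))"
    proof (rule sum_strict_mono_ex1[OF J])
      show "\<forall>i\<in>J. m i * ((1 - e) * real (card U)) \<le> m i * real (card (V i))"
        using m by (intro ballI mult_left_mono less_imp_le[OF big])
      show "\<exists>i\<in>J. m i * ((1 - e) * real (card U)) < m i * real (card (V i))"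
        using j big by (intro bexI[of _ j] mult_strict_left_mono)
    qed
    also have "\<dots> = (\<Sum>i\<in>J. \<Sum>p\<in>U. if i \<notin> sym_diff (fst p) (snd p) then m i else 0)"
    proof (rule sum.cong[OF refl])
      fix i assume "i \<in> J"
      have "V i = {p \<in> U. i \<notin> sym_diff (fst p) (snd p)}" by (auto simp: V_def)
      then show "m i * real (card (V i)) = (\<Sum>p\<in>U. if i \<notin> sym_diff (fst p) (snd p) then m i else 0)"
        using \<open>finite U\<close> by (simp add: sum.inter_filter[symmetric])
    qed
    also have "\<dots> = (\<Sum>p\<in>U. \<Sum>i\<in>J. if i \<notin> sym_diff (fst p) (snd p) then m i else 0)"
      by (rule sum.swap)
    also have "\<dots> \<le> (\<Sum>p\<in>U. (1 - e) * sum m J)"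
    proof (rule sum_mono)
      fix p assume "p \<in> U"
      then obtain S T where p: "p = (S, T)" "S \<in> G" "T \<in> G" "S \<noteq> T" by (auto simp: U_def)
      have "sym_diff S T \<subseteq> J" using p G by auto
      have "(\<Sum>i\<in>J. if i \<notin> sym_diff S T then m i else 0) = sum m (J - sym_diff S T)"
        using J by (simp add: sum.inter_filter[symmetric] set_diff_eq)
      also have "\<dots> = sum m J - sum m (sym_diff S T)"
        by (rule sum_diff[OF J \<open>sym_diff S T \<subseteq> J\<close>])
      also have "\<dots> \<le> (1 - e) * sum m J" using sep[OF p(2-4)] by (simp add: algebra_simps)
      finally show "(\<Sum>i\<in>J. if i \<notin> sym_diff (fst p) (snd p) then m i else 0) \<le> (1 - e) * sum m J"
        by (simp add: p)
    qed
    also have "\<dots> = (\<Sum>i\<in>J. m i * ((1 - e) * real (card U)))"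
      by (simp add: sum_distrib_right[symmetric] mult_ac)
    finally show False by simp
  qed
  then obtain i where i: "i \<in> J" "real (card (V i)) \<le> (1 - e) * real (card U)" by blast
  have "{(S, T) \<in> G \<times> G. S \<noteq> T \<and> S \<inter> insert i K = T \<inter> insert i K} \<subseteq> V i"
    by (auto simp: V_def U_def)
  moreover have "finite (V i)" using finite_subset[of "V i" U] \<open>finite U\<close> by (auto simp: V_def)
  ultimately have "real (card {(S, T) \<in> G \<times> G. S \<noteq> T \<and> S \<inter> insert i K = T \<inter> insert i K})
      \<le> real (card (V i))"
    by (simp add: card_mono)
  also have "\<dots> \<le> (1 - e) * ((1 - e) ^ k * (real (card G))\<^sup>2)"
    using i(2) K(3) e unfolding U_def[symmetric]
    by (meson diff_ge_0_iff_ge mult_left_mono order_trans)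
  finally have "real (card {(S, T) \<in> G \<times> G. S \<noteq> T \<and> S \<inter> insert i K = T \<inter> insert i K})
      \<le> (1 - e) ^ Suc k * (real (card G))\<^sup>2" by (simp add: mult.assoc)
  moreover have "card (insert i K) \<le> Suc k"
    using K(2) card_insert_le_m1[of "Suc k" K i] by simp
  ultimately show ?case using i(1) K(1) by (intro exI[of _ "insert i K"]) auto
qed

text \<open>The packing bound for classes of polynomial growth. Slightly more than
  \<open>2 ln M / e\<close> points already separate all \<open>M = card G\<close> members, so
  \<open>M\<close> is at most the number of traces on these points, which is polynomial in
  \<open>ln M\<close>. The bound is free of \<open>card J\<close>, hence later of the sample
  size.\<close>

lemma packing_card_le:
  fixes m :: "'i \<Rightarrow> real"
  assumes J: "finite J" and m: "\<And>i. i \<in> J \<Longrightarrow> m i \<ge> 0" and W: "sum m J > 0"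
    and G: "G \<subseteq> Pow J" and e: "0 < e" "e \<le> 1" and D: "D \<ge> 1"
    and sep: "\<And>S T. S \<in> G \<Longrightarrow> T \<in> G \<Longrightarrow> S \<noteq> T \<Longrightarrow> sum m (sym_diff S T) \<ge> e * sum m J"
    and growth: "\<And>K. K \<subseteq> J \<Longrightarrow> card ((\<lambda>S. S \<inter> K) ` G) \<le> (card K + 1) ^ D"
  shows "real (card G) \<le> ((4 * real D + 3) / e) ^ (2 * D)"
proof (cases "G = {}")
  case False
  have finG: "finite G" using G J by (meson finite_Pow_iff finite_subset)
  define M where "M = real (card G)"
  have M: "M \<ge> 1" using False finG by (simp add: M_def Suc_leI card_gt_0_iff)
  \<comment> \<open>\<open>M\<close> occurs on both sides, since \<open>k\<close> is of order
    \<open>ln M\<close>. With \<open>M = y ^ (2 * D)\<close> the logarithm is at most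
    \<open>2 D y\<close>, which costs half of the powers of \<open>y\<close> and leads to the
    exponent \<open>2 * D\<close>. In the constant, \<open>4 D\<close> comes from
    \<open>2 ln M / e\<close>, and \<open>3\<close> from rounding \<open>k\<close> and passing to
    \<open>k + 1\<close>, absorbed by \<open>y / e \<ge> 1\<close>.\<close>
  define y where "y = root (2 * D) M"
  have y: "y \<ge> 1" using M D by (simp add: y_def real_root_ge_1_iff)
  have My: "M = y ^ (2 * D)" using M D by (simp add: y_def)
  define k where "k = nat \<lceil>2 * ln M / e\<rceil> + 1"
  have lnM: "ln M \<ge> 0" using M by simp
  have k1: "real k > 2 * ln M / e" and k2: "real k \<le> 2 * ln M / e + 2"
    using lnM e by (simp_all add: k_def) linarith+
  obtain K where K: "K \<subseteq> J" "card K \<le> k"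
    "real (card {(S, T) \<in> G \<times> G. S \<noteq> T \<and> S \<inter> K = T \<inter> K}) \<le> (1 - e) ^ k * M\<^sup>2"
    using exists_separating_points[OF J m W finG G e(2) sep, of k] by (auto simp: M_def)
  have "(1 - e) ^ k \<le> exp (- e) ^ k"
    using e exp_ge_add_one_self[of "- e"] by (intro power_mono) auto
  also have "\<dots> = exp (- (e * real k))" by (simp add: exp_of_nat_mult[symmetric] mult.commute)
  also have "\<dots> < exp (- (2 * ln M))" using k1 e by (simp add: field_simps)
  also have "\<dots> = 1 / M\<^sup>2" using M by (simp add: exp_minus exp_double inverse_eq_divide)
  finally have "(1 - e) ^ k * M\<^sup>2 < 1" using M by (simp add: field_simps)
  then have "card {(S, T) \<in> G \<times> G. S \<noteq> T \<and> S \<inter> K = T \<inter> K} = 0" using K(3) by linarith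
  moreover have "finite {(S, T) \<in> G \<times> G. S \<noteq> T \<and> S \<inter> K = T \<inter> K}"
    by (rule finite_subset[of _ "G \<times> G"]) (use finG in auto)
  ultimately have "inj_on (\<lambda>S. S \<inter> K) G" by (auto simp: inj_on_def)
  then have "card G \<le> (card K + 1) ^ D" using growth[OF K(1)] by (simp add: card_image)
  also have "\<dots> \<le> (k + 1) ^ D" using K(2) by (intro power_mono) auto
  finally have "card G \<le> (k + 1) ^ D" .
  then have "real (card G) \<le> real ((k + 1) ^ D)" by (simp only: of_nat_le_iff)
  then have "M \<le> (real k + 1) ^ D" by (simp add: M_def add.commute)
  also have "\<dots> \<le> (((4 * real D + 3) / e) * y) ^ D"
  proof (rule power_mono)
    have "ln M = 2 * real D * ln y" using y by (simp add: My ln_realpow)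
    also have "\<dots> \<le> 2 * real D * y" using y by (intro mult_left_mono ln_bound) auto
    finally have "2 * ln M / e \<le> 4 * real D * y / e" using e by (simp add: field_simps)
    moreover have "1 * 1 \<le> y * (1 / e)" using y e by (intro mult_mono) auto
    then have "3 \<le> 3 * y / e" by simp
    ultimately show "real k + 1 \<le> (4 * real D + 3) / e * y"
      using k2 by (simp add: add_divide_distrib distrib_right)
  qed simp
  finally have "y ^ D * y ^ D \<le> ((4 * real D + 3) / e) ^ D * y ^ D"
    unfolding My mult_2 power_add power_mult_distrib .
  then have "y ^ D \<le> ((4 * real D + 3) / e) ^ D" using y by simp
  then have "y \<le> (4 * real D + 3) / e"
    using power_mono_iff[of y "(4 * real D + 3) / e" D] y e D by simp
  then have "y ^ (2 * D) \<le> ((4 * real D + 3) / e) ^ (2 * D)" using y by (intro power_mono) auto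
  then show ?thesis using My by (simp add: M_def)
qed (use e in simp)

section \<open>Rademacher averages\<close>

text \<open>Sign vectors on \<open>J\<close> are encoded by the set \<open>I \<subseteq> J\<close> of positive coordinates.\<close>

definition rsum :: "'i set \<Rightarrow> 'i set \<Rightarrow> ('i \<Rightarrow> real) \<Rightarrow> real" where
  "rsum J I a = (\<Sum>i\<in>J. if i \<in> I then a i else - a i)"

text \<open>Expectation over independent fair signs, as a finite average: any function of the sign
  pattern can be averaged without integrability conditions.\<close>

definition signavg :: "'i set \<Rightarrow> ('i set \<Rightarrow> real) \<Rightarrow> real" where
  "signavg J F = (\<Sum>I\<in>Pow J. F I) / 2 ^ card J"

lemma signavg_mono: "(\<And>I. I \<subseteq> J \<Longrightarrow> F I \<le> G I) \<Longrightarrow> signavg J F \<le> signavg J G"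
  unfolding signavg_def by (intro divide_right_mono sum_mono) auto

lemma signavg_add: "signavg J (\<lambda>I. F I + G I) = signavg J F + signavg J G"
  by (simp add: signavg_def sum.distrib add_divide_distrib)

lemma signavg_cmult: "signavg J (\<lambda>I. c * F I) = c * signavg J F"
  by (simp add: signavg_def sum_distrib_left)

lemma signavg_const: "finite J \<Longrightarrow> signavg J (\<lambda>I. c) = c"
  by (simp add: signavg_def card_Pow)

lemma signavg_sum: "signavg J (\<lambda>I. \<Sum>k\<in>A. F k I) = (\<Sum>k\<in>A. signavg J (F k))"
  unfolding signavg_def by (subst sum.swap) (simp add: sum_divide_distrib)

lemma rsum_diff: "rsum J I a - rsum J I b = rsum J I (\<lambda>i. a i - b i)"
  unfolding rsum_def sum_subtractf[symmetric] by (intro sum.cong) auto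

lemma abs_rsum_le: "\<bar>rsum J I a\<bar> \<le> (\<Sum>i\<in>J. \<bar>a i\<bar>)"
  unfolding rsum_def by (rule order_trans[OF sum_abs]) (intro sum_mono, auto)

text \<open>This is \<open>cosh x \<le> exp (x^2 / 2)\<close>, read off from the logarithmic
  inequality behind Hoeffding's lemma with probability \<open>1 / 2\<close> and range
  \<open>2 y\<close>. That is applied for \<open>y \<ge> 0\<close>; both sides are even.\<close>

lemma exp_average_le:
  fixes x :: real
  shows "exp x + exp (- x) \<le> 2 * exp (x\<^sup>2 / 2)"
proof -
  have *: "exp y + exp (- y) \<le> 2 * exp (y\<^sup>2 / 2)" if "y \<ge> 0" for y :: real
  proof -
    have eq: "1 + 1 / 2 * (exp (2 * y) - 1) = (exp y + exp (- y)) / 2 * exp y"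
      by (simp add: field_simps exp_double[of y, unfolded mult.commute[of 2 y]] power2_eq_square exp_minus)
    have "- (2 * y) * (1 / 2) + ln (1 + 1 / 2 * (exp (2 * y) - 1)) \<le> (2 * y)\<^sup>2 / 8"
      using that by (intro Hoeffdings_lemma_aux) auto
    moreover have "ln ((exp y + exp (- y)) / 2 * exp y) = ln ((exp y + exp (- y)) / 2) + y"
      using add_pos_pos[OF exp_gt_zero[of y] exp_gt_zero[of "- y"]] by (subst ln_mult) auto
    ultimately have "ln ((exp y + exp (- y)) / 2) \<le> y\<^sup>2 / 2"
      unfolding eq by (simp add: power2_eq_square)
    moreover have pos: "(exp y + exp (- y)) / 2 > 0" by (simp add: add_pos_pos)
    ultimately have "(exp y + exp (- y)) / 2 \<le> exp (y\<^sup>2 / 2)"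
      by (metis exp_le_cancel_iff exp_ln)
    then show ?thesis by simp
  qed
  show ?thesis using *[of x] *[of "- x"] by (cases "x \<ge> 0") auto
qed

text \<open>Independence of the signs: the exponential is a product over coordinates, and summing
  over \<open>I\<close> is the expansion of the product of the factors
  \<open>exp (a i) + exp (- a i)\<close>.\<close>

lemma signavg_exp_rsum_le:
  assumes "finite J"
  shows "signavg J (\<lambda>I. exp (rsum J I a)) \<le> exp ((\<Sum>i\<in>J. (a i)\<^sup>2) / 2)"
proof -
  have "exp (rsum J I a) = (\<Prod>i\<in>I. exp (a i)) * (\<Prod>i\<in>J - I. exp (- a i))" if "I \<subseteq> J" for I
  proof -
    have "rsum J I a = (\<Sum>i\<in>I. a i) + (\<Sum>i\<in>J - I. - a i)"
      unfolding rsum_def using that assms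
      by (subst sum.subset_diff[OF that assms]) (auto simp: add.commute intro!: arg_cong2[where f = "(+)"] sum.cong)
    then show ?thesis using assms that by (simp add: exp_add exp_sum finite_subset)
  qed
  then have "(\<Sum>I\<in>Pow J. exp (rsum J I a)) = (\<Prod>i\<in>J. exp (a i) + exp (- a i))"
    by (subst prod_add[OF assms]) (auto intro!: sum.cong)
  also have "\<dots> \<le> (\<Prod>i\<in>J. 2 * exp ((a i)\<^sup>2 / 2))"
    by (intro prod_mono) (auto intro: exp_average_le add_nonneg_nonneg)
  also have "\<dots> = 2 ^ card J * exp ((\<Sum>i\<in>J. (a i)\<^sup>2) / 2)"
    using assms by (simp add: prod.distrib exp_sum sum_divide_distrib)
  finally show ?thesis by (simp add: signavg_def field_simps)
qed

lemma rsum_cmult: "rsum J I (\<lambda>i. c * a i) = c * rsum J I a"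
  by (simp add: rsum_def sum_distrib_left if_distrib[where f = "\<lambda>x. c * x"] cong: if_cong)

text \<open>Maxima are expressed through dominating functions \<open>U\<close>: these add up along a chain.\<close>

lemma rademacher_finite_max:
  fixes a :: "'t \<Rightarrow> 'i \<Rightarrow> real"
  assumes J: "finite J" and T: "finite T" "real (card T) \<le> N" and N: "N \<ge> 1" and s: "s \<ge> 0"
    and a: "\<And>t. t \<in> T \<Longrightarrow> (\<Sum>i\<in>J. (a t i)\<^sup>2) \<le> s\<^sup>2"
  obtains U where "\<And>I t. I \<subseteq> J \<Longrightarrow> t \<in> T \<Longrightarrow> \<bar>rsum J I (a t)\<bar> \<le> U I"
    and "signavg J U \<le> s * sqrt (2 * ln (2 * N))"
\<comment> \<open>Separated off because \<open>l\<close> divides by \<open>s\<close> and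
  \<open>Max\<close> needs a nonempty set.\<close>
proof (cases "s = 0 \<or> T = {}")
  case True
  have "\<bar>rsum J I (a t)\<bar> \<le> 0" if "t \<in> T" for I t
  proof -
    have "(\<Sum>i\<in>J. (a t i)\<^sup>2) \<le> 0" using a[OF that] True that by auto
    then have "\<forall>i\<in>J. a t i = 0"
      using J by (metis (no_types, lifting) antisym power_eq_0_iff sum_nonneg sum_nonneg_eq_0_iff zero_le_power2)
    then have "rsum J I (a t) = 0" unfolding rsum_def by (intro sum.neutral) auto
    then show ?thesis by simp
  qed
  then show ?thesis using that[of "\<lambda>_. 0"] s N by (simp add: signavg_const[OF J])
next
  case False
  then have "s > 0" using s by simp
  define U where "U I = Max ((\<lambda>t. \<bar>rsum J I (a t)\<bar>) ` T)" for I
  \<comment> \<open>The minimiser of \<open>ln (2 N) / l + l s^2 / 2\<close>; the factor 2 in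
    \<open>2 * N\<close> accounts for both signs in the absolute value.\<close>
  define l where "l = sqrt (2 * ln (2 * N)) / s"
  define L where "L = ln (2 * N) + l\<^sup>2 * s\<^sup>2 / 2"
  have lnN: "ln (2 * N) > 0" using N by simp
  then have "l > 0" using \<open>s > 0\<close> by (simp add: l_def)
  have dom: "\<bar>rsum J I (a t)\<bar> \<le> U I" if "t \<in> T" for I t
    unfolding U_def using that T by (intro Max_ge) auto
  have expU: "exp (l * U I) \<le> (\<Sum>t\<in>T. exp (rsum J I (\<lambda>i. l * a t i)) + exp (rsum J I (\<lambda>i. - l * a t i)))" for I
  proof -
    have "U I \<in> (\<lambda>t. \<bar>rsum J I (a t)\<bar>) ` T"
      unfolding U_def using T False by (intro Max_in) auto
    then obtain t where t: "t \<in> T" "U I = \<bar>rsum J I (a t)\<bar>" by auto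
    have "exp (l * U I) \<le> exp (rsum J I (\<lambda>i. l * a t i)) + exp (rsum J I (\<lambda>i. - l * a t i))"
      unfolding t(2) rsum_cmult by (cases "rsum J I (a t) \<ge> 0") auto
    also have "\<dots> \<le> (\<Sum>t\<in>T. exp (rsum J I (\<lambda>i. l * a t i)) + exp (rsum J I (\<lambda>i. - l * a t i)))"
      using t T by (intro member_le_sum) (auto intro: add_nonneg_nonneg)
    finally show ?thesis .
  qed
  have mgf: "signavg J (\<lambda>I. exp (rsum J I (\<lambda>i. c * a t i))) \<le> exp (l\<^sup>2 * s\<^sup>2 / 2)"
    if "t \<in> T" "c\<^sup>2 = l\<^sup>2" for c t
  proof -
    have "(\<Sum>i\<in>J. (c * a t i)\<^sup>2) / 2 \<le> l\<^sup>2 * s\<^sup>2 / 2"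
      using a[OF that(1)] that(2) by (simp add: power_mult_distrib sum_distrib_left[symmetric] mult_left_mono)
    then show ?thesis using signavg_exp_rsum_le[OF J] by (meson exp_le_cancel_iff order_trans)
  qed
  have "signavg J (\<lambda>I. exp (l * U I))
      \<le> signavg J (\<lambda>I. \<Sum>t\<in>T. exp (rsum J I (\<lambda>i. l * a t i)) + exp (rsum J I (\<lambda>i. - l * a t i)))"
    by (intro signavg_mono expU)
  also have "\<dots> \<le> (\<Sum>t\<in>T. exp (l\<^sup>2 * s\<^sup>2 / 2) + exp (l\<^sup>2 * s\<^sup>2 / 2))"
    unfolding signavg_sum signavg_add by (intro sum_mono add_mono mgf) auto
  also have "\<dots> = 2 * real (card T) * exp (l\<^sup>2 * s\<^sup>2 / 2)" by simp
  also have "\<dots> \<le> 2 * N * exp (l\<^sup>2 * s\<^sup>2 / 2)" using T by (intro mult_right_mono) auto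
  also have "\<dots> = exp L" using N by (simp add: L_def exp_add)
  finally have E: "signavg J (\<lambda>I. exp (l * U I)) \<le> exp L" .
  \<comment> \<open>Jensen's inequality in tangent form: \<open>exp\<close> lies above its tangent
    at \<open>L\<close>. Since \<open>L\<close> is the exponent in the bound \<open>E\<close>, the
    averaged right-hand side is at most \<open>L\<close>.\<close>
  have "l * U I \<le> exp (- L) * exp (l * U I) + (L - 1)" for I
    using exp_ge_add_one_self[of "l * U I - L"] by (simp add: exp_diff exp_minus field_simps)
  then have "signavg J (\<lambda>I. l * U I) \<le> signavg J (\<lambda>I. exp (- L) * exp (l * U I) + (L - 1))"
    by (intro signavg_mono)
  also have "\<dots> = exp (- L) * signavg J (\<lambda>I. exp (l * U I)) + (L - 1)"
    by (simp add: signavg_add signavg_cmult signavg_const[OF J])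
  also have "\<dots> \<le> exp (- L) * exp L + (L - 1)" using E by (intro add_right_mono mult_left_mono) auto
  also have "\<dots> = L" by (simp add: exp_minus)
  finally have "l * signavg J U \<le> L" by (simp add: signavg_cmult)
  moreover have "L = l * (s * sqrt (2 * ln (2 * N)))"
    using \<open>s > 0\<close> lnN by (simp add: L_def l_def power_divide field_simps)
  ultimately have "signavg J U \<le> s * sqrt (2 * ln (2 * N))" using \<open>l > 0\<close> by simp
  then show ?thesis using that dom by blast
qed

section \<open>Chaining through nets of index sets\<close>

definition chain_const :: "nat \<Rightarrow> real" where
  "chain_const D = 2 + 4 * real D * (8 * real D + 8)"

lemma chain_const_ge: "chain_const D \<ge> 2"
  by (simp add: chain_const_def)

text \<open>The logarithm of the number of pairs of net points at levels
  \<open>j \<le> Suc k\<close> and \<open>k\<close> grows linearly in \<open>k\<close>, and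
  \<open>chain_const D * (k + 1)\<close> dominates twice this logarithm. As that quantity is at
  least 1, it also dominates the square root. The true order \<open>sqrt (k + 1)\<close> is given
  away, because the sum of \<open>(k + 1) / 2 ^ k\<close> converges anyway.\<close>

lemma sqrt_ln_cover_le:
  assumes D: "D \<ge> 1" and j: "j \<le> Suc k"
    and M: "M = ((4 * real D + 3) / (1 / 4 ^ k)) ^ (2 * D)" and M': "M' = ((4 * real D + 3) / (1 / 4 ^ j)) ^ (2 * D)"
  shows "sqrt (2 * ln (2 * (M' * M))) \<le> chain_const D * (real k + 1)"
proof -
  have ln4: "ln (4::real) \<le> 2"
  proof -
    have "ln (4::real) = 2 * ln 2" using ln_realpow[of 2 2] by simp
    then show ?thesis using ln_le_minus_one[of "2::real"] by simp
  qed
  have lnM: "ln (((4 * real D + 3) / (1 / 4 ^ j)) ^ (2 * D)) \<le> 2 * real D * (4 * real D + 3 + 2 * real j)" for j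
  proof -
    have "ln (((4 * real D + 3) / (1 / 4 ^ j)) ^ (2 * D)) = 2 * real D * (ln (4 * real D + 3) + real j * ln 4)"
      using D by (simp add: ln_realpow ln_mult)
    also have "\<dots> \<le> 2 * real D * ((4 * real D + 3) + real j * 2)"
      using ln4 D by (intro mult_left_mono add_mono ln_bound) auto
    finally show ?thesis by (simp add: mult.commute)
  qed
  have pos: "((4 * real D + 3) / (1 / 4 ^ j)) ^ (2 * D) > 0" for j by (simp add: add_nonneg_pos)
  have "ln (2 * (M' * M)) = ln 2 + (ln M' + ln M)"
    using pos[of k] pos[of j] unfolding M M' by (simp only: ln_mult zero_less_mult_iff) (simp add: ln_mult)
  also have "\<dots> \<le> 1 + (2 * real D * (4 * real D + 3 + 2 * real j) + 2 * real D * (4 * real D + 3 + 2 * real k))"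
    using lnM[of k] lnM[of j] ln_le_minus_one[of "2::real"] unfolding M M' by (intro add_mono) auto
  also have "\<dots> \<le> 1 + (2 * real D * (4 * real D + 3 + 2 * (real k + 1)) + 2 * real D * (4 * real D + 3 + 2 * real k))"
    using j by (intro add_mono mult_left_mono) auto
  finally have "2 * ln (2 * (M' * M)) \<le> 2 + 4 * real D * (8 * real D + 8 + 4 * real k)"
    by (simp add: algebra_simps)
  also have "\<dots> \<le> chain_const D * (real k + 1)"
  proof -
    have "0 \<le> 32 * (real D * real D) * real k" by simp
    then show ?thesis unfolding chain_const_def by (simp add: algebra_simps)
  qed
  also have "\<dots> \<le> (chain_const D * (real k + 1)) * (chain_const D * (real k + 1))"
  proof -
    have "1 * 1 \<le> chain_const D * (real k + 1)" using chain_const_ge[of D] by (intro mult_mono) auto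
    then show ?thesis
      using mult_left_mono[of 1 "chain_const D * (real k + 1)" "chain_const D * (real k + 1)"] by linarith
  qed
  finally have "2 * ln (2 * (M' * M)) \<le> (chain_const D * (real k + 1))\<^sup>2" by (simp add: power2_eq_square)
  then show ?thesis using chain_const_ge[of D] by (intro real_le_lsqrt) auto
qed

lemma sum_sym_diff_triangle:
  fixes m :: "'i \<Rightarrow> real"
  assumes "finite J" "A \<subseteq> J" "B \<subseteq> J" "C \<subseteq> J" "\<And>i. m i \<ge> 0"
  shows "sum m (sym_diff A C) \<le> sum m (sym_diff A B) + sum m (sym_diff B C)"
proof -
  have "sum m (sym_diff A C) \<le> sum m (sym_diff A B \<union> sym_diff B C)"
    using assms by (intro sum_mono2) (auto intro: finite_subset)
  also have "\<dots> \<le> sum m (sym_diff A B) + sum m (sym_diff B C)"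
    using assms by (subst sum_Un) (auto intro: finite_subset sum_nonneg)
  finally show ?thesis .
qed

text \<open>A packing of largest cardinality is a net, since a member far from all its points could
  be added.\<close>

lemma maximal_packing_covers:
  fixes d :: "'s \<Rightarrow> 's \<Rightarrow> real"
  assumes "finite F" and sym: "\<And>S T. d S T = d T S" and d0: "\<And>S. d S S < e"
  obtains G where "G \<subseteq> F" "\<And>S T. S \<in> G \<Longrightarrow> T \<in> G \<Longrightarrow> S \<noteq> T \<Longrightarrow> d S T \<ge> e"
    "\<And>S. S \<in> F \<Longrightarrow> \<exists>T\<in>G. d S T < e"
proof -
  define P where "P G \<longleftrightarrow> G \<subseteq> F \<and> (\<forall>S\<in>G. \<forall>T\<in>G. S \<noteq> T \<longrightarrow> d S T \<ge> e)" for G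
  have "P {}" by (simp add: P_def)
  moreover have "\<forall>G. P G \<longrightarrow> card G < Suc (card F)" using assms(1) by (auto simp: P_def card_mono less_Suc_eq_le)
  ultimately obtain G where G: "P G" "\<And>G'. P G' \<Longrightarrow> card G' \<le> card G"
    using ex_has_greatest_nat[of P "{}" card "Suc (card F)"] by metis
  have "\<exists>T\<in>G. d S T < e" if "S \<in> F" for S
  proof (rule ccontr)
    assume "\<not> ?thesis"
    then have far: "\<And>T. T \<in> G \<Longrightarrow> d S T \<ge> e" by auto
    then have "S \<notin> G" using d0[of S] by force
    have "P (insert S G)" using G(1) far sym \<open>S \<in> F\<close> unfolding P_def by (metis insert_iff insert_subset)
    then have "card (insert S G) \<le> card G" by (rule G(2))
    moreover have "finite G" using G(1) assms(1) finite_subset by (auto simp: P_def)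
    ultimately show False using \<open>S \<notin> G\<close> by simp
  qed
  then show ?thesis using that G(1) by (auto simp: P_def)
qed

text \<open>For fixed \<open>a\<close>, the signed sums over index sets are sub-Gaussian for the
  distance whose square is the \<open>a^2\<close>-weight of the symmetric difference. By the packing
  bound, nets at scale \<open>w / 2 ^ j\<close>, with \<open>w\<close> the Euclidean norm of
  \<open>a\<close>, have size polynomial in \<open>2 ^ j\<close>. Each member is linked to its
  level-\<open>k\<close> approximation through finer ones, and two close members are compared at
  level \<open>k\<close> by a maximum over pairs of net points. The level \<open>k\<close> stays
  free: raising it shrinks the term with the norm of \<open>a\<close>, while the radius
  \<open>r\<close> pays only the factor \<open>k + 1\<close>.\<close>

lemma chaining:
  fixes a :: "'i \<Rightarrow> real"
  assumes J: "finite J" and F: "F \<subseteq> Pow J" and D: "D \<ge> 1"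
    and growth: "\<And>K. K \<subseteq> J \<Longrightarrow> card ((\<lambda>S. S \<inter> K) ` F) \<le> (card K + 1) ^ D"
    and PP: "PP \<subseteq> F \<times> F" and r: "r \<ge> 0"
    and close: "\<And>S T. (S, T) \<in> PP \<Longrightarrow> (\<Sum>i\<in>sym_diff S T. (a i)\<^sup>2) \<le> r\<^sup>2"
  obtains U where
    "\<And>I S T. I \<subseteq> J \<Longrightarrow> (S, T) \<in> PP \<Longrightarrow> \<bar>rsum J I (\<lambda>i. a i * (indicator S i - indicator T i))\<bar> \<le> U I"
    "signavg J U \<le> 20 * chain_const D * (real k + 1) * (sqrt (\<Sum>i\<in>J. (a i)\<^sup>2) / 2 ^ k + r)"
proof -
  define m where "m i = (a i)\<^sup>2" for i
  define W where "W = sum m J"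
  define w where "w = sqrt W"
  define L where "L = chain_const D"
  have m0: "m i \<ge> 0" for i by (simp add: m_def)
  have W0: "W \<ge> 0" by (simp add: W_def m0 sum_nonneg)
  have L2: "L \<ge> 2" by (simp add: L_def chain_const_ge)
  have finF: "finite F" using F J by (meson finite_Pow_iff finite_subset)
  define Z where "Z S I = rsum J I (\<lambda>i. a i * indicator S i)" for S I
  have Zdiff: "rsum J I (\<lambda>i. a i * (indicator S i - indicator T i)) = Z S I - Z T I" for S T I
    unfolding Z_def rsum_diff by (simp add: right_diff_distrib)
  have sq: "(\<Sum>i\<in>J. (a i * (indicator S i - indicator T i))\<^sup>2) = sum m (sym_diff S T)"
    if "S \<subseteq> J" "T \<subseteq> J" for S T
  proof -
    have "(\<Sum>i\<in>J. (a i * (indicator S i - indicator T i))\<^sup>2) = (\<Sum>i\<in>J. if i \<in> sym_diff S T then m i else 0)"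
      by (intro sum.cong) (auto simp: m_def indicator_def)
    also have "\<dots> = sum m (J \<inter> sym_diff S T)" using J by (simp add: sum.inter_restrict)
    also have "J \<inter> sym_diff S T = sym_diff S T" using that by auto
    finally show ?thesis .
  qed
  show ?thesis
  proof (cases "W = 0")
    case True
    then have "a i = 0" if "i \<in> J" for i
      using that J m0 sum_nonneg_eq_0_iff[of J m] by (auto simp: W_def m_def)
    then have "rsum J I (\<lambda>i. a i * (indicator S i - indicator T i)) = 0" for I S T
      unfolding rsum_def by (intro sum.neutral) auto
    then show ?thesis using that[of "\<lambda>_. 0"] r L2
      by (auto simp: signavg_const[OF J] L_def sum_nonneg)
  next
    case False
    then have "W > 0" using W0 by simp
    have "\<exists>G\<subseteq>F. (\<forall>S\<in>G. \<forall>T\<in>G. S \<noteq> T \<longrightarrow> sum m (sym_diff S T) \<ge> (1 / 4 ^ j) * W)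
        \<and> (\<forall>S\<in>F. \<exists>T\<in>G. sum m (sym_diff S T) < (1 / 4 ^ j) * W)" for j :: nat
    proof -
      have d: "sum m (sym_diff S T) = sum m (sym_diff T S)" "sum m (sym_diff S S) < (1 / 4 ^ j) * W" for S T
        using \<open>W > 0\<close> by (simp_all add: Un_commute)
      obtain G where "G \<subseteq> F"
          "\<And>S T. S \<in> G \<Longrightarrow> T \<in> G \<Longrightarrow> S \<noteq> T \<Longrightarrow> sum m (sym_diff S T) \<ge> (1 / 4 ^ j) * W"
          "\<And>S. S \<in> F \<Longrightarrow> \<exists>T\<in>G. sum m (sym_diff S T) < (1 / 4 ^ j) * W"
        using maximal_packing_covers[OF finF, of "\<lambda>S T. sum m (sym_diff S T)", OF d] by metis
      then show ?thesis by (intro exI[of _ G]) simp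
    qed
    then obtain G where G: "\<And>j. G j \<subseteq> F"
      "\<And>j S T. S \<in> G j \<Longrightarrow> T \<in> G j \<Longrightarrow> S \<noteq> T \<Longrightarrow> sum m (sym_diff S T) \<ge> (1 / 4 ^ j) * W"
      "\<And>j S. S \<in> F \<Longrightarrow> \<exists>T\<in>G j. sum m (sym_diff S T) < (1 / 4 ^ j) * W"
      by metis
    define p where "p j S = (SOME T. T \<in> G j \<and> sum m (sym_diff S T) < (1 / 4 ^ j) * W)" for j S
    have p: "p j S \<in> G j \<and> sum m (sym_diff S (p j S)) < (1 / 4 ^ j) * W" if "S \<in> F" for j S
      unfolding p_def by (rule someI_ex) (use G(3)[OF that] in blast)
    have GJ: "S \<subseteq> J" if "S \<in> G j" for S j using that G(1) F by blast
    define N where "N j = ((4 * real D + 3) / (1 / 4 ^ j)) ^ (2 * D)" for j :: nat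
    have cardG: "real (card (G j)) \<le> N j" for j
      unfolding N_def
    proof (rule packing_card_le[OF J, where m = m])
      show "sum m J > 0" using \<open>W > 0\<close> by (simp add: W_def)
      show "G j \<subseteq> Pow J" using G(1) F by blast
      show "sum m (sym_diff S T) \<ge> 1 / 4 ^ j * sum m J" if "S \<in> G j" "T \<in> G j" "S \<noteq> T" for S T
        using G(2)[OF that] by (simp add: W_def)
      show "card ((\<lambda>S. S \<inter> K) ` G j) \<le> (card K + 1) ^ D" if "K \<subseteq> J" for K
        using G(1) finF by (intro order_trans[OF card_mono growth[OF that]]) auto
    qed (use D m0 in auto)
    have N1: "N j \<ge> 1" for j
    proof -
      have "(1::real) * 1 \<le> (4 * real D + 3) * 4 ^ j" by (intro mult_mono) auto
      then show ?thesis unfolding N_def by (intro one_le_power) simp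
    qed
    have finG: "finite (G j)" for j using G(1) finF finite_subset by blast
    have w: "w \<ge> 0" "w\<^sup>2 = W" using W0 by (simp_all add: w_def)
    have half: "W / 4 ^ j = (w / 2 ^ j)\<^sup>2" for j :: nat
      using w by (simp add: power_divide power_mult[symmetric] power2_eq_square power_mult_distrib[symmetric])
    \<comment> \<open>Serves both the links, with \<open>j = Suc l\<close>, and the comparison at
      the coarsest level, with \<open>j = l = k\<close>.\<close>
    have max_pairs: "\<exists>U. (\<forall>I\<subseteq>J. \<forall>S\<in>G j. \<forall>T\<in>G l. sum m (sym_diff S T) \<le> s\<^sup>2 \<longrightarrow> \<bar>Z S I - Z T I\<bar> \<le> U I)
        \<and> signavg J U \<le> s * (L * (real l + 1))" if s: "s \<ge> 0" and jl: "j \<le> Suc l" for s j l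
    proof -
      define TT where "TT = {(S, T) \<in> G j \<times> G l. sum m (sym_diff S T) \<le> s\<^sup>2}"
      have finTT: "finite TT" unfolding TT_def by (rule finite_subset[of _ "G j \<times> G l"]) (auto simp: finG)
      have "card TT \<le> card (G j \<times> G l)" unfolding TT_def by (rule card_mono) (auto simp: finG)
      then have "card TT \<le> card (G j) * card (G l)" by (simp add: card_cartesian_product)
      then have "real (card TT) \<le> real (card (G j)) * real (card (G l))"
        by (metis of_nat_le_iff of_nat_mult)
      also have "\<dots> \<le> N j * N l" using cardG N1[of j] by (intro mult_mono) auto
      finally have cTT: "real (card TT) \<le> N j * N l" .
      have NN: "N j * N l \<ge> 1" using mult_mono[OF N1[of j] N1[of l]] N1[of j] by simp
      obtain U where U: "\<And>I t. I \<subseteq> J \<Longrightarrow> t \<in> TT \<Longrightarrow>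
            \<bar>rsum J I (\<lambda>i. a i * (indicator (fst t) i - indicator (snd t) i))\<bar> \<le> U I"
          "signavg J U \<le> s * sqrt (2 * ln (2 * (N j * N l)))"
      proof (rule rademacher_finite_max[OF J finTT cTT NN s])
        fix t assume "t \<in> TT"
        then have "fst t \<subseteq> J" "snd t \<subseteq> J" "sum m (sym_diff (fst t) (snd t)) \<le> s\<^sup>2"
          using GJ[of "fst t" j] GJ[of "snd t" l] by (auto simp: TT_def)
        then show "(\<Sum>i\<in>J. (a i * (indicator (fst t) i - indicator (snd t) i))\<^sup>2) \<le> s\<^sup>2"
          using sq by simp
      qed blast
      have "signavg J U \<le> s * (L * (real l + 1))"
        using U(2) mult_left_mono[OF sqrt_ln_cover_le[OF D jl N_def N_def] s] by (simp add: L_def)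
      moreover have "\<bar>Z S I - Z T I\<bar> \<le> U I"
        if "I \<subseteq> J" "S \<in> G j" "T \<in> G l" "sum m (sym_diff S T) \<le> s\<^sup>2" for I S T
        using U(1)[of I "(S, T)"] that by (simp add: TT_def Zdiff)
      ultimately show ?thesis by blast
    qed
    have s0: "r + 2 * (w / 2 ^ k) \<ge> 0" and s1: "2 * (w / 2 ^ j) \<ge> 0" for j :: nat using r w by auto
    obtain U0 where U0: "\<forall>I\<subseteq>J. \<forall>S\<in>G k. \<forall>T\<in>G k.
          sum m (sym_diff S T) \<le> (r + 2 * (w / 2 ^ k))\<^sup>2 \<longrightarrow> \<bar>Z S I - Z T I\<bar> \<le> U0 I"
        "signavg J U0 \<le> (r + 2 * (w / 2 ^ k)) * (L * (real k + 1))"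
      using max_pairs[OF s0 le_SucI[OF order_refl]] by blast
    define U1 where "U1 j = (SOME U. (\<forall>I\<subseteq>J. \<forall>S\<in>G (Suc j). \<forall>T\<in>G j.
          sum m (sym_diff S T) \<le> (2 * (w / 2 ^ j))\<^sup>2 \<longrightarrow> \<bar>Z S I - Z T I\<bar> \<le> U I)
        \<and> signavg J U \<le> 2 * (w / 2 ^ j) * (L * (real j + 1)))" for j
    have U1: "(\<forall>I\<subseteq>J. \<forall>S\<in>G (Suc j). \<forall>T\<in>G j.
          sum m (sym_diff S T) \<le> (2 * (w / 2 ^ j))\<^sup>2 \<longrightarrow> \<bar>Z S I - Z T I\<bar> \<le> U1 j I)
        \<and> signavg J (U1 j) \<le> 2 * (w / 2 ^ j) * (L * (real j + 1))" for j
      unfolding U1_def by (rule someI_ex[OF max_pairs[OF s1 order_refl]])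
    \<comment> \<open>The chain can be stopped after finitely many levels: at level
      \<open>n = k + q\<close> the Cauchy-Schwarz bound with its factor \<open>sqrt (card J)\<close>
      is already below \<open>w / 2 ^ k\<close>. Neither \<open>q\<close> nor \<open>card J\<close>
      survives in the final estimate.\<close>
    obtain q :: nat where q: "sqrt (real (card J)) < 2 ^ q"
      using real_arch_pow[of 2 "sqrt (real (card J))"] by auto
    define n where "n = k + q"
    have nk: "k \<le> n" by (simp add: n_def)
    have pow_n: "sqrt (real (card J)) * (w / 2 ^ n) \<le> w / 2 ^ k"
    proof -
      have "w * sqrt (real (card J)) \<le> w * 2 ^ q" using q w by (intro mult_left_mono) auto
      then show ?thesis by (simp add: n_def power_add field_simps)
    qed
    have link: "\<bar>Z (p (Suc j) S) I - Z (p j S) I\<bar> \<le> U1 j I" if "S \<in> F" "I \<subseteq> J" for S I j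
    proof (rule U1[THEN conjunct1, rule_format, OF that(2)])
      have *: "p (Suc j) S \<subseteq> J" "p j S \<subseteq> J" "S \<subseteq> J" using p[OF that(1)] GJ that F by blast+
      have "sum m (sym_diff (p (Suc j) S) (p j S))
          \<le> sum m (sym_diff (p (Suc j) S) S) + sum m (sym_diff S (p j S))"
        using sum_sym_diff_triangle[OF J *(1) *(3) *(2)] m0 by blast
      also have "\<dots> \<le> W / 4 ^ Suc j + W / 4 ^ j"
        using p[OF that(1), of "Suc j"] p[OF that(1), of j] by (intro add_mono) (simp_all add: Un_commute)
      also have "\<dots> \<le> 4 * (W / 4 ^ j)" using W0 by (simp add: field_simps)
      finally show "sum m (sym_diff (p (Suc j) S) (p j S)) \<le> (2 * (w / 2 ^ j))\<^sup>2"
        unfolding half power_mult_distrib by simp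
    qed (use p that in auto)
    have chain: "\<bar>Z S I - Z (p k S) I\<bar> \<le> w / 2 ^ k + (\<Sum>j=k..<n. U1 j I)" if "S \<in> F" "I \<subseteq> J" for S I
    proof -
      have SJ: "S \<subseteq> J" "p n S \<subseteq> J" using p[OF that(1)] GJ that F by blast+
      have "\<bar>Z S I - Z (p n S) I\<bar> \<le> (\<Sum>i\<in>J. \<bar>a i * (indicator S i - indicator (p n S) i)\<bar>)"
        unfolding Zdiff[symmetric] by (rule abs_rsum_le)
      also have "\<dots> \<le> L2_set (\<lambda>i. 1) J * L2_set (\<lambda>i. a i * (indicator S i - indicator (p n S) i)) J"
        using L2_set_mult_ineq[of "\<lambda>_. 1" "\<lambda>i. a i * (indicator S i - indicator (p n S) i)" J] by simp
      also have "\<dots> = sqrt (real (card J)) * sqrt (sum m (sym_diff S (p n S)))"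
        by (simp add: L2_set_def sq[OF SJ])
      also have "\<dots> \<le> sqrt (real (card J)) * (w / 2 ^ n)"
        using p[OF that(1), of n] w by (intro mult_left_mono real_le_lsqrt) (auto simp: half[symmetric])
      finally have 1: "\<bar>Z S I - Z (p n S) I\<bar> \<le> w / 2 ^ k" using pow_n by linarith
      have "Z (p n S) I - Z (p k S) I = (\<Sum>j=k..<n. Z (p (Suc j) S) I - Z (p j S) I)"
        by (rule sum_Suc_diff'[OF nk, symmetric])
      also have "\<bar>\<dots>\<bar> \<le> (\<Sum>j=k..<n. U1 j I)"
        by (rule order_trans[OF sum_abs sum_mono]) (rule link[OF that])
      finally show ?thesis using 1 by linarith
    qed
    have base: "\<bar>Z (p k S) I - Z (p k T) I\<bar> \<le> U0 I" if "(S, T) \<in> PP" "I \<subseteq> J" for S T I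
    proof (rule U0(1)[rule_format, OF that(2)])
      have ST: "S \<in> F" "T \<in> F" using that PP by auto
      then have *: "p k S \<subseteq> J" "p k T \<subseteq> J" "S \<subseteq> J" "T \<subseteq> J" using p GJ F by blast+
      have "sum m (sym_diff (p k S) (p k T)) \<le> sum m (sym_diff (p k S) S) + sum m (sym_diff S (p k T))"
        using sum_sym_diff_triangle[OF J *(1) *(3) *(2)] m0 by blast
      also have "\<dots> \<le> sum m (sym_diff (p k S) S) + (sum m (sym_diff S T) + sum m (sym_diff T (p k T)))"
        using sum_sym_diff_triangle[OF J *(3) *(4) *(2)] m0 by simp
      also have "\<dots> \<le> W / 4 ^ k + (r\<^sup>2 + W / 4 ^ k)"
        using p[OF ST(1), of k] p[OF ST(2), of k] close[OF that(1)]
        by (intro add_mono) (simp_all add: Un_commute m_def)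
      also have "\<dots> \<le> (r + 2 * (w / 2 ^ k))\<^sup>2"
      proof -
        have *: "v\<^sup>2 + (r\<^sup>2 + v\<^sup>2) \<le> (r + 2 * v)\<^sup>2" if "v \<ge> 0" for v
          using that r by (simp add: power2_eq_square algebra_simps)
        show ?thesis using *[of "w / 2 ^ k"] w(1) unfolding half by simp
      qed
      finally show "sum m (sym_diff (p k S) (p k T)) \<le> (r + 2 * (w / 2 ^ k))\<^sup>2" .
      show "p k S \<in> G k" "p k T \<in> G k" using p ST by auto
    qed
    define U where "U I = U0 I + 2 * (w / 2 ^ k) + 2 * (\<Sum>j=k..<n. U1 j I)" for I
    have "\<bar>Z S I - Z T I\<bar> \<le> U I" if "(S, T) \<in> PP" "I \<subseteq> J" for S T I
      using base[OF that] chain[of S I] chain[of T I] that PP by (auto simp: U_def)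
    moreover have "signavg J U \<le> 20 * L * (real k + 1) * (w / 2 ^ k + r)"
    proof -
      have tele: "(\<Sum>j=k..<n. (real j + 1) / 2 ^ j) \<le> 2 * (real k + 2) / 2 ^ k"
      proof -
        \<comment> \<open>A discrete antiderivative:
          \<open>h j - h (Suc j) = (j + 1) / 2 ^ j\<close>.\<close>
        define h where "h j = 2 * (real j + 2) / 2 ^ j" for j
        have "(\<Sum>j=k..<n. (real j + 1) / 2 ^ j) = (\<Sum>j=k..<n. - h (Suc j) - - h j)"
          by (intro sum.cong) (auto simp: h_def field_simps)
        also have "\<dots> = - h n - - h k" by (rule sum_Suc_diff'[OF nk])
        also have "\<dots> \<le> h k" by (simp add: h_def)
        finally show ?thesis by (simp add: h_def)
      qed
      have "signavg J U = signavg J U0 + 2 * (w / 2 ^ k) + 2 * (\<Sum>j=k..<n. signavg J (U1 j))"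
        by (simp add: U_def[abs_def] signavg_add signavg_cmult signavg_sum signavg_const[OF J])
      also have "\<dots> \<le> (r + 2 * (w / 2 ^ k)) * (L * (real k + 1)) + 2 * (w / 2 ^ k)
          + 2 * (\<Sum>j=k..<n. 2 * (w / 2 ^ j) * (L * (real j + 1)))"
        using U0(2) U1[THEN conjunct2] by (intro add_mono mult_left_mono sum_mono) auto
      also have "(\<Sum>j=k..<n. 2 * (w / 2 ^ j) * (L * (real j + 1)))
          = 2 * w * L * (\<Sum>j=k..<n. (real j + 1) / 2 ^ j)"
        by (simp add: sum_distrib_left mult_ac)
      also have "2 * w * L * (\<Sum>j=k..<n. (real j + 1) / 2 ^ j) \<le> 2 * w * L * (2 * (real k + 2) / 2 ^ k)"
        using w L2 by (intro mult_left_mono tele) auto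
      finally have A: "signavg J U \<le> (r + 2 * (w / 2 ^ k)) * (L * (real k + 1)) + 2 * (w / 2 ^ k)
          + 2 * (2 * w * L * (2 * (real k + 2) / 2 ^ k))" by simp
      define v where "v = w / 2 ^ k"
      have v: "v \<ge> 0" using w by (simp add: v_def)
      have "signavg J U \<le> L * (real k + 1) * r + 2 * v * L * (real k + 1) + 2 * v + 8 * L * (real k + 2) * v"
        using A by (simp add: v_def algebra_simps add_divide_distrib)
      also have "\<dots> \<le> 20 * L * (real k + 1) * (v + r)"
      proof -
        have "2 * v \<le> L * v" using L2 v by (intro mult_right_mono) auto
        moreover have "0 \<le> L * v * real k" "0 \<le> L * r" "0 \<le> L * r * real k" "0 \<le> L * v" using L2 v r by auto
        ultimately show ?thesis by (simp add: algebra_simps)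
      qed
      finally show ?thesis by (simp add: v_def)
    qed
    ultimately show ?thesis
      using that[of U] by (simp add: Zdiff w_def W_def m_def L_def)
  qed
qed

section \<open>Symmetrization\<close>

lemma PiM_coordinate_integral:
  fixes f :: "'a \<Rightarrow> real"
  assumes "prob_space P" "i \<in> K" "integrable P f"
  shows "integrable (PiM K (\<lambda>_. P)) (\<lambda>z. f (z i))"
    and "(\<integral>z. f (z i) \<partial>PiM K (\<lambda>_. P)) = (\<integral>x. f x \<partial>P)"
proof -
  have d: "distr (PiM K (\<lambda>_. P)) P (\<lambda>z. z i) = P"
    using assms by (intro distr_PiM_component) auto
  have m: "(\<lambda>z. z i) \<in> measurable (PiM K (\<lambda>_. P)) P"
    using assms(2) by (rule measurable_component_singleton)
  show "integrable (PiM K (\<lambda>_. P)) (\<lambda>z. f (z i))"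
    using integrable_distr[OF m, of f] assms(3) d by simp
  show "(\<integral>z. f (z i) \<partial>PiM K (\<lambda>_. P)) = (\<integral>x. f x \<partial>P)"
    using integral_distr[OF m, of f] assms(3) d by simp
qed

lemma integral_PiM_reindex:
  fixes h :: "('i \<Rightarrow> 'a) \<Rightarrow> real"
  assumes "prob_space P" "inj_on s I" "s \<in> I \<rightarrow> K" "h \<in> borel_measurable (PiM I (\<lambda>_. P))"
  shows "(\<integral>z. h (\<lambda>i\<in>I. z (s i)) \<partial>PiM K (\<lambda>_. P)) = (\<integral>x. h x \<partial>PiM I (\<lambda>_. P))"
proof -
  have "distr (PiM K (\<lambda>_. P)) (PiM I (\<lambda>_. P)) (\<lambda>z. \<lambda>i\<in>I. z (s i)) = PiM I (\<lambda>_. P)"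
    using assms by (intro distr_PiM_reindex) auto
  moreover have "(\<lambda>z. \<lambda>i\<in>I. z (s i)) \<in> measurable (PiM K (\<lambda>_. P)) (PiM I (\<lambda>_. P))"
    using assms(3) by (intro measurable_restrict measurable_component_singleton) auto
  ultimately show ?thesis using integral_distr[OF _ assms(4)] by metis
qed

lemma Max_abs_add_le:
  fixes a b c :: "'t \<Rightarrow> real"
  assumes "finite T" "T \<noteq> {}" "\<And>t. t \<in> T \<Longrightarrow> \<bar>a t\<bar> \<le> \<bar>b t\<bar> + \<bar>c t\<bar>"
  shows "(MAX t\<in>T. \<bar>a t\<bar>) \<le> (MAX t\<in>T. \<bar>b t\<bar>) + (MAX t\<in>T. \<bar>c t\<bar>)"
proof -
  have "\<bar>a t\<bar> \<le> (MAX t\<in>T. \<bar>b t\<bar>) + (MAX t\<in>T. \<bar>c t\<bar>)" if "t \<in> T" for t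
  proof -
    have "\<bar>b t\<bar> \<le> (MAX t\<in>T. \<bar>b t\<bar>)" "\<bar>c t\<bar> \<le> (MAX t\<in>T. \<bar>c t\<bar>)"
      using that assms(1) by (auto intro!: Max_ge)
    then show ?thesis using assms(3)[OF that] by linarith
  qed
  then show ?thesis using assms by (subst Max_le_iff) auto
qed

lemma integrable_MAX_abs_sum:
  fixes f :: "'t \<Rightarrow> 'a \<Rightarrow> real" and k :: "'j \<Rightarrow> 'i"
  assumes "prob_space P" "finite T" "T \<noteq> {}" "\<And>t. t \<in> T \<Longrightarrow> integrable P (f t)"
    and "\<And>j. j \<in> B \<Longrightarrow> k j \<in> K"
  shows "integrable (PiM K (\<lambda>_. P)) (\<lambda>z. MAX t\<in>T. \<bar>c t + (\<Sum>j\<in>B. e j * f t (z (k j)))\<bar>)"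
proof -
  interpret R: prob_space "PiM K (\<lambda>_. P)" using assms(1) by (intro prob_space_PiM)
  show ?thesis
    using assms by (intro integrable_MAX integrable_abs Bochner_Integration.integrable_add R.integrable_const
        Bochner_Integration.integrable_sum integrable_mult_right PiM_coordinate_integral) auto
qed

text \<open>The coordinates \<open>n..<2 * n\<close> carry an independent copy of the sample.
  Jensen's inequality replaces the means by the copy; exchanging the \<open>i\<close>-th point with
  its copy for all \<open>i\<close> outside \<open>I\<close> preserves the product measure and puts
  the sign pattern \<open>I\<close> on the differences. This holds for each \<open>I\<close>, hence
  on average. Finiteness of \<open>T\<close> makes every maximum integrable.\<close>

lemma symmetrization:
  fixes f :: "'t \<Rightarrow> 'a \<Rightarrow> real" and n :: nat
  assumes P: "prob_space P" and T: "finite T" "T \<noteq> {}"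
    and f: "\<And>t. t \<in> T \<Longrightarrow> integrable P (f t)"
  defines "Q \<equiv> PiM {..<n} (\<lambda>_. P)"
  shows "(\<integral>x. (MAX t\<in>T. \<bar>(\<Sum>i<n. f t (x i)) - real n * (\<integral>y. f t y \<partial>P)\<bar>) \<partial>Q)
    \<le> 2 * (\<integral>x. signavg {..<n} (\<lambda>I. MAX t\<in>T. \<bar>rsum {..<n} I (\<lambda>i. f t (x i))\<bar>) \<partial>Q)"
proof -
  define Q' where "Q' = PiM {n..<2 * n} (\<lambda>_. P)"
  define K where "K = {..<n} \<union> {n..<2 * n}"
  define R where "R = PiM K (\<lambda>_. P)"
  define h where "h z = (MAX t\<in>T. \<bar>\<Sum>i<n. f t (z i) - f t (z (n + i))\<bar>)" for z :: "nat \<Rightarrow> 'a"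
  define e where "e I i = (if i \<in> I then 1 else -1 :: real)" for I and i :: nat
  have rsum_e: "rsum {..<n} I a = (\<Sum>i<n. e I i * a i)" for I a
    unfolding rsum_def e_def by (intro sum.cong) auto
  interpret Q: prob_space Q unfolding Q_def using P by (intro prob_space_PiM)
  interpret Q': prob_space Q' unfolding Q'_def using P by (intro prob_space_PiM)
  interpret R: prob_space R unfolding R_def using P by (intro prob_space_PiM)
  interpret PP: product_sigma_finite "\<lambda>_::nat. P"
    using P by unfold_locales (metis prob_space_imp_sigma_finite sigma_finite_measure.sigma_finite_countable)
  have merge: "merge {..<n} {n..<2 * n} (x, y) i = x i" "merge {..<n} {n..<2 * n} (x, y) (n + i) = y (n + i)"
    if "i < n" for x y :: "nat \<Rightarrow> 'a" and i
    using that by (auto simp: merge_def)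
  have hR: "integrable R h"
  proof -
    have "integrable R (\<lambda>z. MAX t\<in>T. \<bar>0 + (\<Sum>j\<in>K. (if j < n then 1 else -1) * f t (z j))\<bar>)"
      unfolding R_def by (rule integrable_MAX_abs_sum[OF P T f, where k = "\<lambda>j. j"])
    moreover have "(\<Sum>j\<in>K. (if j < n then 1 else -1) * f t (z j)) = (\<Sum>i<n. f t (z i) - f t (z (n + i)))"
      for t and z :: "nat \<Rightarrow> 'a"
    proof -
      have "(\<Sum>j\<in>K. (if j < n then 1 else -1) * f t (z j))
          = (\<Sum>j<n. f t (z j)) + (\<Sum>j\<in>{n..<2 * n}. - f t (z j))"
        unfolding K_def by (subst sum.union_disjoint) auto
      also have "(\<Sum>j\<in>{n..<2 * n}. - f t (z j)) = (\<Sum>i<n. - f t (z (n + i)))"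
        by (rule sum.reindex_bij_witness[of _ "\<lambda>i. n + i" "\<lambda>j. j - n"]) auto
      finally show ?thesis by (simp add: sum_negf sum_subtractf)
    qed
    ultimately show ?thesis by (simp add: h_def[abs_def])
  qed
  have step1: "(MAX t\<in>T. \<bar>(\<Sum>i<n. f t (x i)) - real n * (\<integral>y. f t y \<partial>P)\<bar>)
      \<le> (\<integral>y. h (merge {..<n} {n..<2 * n} (x, y)) \<partial>Q')" for x
  proof -
    have hm: "h (merge {..<n} {n..<2 * n} (x, y))
        = (MAX t\<in>T. \<bar>(\<Sum>i<n. f t (x i)) + (\<Sum>i<n. -1 * f t (y (n + i)))\<bar>)" for y
      unfolding h_def by (intro arg_cong[where f = Max] image_cong refl) (simp add: merge sum_subtractf sum_negf)
    have int: "integrable Q' (\<lambda>y. h (merge {..<n} {n..<2 * n} (x, y)))"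
      unfolding hm Q'_def by (rule integrable_MAX_abs_sum[OF P T f]) auto
    have "\<bar>(\<Sum>i<n. f t (x i)) - real n * (\<integral>y. f t y \<partial>P)\<bar>
        \<le> (\<integral>y. h (merge {..<n} {n..<2 * n} (x, y)) \<partial>Q')" if t: "t \<in> T" for t
    proof -
      have ci: "integrable Q' (\<lambda>y. f t (y (n + i)))" "(\<integral>y. f t (y (n + i)) \<partial>Q') = (\<integral>y. f t y \<partial>P)"
        if "i < n" for i
        using that PiM_coordinate_integral[OF P _ f[OF t], of "n + i" "{n..<2 * n}"] by (auto simp: Q'_def)
      have i2: "integrable Q' (\<lambda>y. (\<Sum>i<n. f t (x i)) + (\<Sum>i<n. -1 * f t (y (n + i))))"
        using ci by (intro Bochner_Integration.integrable_add Q'.integrable_const Bochner_Integration.integrable_sum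
            integrable_mult_right) auto
      have "(\<Sum>i<n. f t (x i)) - real n * (\<integral>y. f t y \<partial>P)
          = (\<integral>y. (\<Sum>i<n. f t (x i)) + (\<Sum>i<n. -1 * f t (y (n + i))) \<partial>Q')"
      proof -
        have "integrable Q' (\<lambda>y. \<Sum>i<n. f t (y (n + i)))"
          using ci by (intro Bochner_Integration.integrable_sum) auto
        moreover have "(\<integral>y. (\<Sum>i<n. f t (y (n + i))) \<partial>Q') = real n * (\<integral>y. f t y \<partial>P)"
          using ci by (subst Bochner_Integration.integral_sum) auto
        ultimately show ?thesis by (simp add: sum_negf Q'.prob_space)
      qed
      also have "\<bar>\<dots>\<bar> \<le> (\<integral>y. \<bar>(\<Sum>i<n. f t (x i)) + (\<Sum>i<n. -1 * f t (y (n + i)))\<bar> \<partial>Q')"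
        by (rule integral_abs_bound)
      also have "\<dots> \<le> (\<integral>y. h (merge {..<n} {n..<2 * n} (x, y)) \<partial>Q')"
      proof (rule integral_mono)
        fix y
        show "\<bar>(\<Sum>i<n. f t (x i)) + (\<Sum>i<n. -1 * f t (y (n + i)))\<bar> \<le> h (merge {..<n} {n..<2 * n} (x, y))"
          unfolding hm using T t by (intro Max_ge) auto
      qed (use i2 int in auto)
      finally show ?thesis .
    qed
    then show ?thesis using T by (subst Max_le_iff) auto
  qed
  have "(\<integral>x. (MAX t\<in>T. \<bar>(\<Sum>i<n. f t (x i)) - real n * (\<integral>y. f t y \<partial>P)\<bar>) \<partial>Q)
      \<le> (\<integral>x. (\<integral>y. h (merge {..<n} {n..<2 * n} (x, y)) \<partial>Q') \<partial>Q)"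
  proof (rule integral_mono)
    have "integrable Q (\<lambda>x. MAX t\<in>T. \<bar>- real n * (\<integral>y. f t y \<partial>P) + (\<Sum>i<n. 1 * f t (x i))\<bar>)"
      unfolding Q_def by (rule integrable_MAX_abs_sum[OF P T f]) auto
    then show "integrable Q (\<lambda>x. MAX t\<in>T. \<bar>(\<Sum>i<n. f t (x i)) - real n * (\<integral>y. f t y \<partial>P)\<bar>)"
      by (simp add: add.commute)
    interpret PQ: pair_sigma_finite Q Q' ..
    have "integrable (Q \<Otimes>\<^sub>M Q') (\<lambda>p. h (merge {..<n} {n..<2 * n} p))"
    proof -
      have "distr (Q \<Otimes>\<^sub>M Q') R (merge {..<n} {n..<2 * n}) = R"
        unfolding Q_def Q'_def R_def K_def by (rule PP.distr_merge) auto
      moreover have "merge {..<n} {n..<2 * n} \<in> measurable (Q \<Otimes>\<^sub>M Q') R"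
        unfolding Q_def Q'_def R_def K_def by (rule measurable_merge)
      ultimately show ?thesis using integrable_distr hR by metis
    qed
    then show "integrable Q (\<lambda>x. \<integral>y. h (merge {..<n} {n..<2 * n} (x, y)) \<partial>Q')"
      by (rule PQ.integrable_fst')
  qed (rule step1)
  also have "\<dots> = (\<integral>z. h z \<partial>R)"
    unfolding Q_def Q'_def R_def K_def
    by (rule PP.product_integral_fold[symmetric]) (use hR in \<open>auto simp: R_def K_def\<close>)
  finally have A: "(\<integral>x. (MAX t\<in>T. \<bar>(\<Sum>i<n. f t (x i)) - real n * (\<integral>y. f t y \<partial>P)\<bar>) \<partial>Q) \<le> (\<integral>z. h z \<partial>R)" .
  define G where "G I x = (MAX t\<in>T. \<bar>rsum {..<n} I (\<lambda>i. f t (x i))\<bar>)" for I and x :: "nat \<Rightarrow> 'a"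
  have G_int: "integrable Q (G I)" for I
  proof -
    have "integrable Q (\<lambda>x. MAX t\<in>T. \<bar>0 + (\<Sum>i<n. e I i * f t (x i))\<bar>)"
      unfolding Q_def by (rule integrable_MAX_abs_sum[OF P T f]) auto
    then show ?thesis by (simp add: G_def[abs_def] rsum_e)
  qed
  have G_move: "integrable R (\<lambda>z. G I (\<lambda>i\<in>{..<n}. z (s i)))"
    "(\<integral>z. G I (\<lambda>i\<in>{..<n}. z (s i)) \<partial>R) = (\<integral>x. G I x \<partial>Q)"
    if s: "inj_on s {..<n}" "s \<in> {..<n} \<rightarrow> K" for s I
  proof -
    show "(\<integral>z. G I (\<lambda>i\<in>{..<n}. z (s i)) \<partial>R) = (\<integral>x. G I x \<partial>Q)"
      unfolding R_def Q_def using G_int[of I] by (intro integral_PiM_reindex[OF P s]) (auto simp: Q_def)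
    have "integrable R (\<lambda>x. MAX t\<in>T. \<bar>0 + (\<Sum>i<n. e I i * f t (x (s i)))\<bar>)"
      unfolding R_def using s(2) by (intro integrable_MAX_abs_sum[OF P T f]) auto
    then show "integrable R (\<lambda>z. G I (\<lambda>i\<in>{..<n}. z (s i)))" by (simp add: G_def rsum_e)
  qed
  have swap: "(\<integral>z. h z \<partial>R) \<le> 2 * (\<integral>x. G I x \<partial>Q)" for I
  proof -
    \<comment> \<open>An involution of \<open>K\<close>: \<open>i\<close> and \<open>n + i\<close>
      trade places exactly when \<open>i\<close> is outside \<open>I\<close>.\<close>
    define s where "s i = (if i < n then (if i \<in> I then i else n + i) else (if i - n \<in> I then i else i - n))"
      for i :: nat
    have sK: "s \<in> K \<rightarrow> K" by (auto simp: s_def K_def)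
    have "s (s i) = i" if "i \<in> K" for i using that by (auto simp: s_def K_def)
    then have "inj_on s K" by (rule inj_on_inverseI)
    then have "(\<integral>z. h z \<partial>R) = (\<integral>z. h (\<lambda>i\<in>K. z (s i)) \<partial>R)"
      unfolding R_def using integral_PiM_reindex[OF P _ sK, of h] hR by (simp add: R_def)
    also have "\<dots> \<le> (\<integral>z. G I (\<lambda>i\<in>{..<n}. z i) + G I (\<lambda>i\<in>{..<n}. z (n + i)) \<partial>R)"
    proof (rule integral_mono)
      have m: "(\<lambda>z. \<lambda>i\<in>K. z (s i)) \<in> measurable R R"
        unfolding R_def using sK by (intro measurable_restrict measurable_component_singleton) auto
      have "distr R R (\<lambda>z. \<lambda>i\<in>K. z (s i)) = R"
        unfolding R_def using distr_PiM_reindex[of K "\<lambda>_. P" s K] P \<open>inj_on s K\<close> sK by simp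
      then show "integrable R (\<lambda>z. h (\<lambda>i\<in>K. z (s i)))" using integrable_distr[OF m, of h] hR by simp
      show "integrable R (\<lambda>z. G I (\<lambda>i\<in>{..<n}. z i) + G I (\<lambda>i\<in>{..<n}. z (n + i)))"
        by (intro Bochner_Integration.integrable_add G_move) (auto simp: K_def inj_on_def)
      fix z :: "nat \<Rightarrow> 'a"
      have hs: "(\<Sum>i<n. f t ((\<lambda>i\<in>K. z (s i)) i) - f t ((\<lambda>i\<in>K. z (s i)) (n + i)))
          = (\<Sum>i<n. e I i * f t (z i)) - (\<Sum>i<n. e I i * f t (z (n + i)))" for t
        unfolding sum_subtractf[symmetric]
        by (intro sum.cong) (auto simp: K_def s_def e_def)
      have "h (\<lambda>i\<in>K. z (s i)) \<le> (MAX t\<in>T. \<bar>\<Sum>i<n. e I i * f t (z i)\<bar>) + (MAX t\<in>T. \<bar>\<Sum>i<n. e I i * f t (z (n + i))\<bar>)"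
        unfolding h_def using T by (intro Max_abs_add_le) (auto simp only: hs intro: abs_triangle_ineq4)
      then show "h (\<lambda>i\<in>K. z (s i)) \<le> G I (\<lambda>i\<in>{..<n}. z i) + G I (\<lambda>i\<in>{..<n}. z (n + i))"
        by (simp add: G_def rsum_e)
    qed
    also have "\<dots> = (\<integral>x. G I x \<partial>Q) + (\<integral>x. G I x \<partial>Q)"
    proof -
      have "inj_on (\<lambda>i. i) {..<n}" "(\<lambda>i. i) \<in> {..<n} \<rightarrow> K" "inj_on (\<lambda>i. n + i) {..<n}" "(\<lambda>i. n + i) \<in> {..<n} \<rightarrow> K"
        by (auto simp: K_def inj_on_def)
      then show ?thesis using G_move[of "\<lambda>i. i" I] G_move[of "\<lambda>i. n + i" I]
        by (simp add: Bochner_Integration.integral_add)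
    qed
    finally show ?thesis by simp
  qed
  have "(\<integral>z. h z \<partial>R) = signavg {..<n} (\<lambda>I. \<integral>z. h z \<partial>R)" by (simp add: signavg_const)
  also have "\<dots> \<le> signavg {..<n} (\<lambda>I. 2 * (\<integral>x. G I x \<partial>Q))" by (intro signavg_mono swap)
  also have "\<dots> = 2 * (\<integral>x. signavg {..<n} (\<lambda>I. G I x) \<partial>Q)"
    unfolding signavg_cmult using G_int by (simp add: signavg_def Bochner_Integration.integral_sum)
  finally show ?thesis using A by (simp add: G_def)
qed

text \<open>Jensen's inequality by way of \<open>sqrt y \<le> (y / c + c) / 2\<close>: integrate and
  take \<open>c = sqrt S\<close>, or let \<open>c\<close> tend to 0 when
  \<open>S = 0\<close>.\<close>

lemma (in prob_space) integral_sqrt_le: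
  fixes W :: "'a \<Rightarrow> real"
  assumes W: "integrable M W" "\<And>x. W x \<ge> 0"
  shows "integrable M (\<lambda>x. sqrt (W x))" "(\<integral>x. sqrt (W x) \<partial>M) \<le> sqrt (\<integral>x. W x \<partial>M)"
proof -
  have amgm: "sqrt y \<le> (y / c + c) / 2" if "y \<ge> 0" "c > 0" for y c :: real
  proof -
    have "0 \<le> (sqrt y - c)\<^sup>2" by simp
    then have "2 * c * sqrt y \<le> y + c\<^sup>2" using that by (simp add: power2_diff mult_ac)
    then show ?thesis using that by (simp add: field_simps power2_eq_square)
  qed
  have [measurable]: "W \<in> borel_measurable M" using W(1) by simp
  show int: "integrable M (\<lambda>x. sqrt (W x))"
  proof (rule Bochner_Integration.integrable_bound)
    show "integrable M (\<lambda>x. (W x / 1 + 1) / 2)" using W(1) by simp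
    show "AE x in M. norm (sqrt (W x)) \<le> norm ((W x / 1 + 1) / 2)"
      using amgm[of _ 1] W(2) by (intro AE_I2) (simp add: abs_of_nonneg)
  qed simp
  define S where "S = (\<integral>x. W x \<partial>M)"
  have S: "S \<ge> 0" unfolding S_def using W(2) by (intro Bochner_Integration.integral_nonneg) auto
  have le: "(\<integral>x. sqrt (W x) \<partial>M) \<le> (S / c + c) / 2" if "c > 0" for c
  proof -
    have "(\<integral>x. sqrt (W x) \<partial>M) \<le> (\<integral>x. (W x / c + c) / 2 \<partial>M)"
      using W int amgm that by (intro integral_mono) auto
    also have "\<dots> = (S / c + c) / 2" using W(1) by (simp add: S_def prob_space)
    finally show ?thesis .
  qed
  show "(\<integral>x. sqrt (W x) \<partial>M) \<le> sqrt (\<integral>x. W x \<partial>M)"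
  proof (cases "S = 0")
    case True
    have "(\<integral>x. sqrt (W x) \<partial>M) \<le> c" if "c > 0" for c using le[of c] that True by auto
    then have "(\<integral>x. sqrt (W x) \<partial>M) \<le> 0" by (rule field_le_epsilon[of _ 0, simplified])
    then show ?thesis using True by (simp add: S_def)
  next
    case False
    then have "S / sqrt S = sqrt S" "sqrt S > 0" using S by (auto simp: real_div_sqrt)
    then show ?thesis using le[of "sqrt S"] by (simp add: S_def)
  qed
qed

text \<open>Markov's inequality for the maxima over an increasing sequence of finite subfamilies,
  followed by continuity from below; this works because \<open>B\<close> is the same for all
  subfamilies.\<close>

lemma (in prob_space) prob_Ex_countable_gt_le:
  fixes Y :: "'c \<Rightarrow> 'a \<Rightarrow> real"
  assumes C: "countable C" and Y: "\<And>c. c \<in> C \<Longrightarrow> integrable M (Y c)" "\<And>c x. c \<in> C \<Longrightarrow> Y c x \<ge> 0"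
    and B: "\<And>A. finite A \<Longrightarrow> A \<noteq> {} \<Longrightarrow> A \<subseteq> C \<Longrightarrow> (\<integral>x. (MAX c\<in>A. Y c x) \<partial>M) \<le> B"
    and t: "t > 0" and B0: "B \<ge> 0"
  shows "{x\<in>space M. \<exists>c\<in>C. Y c x > t} \<in> sets M"
    and "measure M {x\<in>space M. \<exists>c\<in>C. Y c x > t} \<le> B / t"
proof -
  have [measurable]: "Y c \<in> borel_measurable M" if "c \<in> C" for c using Y(1)[OF that] by simp
  show "{x\<in>space M. \<exists>c\<in>C. Y c x > t} \<in> sets M"
  proof -
    have "{x\<in>space M. \<exists>c\<in>C. Y c x > t} = (\<Union>c\<in>C. {x\<in>space M. Y c x > t})" by auto
    then show ?thesis using C by (auto intro!: sets.countable_UN')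
  qed
  define A where "A k = {c \<in> C. to_nat_on C c < k}" for k :: nat
  have fin: "finite (A k)" for k
  proof (rule finite_imageD[of "to_nat_on C"])
    show "finite (to_nat_on C ` A k)" by (rule finite_subset[of _ "{..<k}"]) (auto simp: A_def)
    show "inj_on (to_nat_on C) (A k)"
      using inj_on_to_nat_on[OF C] by (rule inj_on_subset) (auto simp: A_def)
  qed
  define E where "E k = {x\<in>space M. \<exists>c\<in>A k. Y c x > t}" for k
  have Es: "E k \<in> sets M" for k
    unfolding E_def using fin by (intro sets.sets_Collect_finite_Ex) (auto simp: A_def)
  have "incseq E" by (auto simp: incseq_def E_def A_def)
  then have "(\<lambda>k. measure M (E k)) \<longlonglongrightarrow> measure M (\<Union>k. E k)"
    using Es by (intro finite_Lim_measure_incseq) auto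
  moreover have "(\<Union>k. E k) = {x\<in>space M. \<exists>c\<in>C. Y c x > t}"
    by (auto simp: E_def A_def)
  moreover have "measure M (E k) \<le> B / t" for k
  proof (cases "A k = {}")
    case True
    then show ?thesis using t B0 by (simp add: E_def)
  next
    case False
    have sub: "A k \<subseteq> C" by (auto simp: A_def)
    have int: "integrable M (\<lambda>x. MAX c\<in>A k. Y c x)"
      using fin False sub Y by (intro integrable_MAX) auto
    have "measure M (E k) \<le> measure M {x\<in>space M. (MAX c\<in>A k. Y c x) \<ge> t}"
    proof (rule finite_measure_mono)
      show "E k \<subseteq> {x\<in>space M. (MAX c\<in>A k. Y c x) \<ge> t}"
        unfolding E_def using fin[of k] by (auto intro: order_trans[OF less_imp_le Max_ge])
      show "{x\<in>space M. (MAX c\<in>A k. Y c x) \<ge> t} \<in> sets M"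
        using int by measurable
    qed
    also have "\<dots> \<le> (\<integral>x. (MAX c\<in>A k. Y c x) \<partial>M) / t"
    proof (rule integral_Markov_inequality_measure[OF int, of "{}"])
      show "AE x in M. 0 \<le> (MAX c\<in>A k. Y c x)"
      proof (rule AE_I2)
        fix x
        obtain c where "c \<in> A k" using False by blast
        then have "0 \<le> Y c x" "Y c x \<le> (MAX c\<in>A k. Y c x)" using Y(2) sub fin[of k] by auto
        then show "0 \<le> (MAX c\<in>A k. Y c x)" by linarith
      qed
    qed (use t in auto)
    also have "\<dots> \<le> B / t" using B[OF fin False sub] t by (intro divide_right_mono) auto
    finally show ?thesis .
  qed
  ultimately show "measure M {x\<in>space M. \<exists>c\<in>C. Y c x > t} \<le> B / t"
    using LIMSEQ_le_const2 by metis
qed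

section \<open>Maximal inequalities for half-spaces\<close>

lemma halfspace_measurable [measurable]: "halfspace h \<in> sets (borel :: 'a::euclidean_space measure)"
  unfolding halfspace_def by measurable

definition hsym :: "('a::real_inner \<times> real) \<times> ('a \<times> real) \<Rightarrow> 'a set" where
  "hsym h = sym_diff (halfspace (fst h)) (halfspace (snd h))"

text \<open>With the empty set as second half-space this is \<open>g\<close> times a single
  indicator, so bounds over all pairs cover both kinds of functions in the decomposition.\<close>

definition hdiff :: "('a::real_inner \<Rightarrow> real) \<Rightarrow> ('a \<times> real) \<times> ('a \<times> real) \<Rightarrow> 'a \<Rightarrow> real" where
  "hdiff g h x = g x * (indicator (halfspace (fst h)) x - indicator (halfspace (snd h)) x)"

lemma hsym_measurable [measurable]: "hsym h \<in> sets (borel :: 'a::euclidean_space measure)"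
  unfolding hsym_def by measurable

lemma hdiff_measurable [measurable]:
  fixes g :: "'a::euclidean_space \<Rightarrow> real"
  assumes [measurable]: "g \<in> borel_measurable borel"
  shows "hdiff g h \<in> borel_measurable borel"
  unfolding hdiff_def[abs_def] by measurable

lemma hdiff_abs: "\<bar>hdiff g h x\<bar> = \<bar>g x\<bar> * indicator (hsym h) x"
  by (auto simp: hdiff_def hsym_def indicator_def)

lemma hdiff_abs_le: "\<bar>hdiff g h x\<bar> \<le> \<bar>g x\<bar>"
  by (simp add: hdiff_abs indicator_def)

definition trace_set :: "nat \<Rightarrow> (nat \<Rightarrow> 'a::real_inner) \<Rightarrow> 'a \<times> real \<Rightarrow> nat set" where
  "trace_set n x h = {i\<in>{..<n}. x i \<in> halfspace h}"

lemma trace_set_growth: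
  fixes x :: "nat \<Rightarrow> 'a::euclidean_space"
  assumes "K \<subseteq> {..<n}"
  shows "card ((\<lambda>S. S \<inter> K) ` range (trace_set n x)) \<le> (card K + 1) ^ (DIM('a) + 1)"
proof -
  have "(\<lambda>S. S \<inter> K) ` range (trace_set n x) = range (\<lambda>h. {i\<in>K. x i \<in> halfspace h})"
    using assms by (auto simp: trace_set_def image_def)
  then show ?thesis
    using halfspace_trace_card_le[of K x] assms finite_subset by fastforce
qed

abbreviation half_const :: "'a::euclidean_space itself \<Rightarrow> real" where
  "half_const _ \<equiv> chain_const (DIM('a) + 1)"

text \<open>Only traces on the sample enter, so this is \<open>chaining\<close> with weights
  \<open>g (x i)\<close> on a family of growth exponent \<open>DIM('a) + 1\<close>. The radius
  \<open>r\<close> is empirical and may depend on the sample.\<close>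

lemma Rademacher_halfspace_bound:
  fixes x :: "nat \<Rightarrow> 'a::euclidean_space"
  assumes PP: "finite PP" "PP \<noteq> {}" and r: "r \<ge> 0"
    and close: "\<And>h. h \<in> PP \<Longrightarrow> (\<Sum>i<n. (g (x i))\<^sup>2 * indicator (hsym h) (x i)) \<le> r\<^sup>2"
  shows "signavg {..<n} (\<lambda>I. MAX h\<in>PP. \<bar>rsum {..<n} I (\<lambda>i. hdiff g h (x i))\<bar>)
    \<le> 20 * half_const TYPE('a) * (real k + 1) * (sqrt (\<Sum>i<n. (g (x i))\<^sup>2) / 2 ^ k + r)"
proof -
  define tr where "tr h = (trace_set n x (fst h), trace_set n x (snd h))" for h
  obtain U where U:
    "\<And>I S T. I \<subseteq> {..<n} \<Longrightarrow> (S, T) \<in> tr ` PP \<Longrightarrow>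
        \<bar>rsum {..<n} I (\<lambda>i. g (x i) * (indicator S i - indicator T i))\<bar> \<le> U I"
    "signavg {..<n} U \<le> 20 * half_const TYPE('a) * (real k + 1) * (sqrt (\<Sum>i<n. (g (x i))\<^sup>2) / 2 ^ k + r)"
  proof (rule chaining[of "{..<n}" "range (trace_set n x)" "DIM('a) + 1" "tr ` PP" r "\<lambda>i. g (x i)" k])
    show "card ((\<lambda>S. S \<inter> K) ` range (trace_set n x)) \<le> (card K + 1) ^ (DIM('a) + 1)" if "K \<subseteq> {..<n}" for K
      using that by (rule trace_set_growth)
    show "(\<Sum>i\<in>sym_diff S T. (g (x i))\<^sup>2) \<le> r\<^sup>2" if ST: "(S, T) \<in> tr ` PP" for S T
    proof -
      obtain h where h: "h \<in> PP" "S = trace_set n x (fst h)" "T = trace_set n x (snd h)"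
        using ST by (auto simp: tr_def)
      have "sym_diff S T = {i\<in>{..<n}. x i \<in> hsym h}"
        by (auto simp: h trace_set_def hsym_def)
      then have "(\<Sum>i\<in>sym_diff S T. (g (x i))\<^sup>2) = (\<Sum>i<n. if x i \<in> hsym h then (g (x i))\<^sup>2 else 0)"
        by (simp only: sum.inter_filter[OF finite_lessThan])
      also have "\<dots> = (\<Sum>i<n. (g (x i))\<^sup>2 * indicator (hsym h) (x i))"
        by (intro sum.cong) (auto simp: indicator_def)
      finally show ?thesis using close[OF h(1)] by simp
    qed
  qed (use r in \<open>auto simp: tr_def trace_set_def\<close>)
  have "(MAX h\<in>PP. \<bar>rsum {..<n} I (\<lambda>i. hdiff g h (x i))\<bar>) \<le> U I" if "I \<subseteq> {..<n}" for I
  proof -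
    have "\<bar>rsum {..<n} I (\<lambda>i. hdiff g h (x i))\<bar> \<le> U I" if h: "h \<in> PP" for h
    proof -
      have "rsum {..<n} I (\<lambda>i. hdiff g h (x i))
          = rsum {..<n} I (\<lambda>i. g (x i) * (indicator (fst (tr h)) i - indicator (snd (tr h)) i))"
        unfolding rsum_def by (intro sum.cong) (auto simp: hdiff_def tr_def trace_set_def indicator_def)
      then show ?thesis using U(1)[OF \<open>I \<subseteq> {..<n}\<close>, of "fst (tr h)" "snd (tr h)"] h by simp
    qed
    then show ?thesis using PP by (subst Max_le_iff) auto
  qed
  then show ?thesis using U(2) signavg_mono[of "{..<n}" _ U] by (meson order_trans)
qed

text \<open>Serves to keep empirical radii near their means, for which any bound of smaller order
  than \<open>n\<close> will do: one union bound over the polynomially many pairs of traces, without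
  chaining, gives order \<open>sqrt (n ln n)\<close>.\<close>

lemma Rademacher_symmetric_difference_bound:
  fixes x :: "nat \<Rightarrow> 'a::euclidean_space"
  assumes PP: "finite PP" "PP \<noteq> {}" and g: "\<And>y. \<bar>g y\<bar> \<le> b"
  shows "signavg {..<n} (\<lambda>I. MAX h\<in>PP. \<bar>rsum {..<n} I (\<lambda>i. (g (x i))\<^sup>2 * indicator (hsym h) (x i))\<bar>)
    \<le> sqrt (real n) * b\<^sup>2 * sqrt (2 * ln (2 * (real n + 1) ^ (2 * (DIM('a) + 1))))"
proof -
  define tr where "tr h = (trace_set n x (fst h), trace_set n x (snd h))" for h
  define a where "a t i = (g (x i))\<^sup>2 * indicator (sym_diff (fst t) (snd t)) i" for t i
  define F where "F = range (trace_set n x)"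
  have finF: "finite F" by (rule finite_subset[of _ "Pow {..<n}"]) (auto simp: F_def trace_set_def)
  have cF: "card F \<le> (n + 1) ^ (DIM('a) + 1)"
    using halfspace_trace_card_le[of "{..<n}" x] by (simp add: F_def trace_set_def[abs_def])
  have "card (tr ` PP) \<le> card (F \<times> F)"
    using finF by (intro card_mono) (auto simp: tr_def F_def)
  also have "\<dots> \<le> (n + 1) ^ (DIM('a) + 1) * (n + 1) ^ (DIM('a) + 1)"
    unfolding card_cartesian_product using cF by (intro mult_mono) auto
  also have "\<dots> = (n + 1) ^ (2 * (DIM('a) + 1))" by (simp only: mult_2 power_add)
  finally have "real (card (tr ` PP)) \<le> real ((n + 1) ^ (2 * (DIM('a) + 1)))" by (simp only: of_nat_le_iff)
  then have card: "real (card (tr ` PP)) \<le> (real n + 1) ^ (2 * (DIM('a) + 1))"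
    by (simp only: of_nat_power of_nat_add of_nat_1)
  have sq: "(\<Sum>i<n. (a t i)\<^sup>2) \<le> (sqrt (real n) * b\<^sup>2)\<^sup>2" for t
  proof -
    have "(a t i)\<^sup>2 \<le> (b\<^sup>2)\<^sup>2" for i
    proof -
      have "(g (x i))\<^sup>2 \<le> b\<^sup>2" using g[of "x i"] by (metis abs_ge_zero power2_abs power_mono)
      then have "\<bar>a t i\<bar> \<le> b\<^sup>2" by (auto simp: a_def indicator_def)
      then show ?thesis by (metis abs_ge_zero power2_abs power_mono)
    qed
    then have "(\<Sum>i<n. (a t i)\<^sup>2) \<le> (\<Sum>i<n. (b\<^sup>2)\<^sup>2)" by (intro sum_mono)
    then show ?thesis by (simp add: power_mult_distrib)
  qed
  have N1: "(real n + 1) ^ (2 * (DIM('a) + 1)) \<ge> 1" by (rule one_le_power) simp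
  have s0: "sqrt (real n) * b\<^sup>2 \<ge> 0" by simp
  obtain U where U: "\<And>I t. I \<subseteq> {..<n} \<Longrightarrow> t \<in> tr ` PP \<Longrightarrow> \<bar>rsum {..<n} I (a t)\<bar> \<le> U I"
    "signavg {..<n} U \<le> sqrt (real n) * b\<^sup>2 * sqrt (2 * ln (2 * (real n + 1) ^ (2 * (DIM('a) + 1))))"
    using rademacher_finite_max[where a = a, OF finite_lessThan finite_imageI[OF PP(1)] card N1 s0 sq] by blast
  have "(MAX h\<in>PP. \<bar>rsum {..<n} I (\<lambda>i. (g (x i))\<^sup>2 * indicator (hsym h) (x i))\<bar>) \<le> U I" if "I \<subseteq> {..<n}" for I
  proof -
    have "\<bar>rsum {..<n} I (\<lambda>i. (g (x i))\<^sup>2 * indicator (hsym h) (x i))\<bar> \<le> U I" if h: "h \<in> PP" for h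
    proof -
      have "rsum {..<n} I (\<lambda>i. (g (x i))\<^sup>2 * indicator (hsym h) (x i)) = rsum {..<n} I (a (tr h))"
        unfolding rsum_def by (intro sum.cong) (auto simp: a_def hsym_def tr_def trace_set_def indicator_def)
      then show ?thesis using U(1)[OF \<open>I \<subseteq> {..<n}\<close>, of "tr h"] h by simp
    qed
    then show ?thesis using PP by (subst Max_le_iff) auto
  qed
  then show ?thesis using U(2) signavg_mono[of "{..<n}" _ U] by (meson order_trans)
qed

section \<open>Maximal inequalities in mean for centred sums\<close>

locale euclidean_law = prob_space P for P :: "'a::euclidean_space measure" +
  assumes sets_P [measurable_cong, simp]: "sets P = sets borel"
begin

definition sample :: "nat \<Rightarrow> (nat \<Rightarrow> 'a) measure" where
  "sample n = PiM {..<n} (\<lambda>_. P)"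

text \<open>In the notation of the paper, \<open>sqrt n \<cdot> G\<^sub>n f\<close>.\<close>

definition centred_sum :: "nat \<Rightarrow> ('a \<Rightarrow> real) \<Rightarrow> (nat \<Rightarrow> 'a) \<Rightarrow> real" where
  "centred_sum n f x = (\<Sum>i<n. f (x i)) - real n * (\<integral>y. f y \<partial>P)"

lemma prob_space_sample: "prob_space (sample n)"
  unfolding sample_def by (intro prob_space_PiM prob_space_axioms)

lemma sample_integrable:
  fixes f :: "'a \<Rightarrow> real"
  assumes "integrable P f"
  shows "integrable (sample n) (\<lambda>x. \<Sum>i<n. f (x i))" "(\<integral>x. (\<Sum>i<n. f (x i)) \<partial>sample n) = real n * (\<integral>y. f y \<partial>P)"
proof -
  have "integrable (sample n) (\<lambda>x. f (x i))" "(\<integral>x. f (x i) \<partial>sample n) = (\<integral>y. f y \<partial>P)" if "i < n" for i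
    using PiM_coordinate_integral[OF prob_space_axioms _ assms, of i "{..<n}"] that by (auto simp: sample_def)
  then show "integrable (sample n) (\<lambda>x. \<Sum>i<n. f (x i))" "(\<integral>x. (\<Sum>i<n. f (x i)) \<partial>sample n) = real n * (\<integral>y. f y \<partial>P)"
    by (auto simp: Bochner_Integration.integral_sum)
qed

lemma centred_sum_integrable:
  assumes "integrable P f"
  shows "integrable (sample n) (centred_sum n f)"
proof -
  interpret S: prob_space "sample n" by (rule prob_space_sample)
  show ?thesis unfolding centred_sum_def[abs_def]
    using sample_integrable(1)[OF assms] by (intro Bochner_Integration.integrable_diff S.integrable_const)
qed

lemma square_integrable_imp_integrable:
  fixes g :: "'a \<Rightarrow> real"
  assumes [measurable]: "g \<in> borel_measurable borel" and "integrable P (\<lambda>x. (g x)\<^sup>2)"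
  shows "integrable P g"
proof (rule Bochner_Integration.integrable_bound)
  show "integrable P (\<lambda>x. 1 + (g x)\<^sup>2)" using assms(2) by simp
  have "\<bar>y\<bar> \<le> 1 + y\<^sup>2" for y :: real
    using zero_le_power2[of "\<bar>y\<bar> - 1"] zero_le_power2[of y] by (simp add: power2_diff)
  then show "AE x in P. norm (g x) \<le> norm (1 + (g x)\<^sup>2)" by (intro AE_I2) (simp add: abs_of_nonneg)
qed simp

lemma hdiff_integrable:
  fixes g :: "'a \<Rightarrow> real"
  assumes [measurable]: "g \<in> borel_measurable borel" and "integrable P (\<lambda>x. (g x)\<^sup>2)"
  shows "integrable P (hdiff g h)"
  by (rule Bochner_Integration.integrable_bound[OF square_integrable_imp_integrable[OF assms]])
    (auto simp: hdiff_abs_le)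

lemma hsym_square_integrable:
  fixes g :: "'a \<Rightarrow> real"
  assumes [measurable]: "g \<in> borel_measurable borel" and "integrable P (\<lambda>x. (g x)\<^sup>2)"
  shows "integrable P (\<lambda>x. (g x)\<^sup>2 * indicator (hsym h) x)"
  by (rule Bochner_Integration.integrable_bound[OF assms(2)]) (auto simp: indicator_def)

text \<open>Symmetrization, then chaining for each fixed sample with the largest empirical radius as
  \<open>r\<close>, then Jensen's inequality for the two square roots. The mean of the largest
  radius stays in the bound, to be estimated in two different ways.\<close>

lemma chaining_maximal_inequality:
  fixes g :: "'a \<Rightarrow> real"
  assumes [measurable]: "g \<in> borel_measurable borel" and g: "integrable P (\<lambda>x. (g x)\<^sup>2)"
    and PP: "finite PP" "PP \<noteq> {}"
  shows "(\<integral>x. (MAX h\<in>PP. \<bar>centred_sum n (hdiff g h) x\<bar>) \<partial>sample n)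
    \<le> 40 * half_const TYPE('a) * (real k + 1) * (sqrt (real n * (\<integral>y. (g y)\<^sup>2 \<partial>P)) / 2 ^ k
      + sqrt (\<integral>x. (MAX h\<in>PP. \<Sum>i<n. (g (x i))\<^sup>2 * indicator (hsym h) (x i)) \<partial>sample n))"
proof -
  interpret S: prob_space "sample n" by (rule prob_space_sample)
  define W where "W x = (\<Sum>i<n. (g (x i))\<^sup>2)" for x :: "nat \<Rightarrow> 'a"
  define R where "R x = (MAX h\<in>PP. \<Sum>i<n. (g (x i))\<^sup>2 * indicator (hsym h) (x i))" for x :: "nat \<Rightarrow> 'a"
  define c where "c = 20 * half_const TYPE('a) * (real k + 1)"
  have c: "c \<ge> 0" using chain_const_ge[of "DIM('a) + 1"] by (simp add: c_def)
  have W: "integrable (sample n) W" "(\<integral>x. W x \<partial>sample n) = real n * (\<integral>y. (g y)\<^sup>2 \<partial>P)" "W x \<ge> 0" for x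
    using sample_integrable[OF g] by (auto simp: W_def[abs_def] sum_nonneg)
  have R: "integrable (sample n) R"
    unfolding R_def[abs_def] using PP hsym_square_integrable[OF assms(1) g]
    by (intro integrable_MAX sample_integrable) auto
  have R0: "R x \<ge> 0" for x
  proof -
    obtain h where "h \<in> PP" using PP by blast
    then have "(\<Sum>i<n. (g (x i))\<^sup>2 * indicator (hsym h) (x i)) \<le> R x" unfolding R_def using PP by (intro Max_ge) auto
    moreover have "0 \<le> (\<Sum>i<n. (g (x i))\<^sup>2 * indicator (hsym h) (x i))" by (intro sum_nonneg) auto
    ultimately show ?thesis by linarith
  qed
  have pt: "signavg {..<n} (\<lambda>I. MAX h\<in>PP. \<bar>rsum {..<n} I (\<lambda>i. hdiff g h (x i))\<bar>)
      \<le> c * (sqrt (W x) / 2 ^ k + sqrt (R x))" for x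
    unfolding c_def W_def
  proof (rule Rademacher_halfspace_bound[OF PP])
    show "sqrt (R x) \<ge> 0" using R0 by simp
    fix h assume "h \<in> PP"
    then have "(\<Sum>i<n. (g (x i))\<^sup>2 * indicator (hsym h) (x i)) \<le> R x" unfolding R_def using PP by (intro Max_ge) auto
    then show "(\<Sum>i<n. (g (x i))\<^sup>2 * indicator (hsym h) (x i)) \<le> (sqrt (R x))\<^sup>2" using R0 by simp
  qed
  have "(\<integral>x. (MAX h\<in>PP. \<bar>centred_sum n (hdiff g h) x\<bar>) \<partial>sample n)
      \<le> 2 * (\<integral>x. signavg {..<n} (\<lambda>I. MAX h\<in>PP. \<bar>rsum {..<n} I (\<lambda>i. hdiff g h (x i))\<bar>) \<partial>sample n)"
    unfolding centred_sum_def sample_def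
    by (rule symmetrization[OF prob_space_axioms PP]) (rule hdiff_integrable[OF assms(1) g])
  also have "\<dots> \<le> 2 * (\<integral>x. c * (sqrt (W x) / 2 ^ k + sqrt (R x)) \<partial>sample n)"
  proof (intro mult_left_mono integral_mono')
    show "integrable (sample n) (\<lambda>x. c * (sqrt (W x) / 2 ^ k + sqrt (R x)))"
      using S.integral_sqrt_le(1)[OF W(1,3)] S.integral_sqrt_le(1)[OF R R0] by simp
    fix x :: "nat \<Rightarrow> 'a"
    show "0 \<le> c * (sqrt (W x) / 2 ^ k + sqrt (R x))" using c W(3) R0 by simp
  qed (use pt in auto)
  also have "(\<integral>x. c * (sqrt (W x) / 2 ^ k + sqrt (R x)) \<partial>sample n)
      = c * ((\<integral>x. sqrt (W x) \<partial>sample n) / 2 ^ k + (\<integral>x. sqrt (R x) \<partial>sample n))"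
    using S.integral_sqrt_le(1)[OF W(1,3)] S.integral_sqrt_le(1)[OF R R0] by simp
  also have "\<dots> \<le> c * (sqrt (\<integral>x. W x \<partial>sample n) / 2 ^ k + sqrt (\<integral>x. R x \<partial>sample n))"
    using S.integral_sqrt_le(2)[OF W(1,3)] S.integral_sqrt_le(2)[OF R R0] c
    by (intro mult_left_mono add_mono divide_right_mono) auto
  finally show ?thesis unfolding W(2) by (simp add: c_def R_def[abs_def] mult.assoc)
qed

text \<open>Level \<open>k = 0\<close>, with every radius bounded by the full sum of squares. The
  bound scales with the root of the second moment of \<open>g\<close>, which makes it fit for
  truncation tails.\<close>

lemma uniform_maximal_inequality:
  fixes g :: "'a \<Rightarrow> real"
  assumes [measurable]: "g \<in> borel_measurable borel" and g: "integrable P (\<lambda>x. (g x)\<^sup>2)"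
    and PP: "finite PP" "PP \<noteq> {}"
  shows "(\<integral>x. (MAX h\<in>PP. \<bar>centred_sum n (hdiff g h) x\<bar>) \<partial>sample n)
    \<le> 80 * half_const TYPE('a) * sqrt (\<integral>y. (g y)\<^sup>2 \<partial>P) * sqrt (real n)"
proof -
  let ?c = "half_const TYPE('a)" and ?R = "\<integral>x. (MAX h\<in>PP. \<Sum>i<n. (g (x i))\<^sup>2 * indicator (hsym h) (x i)) \<partial>sample n"
  have "?R \<le> (\<integral>x. (\<Sum>i<n. (g (x i))\<^sup>2) \<partial>sample n)"
  proof (rule integral_mono)
    show "integrable (sample n) (\<lambda>x. MAX h\<in>PP. \<Sum>i<n. (g (x i))\<^sup>2 * indicator (hsym h) (x i))"
      using PP hsym_square_integrable[OF assms(1) g] by (intro integrable_MAX sample_integrable) auto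
    show "integrable (sample n) (\<lambda>x. \<Sum>i<n. (g (x i))\<^sup>2)" using sample_integrable[OF g] by simp
    show "(MAX h\<in>PP. \<Sum>i<n. (g (x i))\<^sup>2 * indicator (hsym h) (x i)) \<le> (\<Sum>i<n. (g (x i))\<^sup>2)" for x
    proof -
      have "(\<Sum>i<n. (g (x i))\<^sup>2 * indicator (hsym h) (x i)) \<le> (\<Sum>i<n. (g (x i))\<^sup>2)" for h
        by (intro sum_mono) (simp add: indicator_def)
      then show ?thesis using PP by (subst Max_le_iff) auto
    qed
  qed
  also have "\<dots> = real n * (\<integral>y. (g y)\<^sup>2 \<partial>P)" by (rule sample_integrable(2)[OF g])
  finally have R: "sqrt ?R \<le> sqrt (real n * (\<integral>y. (g y)\<^sup>2 \<partial>P))" by simp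
  have "(\<integral>x. (MAX h\<in>PP. \<bar>centred_sum n (hdiff g h) x\<bar>) \<partial>sample n)
      \<le> 40 * ?c * (real 0 + 1) * (sqrt (real n * (\<integral>y. (g y)\<^sup>2 \<partial>P)) / 2 ^ 0 + sqrt ?R)"
    by (rule chaining_maximal_inequality[OF assms])
  also have "\<dots> \<le> 40 * ?c * (real 0 + 1) * (sqrt (real n * (\<integral>y. (g y)\<^sup>2 \<partial>P)) / 2 ^ 0 + sqrt (real n * (\<integral>y. (g y)\<^sup>2 \<partial>P)))"
    using R chain_const_ge[of "DIM('a) + 1"] by (intro mult_left_mono add_mono) auto
  finally show ?thesis by (simp add: real_sqrt_mult mult_ac)
qed

text \<open>A radius is its mean, at most \<open>n d\<close>, plus a centred sum; symmetrization and
  the union bound control the latter. Boundedness of \<open>g\<close> enters through the weights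
  \<open>g^2\<close>, which are squared once more there.\<close>

lemma empirical_radius_bound:
  fixes g :: "'a \<Rightarrow> real"
  assumes [measurable]: "g \<in> borel_measurable borel" and b: "\<And>y. \<bar>g y\<bar> \<le> b"
    and PP: "finite PP" "PP \<noteq> {}"
    and d: "\<And>h. h \<in> PP \<Longrightarrow> (\<integral>y. (g y)\<^sup>2 * indicator (hsym h) y \<partial>P) \<le> d"
  shows "(\<integral>x. (MAX h\<in>PP. \<Sum>i<n. (g (x i))\<^sup>2 * indicator (hsym h) (x i)) \<partial>sample n)
    \<le> real n * d + 2 * (sqrt (real n) * b\<^sup>2 * sqrt (2 * ln (2 * (real n + 1) ^ (2 * (DIM('a) + 1)))))"
proof -
  interpret S: prob_space "sample n" by (rule prob_space_sample)
  define f where "f h y = (g y)\<^sup>2 * indicator (hsym h) y" for h y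
  have "(g y)\<^sup>2 \<le> b\<^sup>2" for y using b[of y] by (metis abs_ge_zero power2_abs power_mono)
  then have g: "integrable P (\<lambda>x. (g x)\<^sup>2)" by (intro integrable_const_bound[of _ "b\<^sup>2"]) auto
  have f: "integrable P (f h)" for h
    unfolding f_def[abs_def] by (rule hsym_square_integrable[OF assms(1) g])
  have int1: "integrable (sample n) (\<lambda>x. MAX h\<in>PP. \<bar>centred_sum n (f h) x\<bar>)"
    using PP f by (intro integrable_MAX integrable_abs centred_sum_integrable) auto
  have "(\<integral>x. (MAX h\<in>PP. \<Sum>i<n. f h (x i)) \<partial>sample n)
      \<le> (\<integral>x. real n * d + (MAX h\<in>PP. \<bar>centred_sum n (f h) x\<bar>) \<partial>sample n)"
  proof (rule integral_mono)
    show "integrable (sample n) (\<lambda>x. MAX h\<in>PP. \<Sum>i<n. f h (x i))"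
      using PP f by (intro integrable_MAX sample_integrable) auto
    show "integrable (sample n) (\<lambda>x. real n * d + (MAX h\<in>PP. \<bar>centred_sum n (f h) x\<bar>))"
      using int1 by simp
    fix x
    have "(\<Sum>i<n. f h (x i)) \<le> real n * d + (MAX h\<in>PP. \<bar>centred_sum n (f h) x\<bar>)" if h: "h \<in> PP" for h
    proof -
      have "\<bar>centred_sum n (f h) x\<bar> \<le> (MAX h\<in>PP. \<bar>centred_sum n (f h) x\<bar>)" using PP h by (intro Max_ge) auto
      moreover have "real n * (\<integral>y. f h y \<partial>P) \<le> real n * d" using d[OF h] by (intro mult_left_mono) (auto simp: f_def)
      moreover have "(\<Sum>i<n. f h (x i)) = real n * (\<integral>y. f h y \<partial>P) + centred_sum n (f h) x" by (simp add: centred_sum_def)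
      ultimately show ?thesis by linarith
    qed
    then show "(MAX h\<in>PP. \<Sum>i<n. f h (x i)) \<le> real n * d + (MAX h\<in>PP. \<bar>centred_sum n (f h) x\<bar>)"
      using PP by (subst Max_le_iff) auto
  qed
  also have "\<dots> = real n * d + (\<integral>x. (MAX h\<in>PP. \<bar>centred_sum n (f h) x\<bar>) \<partial>sample n)"
    using int1 by (simp add: S.prob_space)
  also have "(\<integral>x. (MAX h\<in>PP. \<bar>centred_sum n (f h) x\<bar>) \<partial>sample n)
      \<le> 2 * (\<integral>x. signavg {..<n} (\<lambda>I. MAX h\<in>PP. \<bar>rsum {..<n} I (\<lambda>i. f h (x i))\<bar>) \<partial>sample n)"
    unfolding centred_sum_def sample_def by (rule symmetrization[OF prob_space_axioms PP f])
  also have "(\<integral>x. signavg {..<n} (\<lambda>I. MAX h\<in>PP. \<bar>rsum {..<n} I (\<lambda>i. f h (x i))\<bar>) \<partial>sample n)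
      \<le> (\<integral>x. sqrt (real n) * b\<^sup>2 * sqrt (2 * ln (2 * (real n + 1) ^ (2 * (DIM('a) + 1)))) \<partial>sample n)"
  proof (rule integral_mono')
    fix x
    show "signavg {..<n} (\<lambda>I. MAX h\<in>PP. \<bar>rsum {..<n} I (\<lambda>i. f h (x i))\<bar>)
        \<le> sqrt (real n) * b\<^sup>2 * sqrt (2 * ln (2 * (real n + 1) ^ (2 * (DIM('a) + 1))))"
      unfolding f_def by (rule Rademacher_symmetric_difference_bound[OF PP b])
    have "(1::real) \<le> 2 * (real n + 1) ^ (2 * (DIM('a) + 1))"
      using one_le_power[of "real n + 1" "2 * (DIM('a) + 1)"] by linarith
    then show "0 \<le> sqrt (real n) * b\<^sup>2 * sqrt (2 * ln (2 * (real n + 1) ^ (2 * (DIM('a) + 1))))"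
      by (intro mult_nonneg_nonneg) auto
  qed simp
  finally show ?thesis by (simp add: f_def S.prob_space)
qed

end

section \<open>Asymptotic equicontinuity in mean by truncation\<close>

context euclidean_law
begin

lemma truncation_tail:
  fixes g :: "'a \<Rightarrow> real"
  assumes [measurable]: "g \<in> borel_measurable borel" and g: "integrable P (\<lambda>x. (g x)\<^sup>2)"
  shows "(\<lambda>m. \<integral>x. (if \<bar>g x\<bar> \<le> real m then 0 else g x)\<^sup>2 \<partial>P) \<longlonglongrightarrow> 0"
proof -
  have "(\<lambda>m. \<integral>x. (if \<bar>g x\<bar> \<le> real m then 0 else g x)\<^sup>2 \<partial>P) \<longlonglongrightarrow> (\<integral>x. 0 \<partial>P)"
  proof (rule integral_dominated_convergence[where w = "\<lambda>x. (g x)\<^sup>2"])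
    show "AE x in P. (\<lambda>m. (if \<bar>g x\<bar> \<le> real m then 0 else g x)\<^sup>2) \<longlonglongrightarrow> 0"
    proof (rule AE_I2)
      fix x
      obtain m0 :: nat where m0: "\<bar>g x\<bar> \<le> real m0" using real_arch_simple by blast
      have "\<forall>\<^sub>F m in sequentially. (if \<bar>g x\<bar> \<le> real m then 0 else g x)\<^sup>2 = 0"
        using eventually_ge_at_top[of m0] by eventually_elim (use m0 in auto)
      then show "(\<lambda>m. (if \<bar>g x\<bar> \<le> real m then 0 else g x)\<^sup>2) \<longlonglongrightarrow> 0"
        by (rule tendsto_eventually)
    qed
  qed (use g in auto)
  then show ?thesis by simp
qed

lemma centred_sum_add:
  assumes "integrable P f1" "integrable P f2"
  shows "centred_sum n (\<lambda>y. f1 y + f2 y) x = centred_sum n f1 x + centred_sum n f2 x"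
  using assms by (simp add: centred_sum_def sum.distrib algebra_simps)

lemma entropy_rate:
  "(\<lambda>n. sqrt (2 * ln (2 * (real n + 1) ^ k)) / sqrt (real n)) \<longlonglongrightarrow> 0"
proof -
  have "(\<lambda>n. 2 * (ln 2 / real n) + 2 * real k * (ln (real n + 1) / real n)) \<longlonglongrightarrow> 2 * 0 + 2 * real k * 0"
    by (intro tendsto_add tendsto_mult tendsto_const; real_asymp)
  moreover have "ln (2 * (real n + 1) ^ k) = ln 2 + real k * ln (real n + 1)" for n
    by (simp add: ln_mult ln_realpow)
  ultimately have "(\<lambda>n. 2 * ln (2 * (real n + 1) ^ k) / real n) \<longlonglongrightarrow> 0"
    by (simp add: add_divide_distrib distrib_left mult.assoc)
  from tendsto_real_sqrt[OF this] show ?thesis by (simp add: real_sqrt_divide)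
qed

text \<open>The constants are chosen in the order \<open>m\<close>, \<open>k\<close>,
  \<open>d\<close>, \<open>n0\<close>. Truncation at \<open>m\<close> makes the tail
  \<open>g2\<close> negligible for all pairs; the level \<open>k\<close> makes the coarse term of
  the bounded part \<open>g1\<close> negligible; \<open>d\<close> is small against the factor
  \<open>k + 1\<close> of that level; large \<open>n\<close> brings the logarithmic excess of the
  empirical radius below \<open>n d\<close>.\<close>

lemma equicontinuity_in_mean:
  fixes g :: "'a \<Rightarrow> real"
  assumes [measurable]: "g \<in> borel_measurable borel" and g: "integrable P (\<lambda>x. (g x)\<^sup>2)" and e: "e > 0"
  obtains d n0 where "d > 0"
    "\<And>n PP. n \<ge> n0 \<Longrightarrow> finite PP \<Longrightarrow> PP \<noteq> {} \<Longrightarrow>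
      (\<And>h. h \<in> PP \<Longrightarrow> (\<integral>y. (g y)\<^sup>2 * indicator (hsym h) y \<partial>P) < d) \<Longrightarrow>
      (\<integral>x. (MAX h\<in>PP. \<bar>centred_sum n (hdiff g h) x\<bar>) \<partial>sample n) \<le> e * sqrt (real n)"
proof -
  define c where "c = half_const TYPE('a)"
  have c: "c \<ge> 2" by (simp add: c_def chain_const_ge)
  define G where "G = (\<integral>y. (g y)\<^sup>2 \<partial>P)"
  have "(\<lambda>m. 80 * c * sqrt (\<integral>x. (if \<bar>g x\<bar> \<le> real m then 0 else g x)\<^sup>2 \<partial>P)) \<longlonglongrightarrow> 80 * c * sqrt 0"
    by (intro tendsto_mult tendsto_const tendsto_real_sqrt truncation_tail[OF assms(1,2)])
  then have "\<forall>\<^sub>F m in sequentially. 80 * c * sqrt (\<integral>x. (if \<bar>g x\<bar> \<le> real m then 0 else g x)\<^sup>2 \<partial>P) < e / 2"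
    by (rule order_tendstoD) (use e in simp)
  then obtain m where m: "80 * c * sqrt (\<integral>x. (if \<bar>g x\<bar> \<le> real m then 0 else g x)\<^sup>2 \<partial>P) < e / 2"
    using eventually_happens trivial_limit_sequentially by blast
  define g1 where "g1 x = (if \<bar>g x\<bar> \<le> real m then g x else 0)" for x
  define g2 where "g2 x = (if \<bar>g x\<bar> \<le> real m then 0 else g x)" for x
  have [measurable]: "g1 \<in> borel_measurable borel" "g2 \<in> borel_measurable borel"
    unfolding g1_def[abs_def] g2_def[abs_def] by measurable
  have g1i: "integrable P (\<lambda>x. (g1 x)\<^sup>2)" and g2i: "integrable P (\<lambda>x. (g2 x)\<^sup>2)"
    by (rule Bochner_Integration.integrable_bound[OF g]; simp add: g1_def g2_def)+
  have G1: "(\<integral>y. (g1 y)\<^sup>2 \<partial>P) \<le> G"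
    unfolding G_def using g g1i by (intro integral_mono) (auto simp: g1_def)
  have "(\<lambda>k. 40 * c * sqrt G * ((real k + 1) / 2 ^ k)) \<longlonglongrightarrow> 40 * c * sqrt G * 0"
    by (intro tendsto_mult tendsto_const; real_asymp)
  then have "\<forall>\<^sub>F k in sequentially. 40 * c * sqrt G * ((real k + 1) / 2 ^ k) < e / 4"
    by (rule order_tendstoD) (use e in simp)
  then obtain k where k: "40 * c * sqrt G * ((real k + 1) / 2 ^ k) < e / 4"
    using eventually_happens trivial_limit_sequentially by blast
  define q where "q = 40 * c * (real k + 1)"
  have q: "q > 0" using c by (simp add: q_def)
  define L where "L n = sqrt (2 * ln (2 * (real n + 1) ^ (2 * (DIM('a) + 1))))" for n
  \<comment> \<open>Half of the admissible squared radius: the mean radius and its fluctuation may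
    take \<open>n d\<close> each, and \<open>q * sqrt (2 n d)\<close> equals
    \<open>e / 4 * sqrt n\<close>.\<close>
  define d where "d = (e / (4 * q))\<^sup>2 / 2"
  have d: "d > 0" using e q by (simp add: d_def)
  have "(\<lambda>n. 2 * (real m)\<^sup>2 * (L n / sqrt (real n))) \<longlonglongrightarrow> 2 * (real m)\<^sup>2 * 0"
    unfolding L_def by (intro tendsto_mult tendsto_const entropy_rate)
  then have "\<forall>\<^sub>F n in sequentially. 2 * (real m)\<^sup>2 * (L n / sqrt (real n)) < d"
    by (rule order_tendstoD) (use d in simp)
  then obtain n1 where n1: "\<And>n. n \<ge> n1 \<Longrightarrow> 2 * (real m)\<^sup>2 * (L n / sqrt (real n)) < d"
    by (auto simp: eventually_sequentially)
  show ?thesis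
  proof (rule that[of d "max n1 1"])
    show "d > 0" by (rule d)
    fix n PP
    assume n: "n \<ge> max n1 1" and PP: "finite PP" "PP \<noteq> {}"
      and close: "\<And>h. h \<in> PP \<Longrightarrow> (\<integral>y. (g y)\<^sup>2 * indicator (hsym h) y \<partial>P) < d"
    have n0: "real n > 0" using n by simp
    have split: "hdiff g h y = hdiff g1 h y + hdiff g2 h y" for h y
      by (simp add: hdiff_def g1_def g2_def)
    have i1: "integrable P (hdiff g1 h)" and i2: "integrable P (hdiff g2 h)" and i0: "integrable P (hdiff g h)" for h
      by (intro hdiff_integrable g1i g2i g; simp)+
    have csplit: "centred_sum n (hdiff g h) x = centred_sum n (hdiff g1 h) x + centred_sum n (hdiff g2 h) x" for h x
      using centred_sum_add[OF i1 i2, of n h h x] by (simp add: split[abs_def])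
    have I1: "integrable (sample n) (\<lambda>x. MAX h\<in>PP. \<bar>centred_sum n (hdiff g1 h) x\<bar>)"
      and I2: "integrable (sample n) (\<lambda>x. MAX h\<in>PP. \<bar>centred_sum n (hdiff g2 h) x\<bar>)"
      and I0: "integrable (sample n) (\<lambda>x. MAX h\<in>PP. \<bar>centred_sum n (hdiff g h) x\<bar>)"
      using PP i0 i1 i2 by (auto intro!: integrable_MAX integrable_abs centred_sum_integrable)
    have "(\<integral>x. (MAX h\<in>PP. \<bar>centred_sum n (hdiff g h) x\<bar>) \<partial>sample n)
        \<le> (\<integral>x. (MAX h\<in>PP. \<bar>centred_sum n (hdiff g1 h) x\<bar>) + (MAX h\<in>PP. \<bar>centred_sum n (hdiff g2 h) x\<bar>) \<partial>sample n)"
      using I0 I1 I2 PP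
      by (intro integral_mono Bochner_Integration.integrable_add Max_abs_add_le) (auto simp: csplit abs_triangle_ineq)
    also have "\<dots> = (\<integral>x. (MAX h\<in>PP. \<bar>centred_sum n (hdiff g1 h) x\<bar>) \<partial>sample n)
        + (\<integral>x. (MAX h\<in>PP. \<bar>centred_sum n (hdiff g2 h) x\<bar>) \<partial>sample n)"
      using I1 I2 by simp
    also have "\<dots> \<le> (e / 4 + e / 4) * sqrt (real n) + e / 2 * sqrt (real n)"
    proof (rule add_mono)
      have "(\<integral>x. (MAX h\<in>PP. \<bar>centred_sum n (hdiff g2 h) x\<bar>) \<partial>sample n)
          \<le> 80 * c * sqrt (\<integral>y. (g2 y)\<^sup>2 \<partial>P) * sqrt (real n)"
        unfolding c_def by (intro uniform_maximal_inequality g2i PP) simp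
      also have "\<dots> \<le> e / 2 * sqrt (real n)"
        using m by (intro mult_right_mono) (auto simp: g2_def)
      finally show "(\<integral>x. (MAX h\<in>PP. \<bar>centred_sum n (hdiff g2 h) x\<bar>) \<partial>sample n) \<le> e / 2 * sqrt (real n)" .
      have cl1: "(\<integral>y. (g1 y)\<^sup>2 * indicator (hsym h) y \<partial>P) \<le> d" if "h \<in> PP" for h
      proof -
        have "(\<integral>y. (g1 y)\<^sup>2 * indicator (hsym h) y \<partial>P) \<le> (\<integral>y. (g y)\<^sup>2 * indicator (hsym h) y \<partial>P)"
          by (intro integral_mono hsym_square_integrable g1i g) (auto simp: g1_def indicator_def)
        then show ?thesis using close[OF that] by linarith
      qed
      let ?R = "\<integral>x. (MAX h\<in>PP. \<Sum>i<n. (g1 (x i))\<^sup>2 * indicator (hsym h) (x i)) \<partial>sample n"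
      have "?R \<le> real n * d + 2 * (sqrt (real n) * (real m)\<^sup>2 * L n)"
        unfolding L_def by (rule empirical_radius_bound[OF _ _ PP cl1]) (auto simp: g1_def)
      also have "2 * (sqrt (real n) * (real m)\<^sup>2 * L n) = real n * (2 * (real m)\<^sup>2 * (L n / sqrt (real n)))"
        using n0 by (simp add: field_simps)
      also have "\<dots> \<le> real n * d" using n1[of n] n by (intro mult_left_mono) auto
      finally have "?R \<le> real n * (e / (4 * q))\<^sup>2" by (simp add: d_def)
      then have "sqrt ?R \<le> sqrt (real n * (e / (4 * q))\<^sup>2)" by simp
      also have "\<dots> = sqrt (real n) * (e / (4 * q))" using e q by (simp add: real_sqrt_mult)
      finally have R: "sqrt ?R \<le> sqrt (real n) * (e / (4 * q))" .
      have "(\<integral>x. (MAX h\<in>PP. \<bar>centred_sum n (hdiff g1 h) x\<bar>) \<partial>sample n)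
          \<le> q * (sqrt (real n * (\<integral>y. (g1 y)\<^sup>2 \<partial>P)) / 2 ^ k + sqrt ?R)"
        unfolding q_def c_def by (intro chaining_maximal_inequality g1i PP) simp
      also have "\<dots> \<le> q * (sqrt (real n * G) / 2 ^ k + sqrt (real n) * (e / (4 * q)))"
        using q R G1 by (intro mult_left_mono add_mono divide_right_mono) (auto intro!: mult_left_mono)
      also have "\<dots> = (40 * c * sqrt G * ((real k + 1) / 2 ^ k)) * sqrt (real n) + e / 4 * sqrt (real n)"
      proof -
        have "q * (sqrt (real n) * (e / (4 * q))) = e / 4 * sqrt (real n)" using q by simp
        moreover have "q * (sqrt (real n * G) / 2 ^ k) = (40 * c * sqrt G * ((real k + 1) / 2 ^ k)) * sqrt (real n)"
          by (simp add: q_def real_sqrt_mult)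
        ultimately show ?thesis by (simp only: distrib_left)
      qed
      also have "\<dots> \<le> e / 4 * sqrt (real n) + e / 4 * sqrt (real n)"
        using k by (intro add_mono mult_right_mono) auto
      finally show "(\<integral>x. (MAX h\<in>PP. \<bar>centred_sum n (hdiff g1 h) x\<bar>) \<partial>sample n) \<le> (e / 4 + e / 4) * sqrt (real n)"
        by (simp add: distrib_right)
    qed
    also have "\<dots> = e * sqrt (real n)" by (simp add: field_simps)
    finally show "(\<integral>x. (MAX h\<in>PP. \<bar>centred_sum n (hdiff g h) x\<bar>) \<partial>sample n) \<le> e * sqrt (real n)" .
  qed
qed

end

text \<open>Shifting the threshold down by about \<open>1/k\<close> and the normal by at most \<open>1/k\<^sup>2\<close> keeps
  every boundary point inside eventually, so the indicators converge at every point.\<close>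

lemma halfspace_countable_dense:
  obtains D :: "('a::euclidean_space \<times> real) set" where "countable D"
    "\<And>h. \<exists>s. (\<forall>k. s k \<in> D) \<and> (\<forall>x. \<forall>\<^sub>F k in sequentially. x \<in> halfspace (s k) \<longleftrightarrow> x \<in> halfspace h)"
proof -
  obtain D :: "('a \<times> real) set" where D: "countable D" "\<And>X. open X \<Longrightarrow> X \<noteq> {} \<Longrightarrow> \<exists>d\<in>D. d \<in> X"
    using countable_dense_exists by blast
  have "\<exists>s. (\<forall>k. s k \<in> D) \<and> (\<forall>x. \<forall>\<^sub>F k in sequentially. x \<in> halfspace (s k) \<longleftrightarrow> x \<in> halfspace h)" for h
  proof -
    obtain p q where h: "h = (p, q)" by fastforce
    define r where "r k = 1 / (real k + 1)" for k
    have r: "r k > 0" "r k \<le> 1" for k by (simp_all add: r_def)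
    define V where "V k = ball p ((r k)\<^sup>2) \<times> {q - 2 * r k <..< q - r k}" for k
    have "\<exists>d. d \<in> D \<and> d \<in> V k" for k
    proof -
      have "open (V k)" unfolding V_def by (intro open_Times) auto
      moreover have "(p, q - 3 / 2 * r k) \<in> V k" using r[of k] by (simp add: V_def)
      ultimately show ?thesis using D(2)[of "V k"] by blast
    qed
    then obtain s where s: "\<And>k. s k \<in> D" "\<And>k. s k \<in> V k" by metis
    have r0: "r \<longlonglongrightarrow> 0" unfolding r_def by real_asymp
    have "\<forall>\<^sub>F k in sequentially. x \<in> halfspace (s k) \<longleftrightarrow> x \<in> halfspace h" for x
    proof -
      have near: "\<bar>fst (s k) \<bullet> x - p \<bullet> x\<bar> \<le> (r k)\<^sup>2 * norm x"
        "snd (s k) < q - r k" "snd (s k) > q - 2 * r k" for k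
      proof -
        have s': "dist p (fst (s k)) < (r k)\<^sup>2" "snd (s k) < q - r k" "snd (s k) > q - 2 * r k"
          using s(2)[of k] by (auto simp: V_def mem_Times_iff)
        have "\<bar>fst (s k) \<bullet> x - p \<bullet> x\<bar> = \<bar>(fst (s k) - p) \<bullet> x\<bar>" by (simp add: inner_diff_left)
        also have "\<dots> \<le> norm (fst (s k) - p) * norm x" by (rule Cauchy_Schwarz_ineq2)
        also have "\<dots> \<le> (r k)\<^sup>2 * norm x"
          using s'(1) by (intro mult_right_mono) (auto simp: dist_norm norm_minus_commute)
        finally show "\<bar>fst (s k) \<bullet> x - p \<bullet> x\<bar> \<le> (r k)\<^sup>2 * norm x" .
        show "snd (s k) < q - r k" "snd (s k) > q - 2 * r k" using s' by auto
      qed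
      show ?thesis
      proof (cases "q \<le> p \<bullet> x")
        case True
        have "(\<lambda>k. r k * norm x) \<longlonglongrightarrow> 0 * norm x" by (intro tendsto_mult r0 tendsto_const)
        then have "\<forall>\<^sub>F k in sequentially. r k * norm x < 1" by (rule order_tendstoD) simp
        then show ?thesis
        proof eventually_elim
          case (elim k)
          have "r k * (r k * norm x) \<le> r k * 1" using elim r(1)[of k] by (intro mult_left_mono) auto
          then have "(r k)\<^sup>2 * norm x \<le> r k" by (simp add: power2_eq_square mult_ac)
          then show ?case using near[of k] True by (auto simp: halfspace_def h)
        qed
      next
        case False
        have "(\<lambda>k. (r k)\<^sup>2 * norm x + 2 * r k) \<longlonglongrightarrow> 0\<^sup>2 * norm x + 2 * 0"
          by (intro tendsto_intros r0)
        then have "\<forall>\<^sub>F k in sequentially. (r k)\<^sup>2 * norm x + 2 * r k < q - p \<bullet> x"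
          by (rule order_tendstoD) (use False in simp)
        then show ?thesis
        proof eventually_elim
          case (elim k)
          then show ?case using near[of k] False by (auto simp: halfspace_def h)
        qed
      qed
    qed
    then show ?thesis using s(1) by blast
  qed
  then show ?thesis using that D(1) by blast
qed

section \<open>From finite families to all pairs of half-spaces\<close>

context euclidean_law
begin

text \<open>The exceptional event concerns countably many pairs from a dense family and is therefore
  measurable. For an arbitrary pair, approximating indicators agree with the given ones eventually
  at each point, so by dominated convergence both the centred sums and the radii converge. The
  strict inequality for the radius passes to the approximating pairs, and the weak inequality for
  the centred sum passes back to the limit.\<close>

lemma uniform_event:
  fixes g :: "'a \<Rightarrow> real"
  assumes [measurable]: "g \<in> borel_measurable borel" and g: "integrable P (\<lambda>x. (g x)\<^sup>2)"
    and B: "\<And>PP. finite PP \<Longrightarrow> PP \<noteq> {} \<Longrightarrow>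
      (\<And>h. h \<in> PP \<Longrightarrow> (\<integral>y. (g y)\<^sup>2 * indicator (hsym h) y \<partial>P) < d) \<Longrightarrow>
      (\<integral>x. (MAX h\<in>PP. \<bar>centred_sum n (hdiff g h) x\<bar>) \<partial>sample n) \<le> B"
    and t: "t > 0" and B0: "B \<ge> 0"
  obtains E where "E \<in> sets (sample n)" "measure (sample n) E \<le> B / t"
    "\<And>x h. x \<in> space (sample n) - E \<Longrightarrow> (\<integral>y. (g y)\<^sup>2 * indicator (hsym h) y \<partial>P) < d \<Longrightarrow>
      \<bar>centred_sum n (hdiff g h) x\<bar> \<le> t"
proof -
  interpret S: prob_space "sample n" by (rule prob_space_sample)
  obtain D :: "('a \<times> real) set" where D: "countable D"
    "\<And>h. \<exists>s. (\<forall>k. s k \<in> D) \<and> (\<forall>x. \<forall>\<^sub>F k in sequentially. x \<in> halfspace (s k) \<longleftrightarrow> x \<in> halfspace h)"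
    using halfspace_countable_dense by blast
  define C where "C = {h \<in> D \<times> D. (\<integral>y. (g y)\<^sup>2 * indicator (hsym h) y \<partial>P) < d}"
  have C: "countable C" by (rule countable_subset[of _ "D \<times> D"]) (auto simp: C_def D(1))
  define E where "E = {x \<in> space (sample n). \<exists>h\<in>C. \<bar>centred_sum n (hdiff g h) x\<bar> > t}"
  have E: "E \<in> sets (sample n)" "measure (sample n) E \<le> B / t"
    unfolding E_def
    by (rule S.prob_Ex_countable_gt_le[OF C _ _ _ t B0];
        use hdiff_integrable[OF assms(1) g] in \<open>auto intro!: integrable_abs centred_sum_integrable B simp: C_def\<close>)+
  have "\<bar>centred_sum n (hdiff g h) x\<bar> \<le> t"
    if x: "x \<in> space (sample n) - E" and h: "(\<integral>y. (g y)\<^sup>2 * indicator (hsym h) y \<partial>P) < d" for x h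
  proof -
    obtain s1 where s1: "\<And>k. s1 k \<in> D"
      "\<And>x. \<forall>\<^sub>F k in sequentially. x \<in> halfspace (s1 k) \<longleftrightarrow> x \<in> halfspace (fst h)"
      using D(2)[of "fst h"] by blast
    obtain s2 where s2: "\<And>k. s2 k \<in> D"
      "\<And>x. \<forall>\<^sub>F k in sequentially. x \<in> halfspace (s2 k) \<longleftrightarrow> x \<in> halfspace (snd h)"
      using D(2)[of "snd h"] by blast
    define s where "s k = (s1 k, s2 k)" for k
    have ev: "\<forall>\<^sub>F k in sequentially. hdiff g (s k) y = hdiff g h y \<and> (y \<in> hsym (s k) \<longleftrightarrow> y \<in> hsym h)" for y
      using s1(2)[of y] s2(2)[of y] by eventually_elim (auto simp: hdiff_def hsym_def s_def indicator_def)
    have lim1: "(\<lambda>k. hdiff g (s k) y) \<longlonglongrightarrow> hdiff g h y" for y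
      by (rule tendsto_eventually) (use ev[of y] in eventually_elim, simp)
    have lim2: "(\<lambda>k. (g y)\<^sup>2 * indicator (hsym (s k)) y) \<longlonglongrightarrow> (g y)\<^sup>2 * indicator (hsym h) y" for y
      by (rule tendsto_eventually) (use ev[of y] in eventually_elim, simp add: indicator_def)
    have "(\<lambda>k. \<integral>y. hdiff g (s k) y \<partial>P) \<longlonglongrightarrow> (\<integral>y. hdiff g h y \<partial>P)"
      using lim1 integrable_abs[OF square_integrable_imp_integrable[OF assms(1) g]]
      by (intro integral_dominated_convergence[where w = "\<lambda>y. \<bar>g y\<bar>"]) (auto simp: hdiff_abs_le)
    then have lim: "(\<lambda>k. \<bar>centred_sum n (hdiff g (s k)) x\<bar>) \<longlonglongrightarrow> \<bar>centred_sum n (hdiff g h) x\<bar>"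
      unfolding centred_sum_def using lim1 by (intro tendsto_intros)
    have "(\<lambda>k. \<integral>y. (g y)\<^sup>2 * indicator (hsym (s k)) y \<partial>P) \<longlonglongrightarrow> (\<integral>y. (g y)\<^sup>2 * indicator (hsym h) y \<partial>P)"
      using lim2 g
      by (intro integral_dominated_convergence[where w = "\<lambda>y. (g y)\<^sup>2"]) (auto simp: indicator_def)
    then have "\<forall>\<^sub>F k in sequentially. (\<integral>y. (g y)\<^sup>2 * indicator (hsym (s k)) y \<partial>P) < d"
      by (rule order_tendstoD) (rule h)
    then have "\<forall>\<^sub>F k in sequentially. \<bar>centred_sum n (hdiff g (s k)) x\<bar> \<le> t"
    proof eventually_elim
      case (elim k)
      then have "s k \<in> C" using s1(1) s2(1) by (simp add: C_def s_def)
      then show ?case using x by (auto simp: E_def not_less)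
    qed
    then show ?thesis by (intro tendsto_upperbound[OF lim]) auto
  qed
  then show ?thesis using that E by blast
qed

end

section \<open>Events of probability tending to one\<close>

context prob_space
begin

text \<open>The failure of \<open>\<Phi>\<close> is only enclosed in a measurable set of small
  probability, so \<open>\<Phi>\<close> may be non-measurable. This is exactly what a statement on
  outer probabilities asks for.\<close>

definition whp :: "(nat \<Rightarrow> 'a \<Rightarrow> bool) \<Rightarrow> bool" where
  "whp \<Phi> \<longleftrightarrow> (\<forall>\<alpha>>0. \<exists>n0. \<forall>n\<ge>n0. \<exists>B\<in>sets M. measure M B \<le> \<alpha> \<and> (\<forall>\<omega>\<in>space M - B. \<Phi> n \<omega>))"

text \<open>The constant may depend on \<open>\<alpha>\<close> but not on \<open>n\<close>. With
  \<open>C\<close> as a bound this expresses boundedness in probability; with \<open>C\<close> as a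
  radius it expresses asymptotic equicontinuity.\<close>

definition tight_family :: "(real \<Rightarrow> nat \<Rightarrow> 'a \<Rightarrow> bool) \<Rightarrow> bool" where
  "tight_family \<Psi> \<longleftrightarrow> (\<forall>\<alpha>>0. \<exists>C>0. \<exists>n0. \<forall>n\<ge>n0. \<exists>B\<in>sets M. measure M B \<le> \<alpha> \<and> (\<forall>\<omega>\<in>space M - B. \<Psi> C n \<omega>))"

lemma whp_mono:
  assumes "whp \<Phi>" "\<And>n \<omega>. n \<ge> N \<Longrightarrow> \<omega> \<in> space M \<Longrightarrow> \<Phi> n \<omega> \<Longrightarrow> \<Psi> n \<omega>"
  shows "whp \<Psi>"
  unfolding whp_def
proof (intro allI impI)
  fix \<alpha> :: real assume "\<alpha> > 0"
  then obtain n0 where n0: "\<And>n. n \<ge> n0 \<Longrightarrow> \<exists>B\<in>sets M. measure M B \<le> \<alpha> \<and> (\<forall>\<omega>\<in>space M - B. \<Phi> n \<omega>)"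
    using assms(1) unfolding whp_def by blast
  show "\<exists>n0. \<forall>n\<ge>n0. \<exists>B\<in>sets M. measure M B \<le> \<alpha> \<and> (\<forall>\<omega>\<in>space M - B. \<Psi> n \<omega>)"
  proof (intro exI[of _ "max n0 N"] allI impI)
    fix n assume n: "n \<ge> max n0 N"
    then obtain B where "B \<in> sets M" "measure M B \<le> \<alpha>" "\<forall>\<omega>\<in>space M - B. \<Phi> n \<omega>"
      using n0[of n] by auto
    then show "\<exists>B\<in>sets M. measure M B \<le> \<alpha> \<and> (\<forall>\<omega>\<in>space M - B. \<Psi> n \<omega>)"
      using assms(2) n by (intro bexI[of _ B]) auto
  qed
qed

text \<open>Tightness fixes the constant before \<open>\<Phi> C\<close> is invoked, so
  \<open>\<Phi>\<close> may demand a smallness that depends on \<open>C\<close>. This covers a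
  bounded factor times a vanishing one, and also an equicontinuity radius that random pairs
  eventually meet.\<close>

lemma tight_family_whp:
  assumes "tight_family \<Psi>" "\<And>C. C > 0 \<Longrightarrow> whp (\<Phi> C)"
  shows "whp (\<lambda>n \<omega>. \<exists>C>0. \<Psi> C n \<omega> \<and> \<Phi> C n \<omega>)"
  unfolding whp_def
proof (intro allI impI)
  fix \<alpha> :: real assume "\<alpha> > 0"
  then have a2: "\<alpha> / 2 > 0" by simp
  obtain C n1 where C: "C > 0"
    and n1: "\<And>n. n \<ge> n1 \<Longrightarrow> \<exists>B\<in>sets M. measure M B \<le> \<alpha> / 2 \<and> (\<forall>\<omega>\<in>space M - B. \<Psi> C n \<omega>)"
    using assms(1) a2 unfolding tight_family_def by blast
  obtain n2 where n2: "\<And>n. n \<ge> n2 \<Longrightarrow> \<exists>B\<in>sets M. measure M B \<le> \<alpha> / 2 \<and> (\<forall>\<omega>\<in>space M - B. \<Phi> C n \<omega>)"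
    using assms(2)[OF C] a2 unfolding whp_def by blast
  show "\<exists>n0. \<forall>n\<ge>n0. \<exists>B\<in>sets M. measure M B \<le> \<alpha> \<and> (\<forall>\<omega>\<in>space M - B. \<exists>C>0. \<Psi> C n \<omega> \<and> \<Phi> C n \<omega>)"
  proof (intro exI[of _ "max n1 n2"] allI impI)
    fix n assume n: "n \<ge> max n1 n2"
    obtain B1 where B1: "B1 \<in> sets M" "measure M B1 \<le> \<alpha> / 2" "\<forall>\<omega>\<in>space M - B1. \<Psi> C n \<omega>"
      using n1[of n] n by auto
    obtain B2 where B2: "B2 \<in> sets M" "measure M B2 \<le> \<alpha> / 2" "\<forall>\<omega>\<in>space M - B2. \<Phi> C n \<omega>"
      using n2[of n] n by auto
    have "measure M (B1 \<union> B2) \<le> measure M B1 + measure M B2"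
      using B1 B2 by (intro measure_Un_le)
    then show "\<exists>B\<in>sets M. measure M B \<le> \<alpha> \<and> (\<forall>\<omega>\<in>space M - B. \<exists>C>0. \<Psi> C n \<omega> \<and> \<Phi> C n \<omega>)"
      using B1 B2 C by (intro bexI[of _ "B1 \<union> B2"]) auto
  qed
qed

lemma whp_conj:
  assumes "whp \<Phi>" "whp \<Psi>"
  shows "whp (\<lambda>n \<omega>. \<Phi> n \<omega> \<and> \<Psi> n \<omega>)"
proof -
  have "tight_family (\<lambda>_. \<Phi>)"
    using assms(1) unfolding whp_def tight_family_def by (meson zero_less_one)
  from tight_family_whp[OF this, of "\<lambda>_. \<Psi>"] assms(2) show ?thesis by (auto elim!: whp_mono)
qed

lemma whp_ball_finite:
  assumes "finite A" "\<And>a. a \<in> A \<Longrightarrow> whp (\<Phi> a)"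
  shows "whp (\<lambda>n \<omega>. \<forall>a\<in>A. \<Phi> a n \<omega>)"
  using assms
proof (induction A rule: finite_induct)
  case empty
  then show ?case unfolding whp_def by (auto intro!: bexI[of _ "{}"])
next
  case (insert a A)
  then have "whp (\<lambda>n \<omega>. \<Phi> a n \<omega> \<and> (\<forall>a\<in>A. \<Phi> a n \<omega>))" by (intro whp_conj) auto
  then show ?case by (rule whp_mono) auto
qed

lemma whp_imp_outer_prob_tendsto_0:
  assumes "whp \<Phi>"
  shows "(\<lambda>n. outer_prob M {\<omega> \<in> space M. \<not> \<Phi> n \<omega>}) \<longlonglongrightarrow> 0"
proof (rule LIMSEQ_I)
  fix r :: real assume "r > 0"
  then have "r / 2 > 0" by simp
  then obtain n0 where n0: "\<And>n. n \<ge> n0 \<Longrightarrow> \<exists>B\<in>sets M. measure M B \<le> r / 2 \<and> (\<forall>\<omega>\<in>space M - B. \<Phi> n \<omega>)"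
    using assms unfolding whp_def by blast
  have "norm (outer_prob M {\<omega> \<in> space M. \<not> \<Phi> n \<omega>} - 0) < r" if n: "n \<ge> n0" for n
  proof -
    let ?S = "{measure M B | B. B \<in> sets M \<and> {\<omega> \<in> space M. \<not> \<Phi> n \<omega>} \<subseteq> B}"
    obtain B where B: "B \<in> sets M" "measure M B \<le> r / 2" "\<forall>\<omega>\<in>space M - B. \<Phi> n \<omega>"
      using n0[OF n] by blast
    have mem: "measure M B \<in> ?S" using B by blast
    have "bdd_below ?S" by (rule bdd_belowI[of _ 0]) auto
    then have "Inf ?S \<le> measure M B" using mem by (intro cInf_lower)
    moreover have "0 \<le> Inf ?S" using mem by (intro cInf_greatest) auto
    ultimately show ?thesis using B(2) \<open>r > 0\<close> by (simp add: outer_prob_def)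
  qed
  then show "\<exists>n0. \<forall>n\<ge>n0. norm (outer_prob M {\<omega> \<in> space M. \<not> \<Phi> n \<omega>} - 0) < r" by blast
qed

end

section \<open>A weak law of large numbers in mean\<close>

context euclidean_law
begin

lemma integrable_truncation_tail:
  fixes f :: "'a \<Rightarrow> real"
  assumes f: "integrable P f"
  shows "(\<lambda>m. \<integral>x. \<bar>if \<bar>f x\<bar> \<le> real m then 0 else f x\<bar> \<partial>P) \<longlonglongrightarrow> 0"
proof -
  have [measurable]: "f \<in> borel_measurable P" using f by simp
  have "(\<lambda>m. \<integral>x. \<bar>if \<bar>f x\<bar> \<le> real m then 0 else f x\<bar> \<partial>P) \<longlonglongrightarrow> (\<integral>x. 0 \<partial>P)"
  proof (rule integral_dominated_convergence[where w = "\<lambda>x. \<bar>f x\<bar>"])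
    show "AE x in P. (\<lambda>m. \<bar>if \<bar>f x\<bar> \<le> real m then 0 else f x\<bar>) \<longlonglongrightarrow> 0"
    proof (rule AE_I2)
      fix x
      obtain m0 :: nat where m0: "\<bar>f x\<bar> \<le> real m0" using real_arch_simple by blast
      have "\<forall>\<^sub>F m in sequentially. \<bar>if \<bar>f x\<bar> \<le> real m then 0 else f x\<bar> = 0"
        using eventually_ge_at_top[of m0] by eventually_elim (use m0 in auto)
      then show "(\<lambda>m. \<bar>if \<bar>f x\<bar> \<le> real m then 0 else f x\<bar>) \<longlonglongrightarrow> 0"
        by (rule tendsto_eventually)
    qed
  qed (use f in auto)
  then show ?thesis by simp
qed

text \<open>The hypothesis is mere integrability because the law will be applied to products of two
  coordinates, which may lack a second moment. After truncation the bounded part has a centred sum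
  of order \<open>sqrt n\<close>, and the tail costs at most \<open>2 n\<close> times its first
  absolute moment.\<close>

lemma centred_sum_mean_small:
  fixes f :: "'a \<Rightarrow> real"
  assumes f: "integrable P f" and e: "e > 0"
  obtains n0 where "\<And>n. n \<ge> n0 \<Longrightarrow> (\<integral>x. \<bar>centred_sum n f x\<bar> \<partial>sample n) \<le> e * real n"
proof -
  have [measurable]: "f \<in> borel_measurable borel"
    using f borel_measurable_integrable measurable_cong_sets[OF sets_P refl] by blast
  have "\<forall>\<^sub>F m in sequentially. (\<integral>x. \<bar>if \<bar>f x\<bar> \<le> real m then 0 else f x\<bar> \<partial>P) < e / 4"
    using integrable_truncation_tail[OF f] by (rule order_tendstoD) (use e in simp)
  then obtain m where m: "(\<integral>x. \<bar>if \<bar>f x\<bar> \<le> real m then 0 else f x\<bar> \<partial>P) < e / 4"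
    using eventually_happens trivial_limit_sequentially by blast
  define f1 where "f1 x = (if \<bar>f x\<bar> \<le> real m then f x else 0)" for x
  define f2 where "f2 x = (if \<bar>f x\<bar> \<le> real m then 0 else f x)" for x
  have [measurable]: "f1 \<in> borel_measurable borel" "f2 \<in> borel_measurable borel"
    unfolding f1_def[abs_def] f2_def[abs_def] by measurable
  have f2i: "integrable P f2" by (rule Bochner_Integration.integrable_bound[OF f]) (auto simp: f2_def)
  have f1sq: "integrable P (\<lambda>x. (f1 x)\<^sup>2)"
    by (rule integrable_const_bound[of _ "(real m)\<^sup>2"]) (auto simp: f1_def power2_le_iff_abs_le)
  have f1i: "integrable P f1" by (rule square_integrable_imp_integrable[OF _ f1sq]) simp
  define K where "K = 80 * half_const TYPE('a) * sqrt (\<integral>y. (f1 y)\<^sup>2 \<partial>P)"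
  have b1: "(\<integral>x. \<bar>centred_sum n f1 x\<bar> \<partial>sample n) \<le> K * sqrt (real n)" for n
  proof -
    \<comment> \<open>The pair of the whole space and the empty set reduces the maximal inequality
      to the single function \<open>f1\<close>.\<close>
    have "hdiff f1 ((0, 0), (0, 1)) = f1" by (auto simp: hdiff_def halfspace_def)
    then show ?thesis
      using uniform_maximal_inequality[of f1 "{((0, 0), (0, 1))}" n] f1sq by (simp add: K_def)
  qed
  have b2: "(\<integral>x. \<bar>centred_sum n f2 x\<bar> \<partial>sample n) \<le> e / 2 * real n" for n
  proof -
    interpret S: prob_space "sample n" by (rule prob_space_sample)
    have "(\<integral>x. \<bar>centred_sum n f2 x\<bar> \<partial>sample n)
        \<le> (\<integral>x. (\<Sum>i<n. \<bar>f2 (x i)\<bar>) + real n * (\<integral>y. \<bar>f2 y\<bar> \<partial>P) \<partial>sample n)"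
    proof (rule integral_mono)
      show "integrable (sample n) (\<lambda>x. \<bar>centred_sum n f2 x\<bar>)"
        using f2i by (intro integrable_abs centred_sum_integrable)
      show "integrable (sample n) (\<lambda>x. (\<Sum>i<n. \<bar>f2 (x i)\<bar>) + real n * (\<integral>y. \<bar>f2 y\<bar> \<partial>P))"
        using sample_integrable(1)[OF integrable_abs[OF f2i]] by simp
      fix x
      have "\<bar>\<Sum>i<n. f2 (x i)\<bar> \<le> (\<Sum>i<n. \<bar>f2 (x i)\<bar>)" by (rule sum_abs)
      moreover have "\<bar>real n * (\<integral>y. f2 y \<partial>P)\<bar> \<le> real n * (\<integral>y. \<bar>f2 y\<bar> \<partial>P)"
        by (simp add: abs_mult mult_left_mono integral_abs_bound)
      ultimately show "\<bar>centred_sum n f2 x\<bar> \<le> (\<Sum>i<n. \<bar>f2 (x i)\<bar>) + real n * (\<integral>y. \<bar>f2 y\<bar> \<partial>P)"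
        unfolding centred_sum_def by linarith
    qed
    also have "\<dots> = real n * (2 * (\<integral>y. \<bar>f2 y\<bar> \<partial>P))"
      using sample_integrable[OF integrable_abs[OF f2i], of n] by (simp add: S.prob_space)
    also have "\<dots> \<le> real n * (e / 2)" using m by (intro mult_left_mono) (auto simp: f2_def)
    finally show ?thesis by (simp add: mult.commute)
  qed
  have "(\<lambda>n. K * (1 / sqrt (real n))) \<longlonglongrightarrow> K * 0" by (intro tendsto_mult tendsto_const; real_asymp)
  then have "\<forall>\<^sub>F n in sequentially. K * (1 / sqrt (real n)) < e / 2" by (rule order_tendstoD) (use e in simp)
  then obtain n1 where n1: "\<And>n. n \<ge> n1 \<Longrightarrow> K * (1 / sqrt (real n)) < e / 2"
    by (auto simp: eventually_sequentially)
  show ?thesis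
  proof (rule that[of "max n1 1"])
    fix n assume n: "n \<ge> max n1 1"
    have "f = (\<lambda>y. f1 y + f2 y)" by (auto simp: f1_def f2_def)
    then have cs: "centred_sum n f x = centred_sum n f1 x + centred_sum n f2 x" for x
      using centred_sum_add[OF f1i f2i] by metis
    have "(\<integral>x. \<bar>centred_sum n f x\<bar> \<partial>sample n) \<le> (\<integral>x. \<bar>centred_sum n f1 x\<bar> + \<bar>centred_sum n f2 x\<bar> \<partial>sample n)"
      using f f1i f2i
      by (intro integral_mono Bochner_Integration.integrable_add integrable_abs centred_sum_integrable)
        (auto simp: cs abs_triangle_ineq)
    also have "\<dots> = (\<integral>x. \<bar>centred_sum n f1 x\<bar> \<partial>sample n) + (\<integral>x. \<bar>centred_sum n f2 x\<bar> \<partial>sample n)"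
      using f1i f2i centred_sum_integrable by simp
    also have "\<dots> \<le> K * sqrt (real n) + e / 2 * real n" using b1 b2 by (intro add_mono)
    also have "K * sqrt (real n) = K * (1 / sqrt (real n)) * real n"
      using n by (simp add: field_simps)
    also have "\<dots> \<le> e / 2 * real n" using n1[of n] n by (intro mult_right_mono) auto
    finally show "(\<integral>x. \<bar>centred_sum n f x\<bar> \<partial>sample n) \<le> e * real n" by (simp add: field_simps)
  qed
qed

end

section \<open>Half-spaces under perturbation of the parameters\<close>

definition theta_halfspace :: "real^'d \<Rightarrow> real \<Rightarrow> real^'d^'d \<Rightarrow> real^'d \<Rightarrow> (real^'d) \<times> real" where
  "theta_halfspace u c A m = (transpose A *v u, c + u \<bullet> (A *v m))"

lemma transpose_mult_inner: "(transpose A *v u) \<bullet> x = u \<bullet> (A *v x)" for A :: "real^'d^'d"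
  by (simp add: dot_lmul_matrix transpose_matrix_vector)

lemma mem_theta_halfspace: "x \<in> halfspace (theta_halfspace u c A m) \<longleftrightarrow> c \<le> u \<bullet> (A *v (x - m))"
  by (auto simp: halfspace_def theta_halfspace_def dot_lmul_matrix matrix_vector_mult_diff_distrib inner_diff_right)

text \<open>A subsequence of the normals converges and the thresholds converge in \<open>[-\<infinity>, \<infinity>]\<close>; off the limiting
  hyperplane, a null set, the two indicators eventually coincide.\<close>

lemma theta_halfspace_uniform_continuity:
  fixes P :: "(real^'d) measure" and A0 :: "real^'d^'d" and g :: "real^'d \<Rightarrow> real"
  assumes "euclidean_law P" and ac: "absolutely_continuous lborel P"
    and [measurable]: "g \<in> borel_measurable borel" and g: "integrable P (\<lambda>x. (g x)\<^sup>2)"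
    and A0: "invertible A0" and d: "d > 0"
  obtains r where "r > 0" "\<And>A m u c. norm (A - A0) < r \<Longrightarrow> norm (m - m0) < r \<Longrightarrow> norm u = 1 \<Longrightarrow>
    (\<integral>y. (g y)\<^sup>2 * indicator (hsym (theta_halfspace u c A m, theta_halfspace u c A0 m0)) y \<partial>P) < d"
proof (rule ccontr)
  interpret euclidean_law P by fact
  define I where "I A m u c = (\<integral>y. (g y)\<^sup>2 * indicator (hsym (theta_halfspace u c A m, theta_halfspace u c A0 m0)) y \<partial>P)"
    for A m u c
  note witness = that
  assume "\<not> thesis"
  then have "\<exists>A m u c. norm (A - A0) < r \<and> norm (m - m0) < r \<and> norm u = 1 \<and> I A m u c \<ge> d" if "r > 0" for r
    using witness[of r] that \<open>\<not> thesis\<close> unfolding I_def by (meson not_less)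
  then have "\<exists>p. norm (fst p - A0) < 1 / real (Suc k) \<and> norm (fst (snd p) - m0) < 1 / real (Suc k)
      \<and> norm (fst (snd (snd p))) = 1 \<and> I (fst p) (fst (snd p)) (fst (snd (snd p))) (snd (snd (snd p))) \<ge> d" for k
    by (metis fst_conv snd_conv of_nat_0_less_iff zero_less_Suc zero_less_divide_1_iff)
  then obtain p where p: "\<And>k. norm (fst (p k) - A0) < 1 / real (Suc k)" "\<And>k. norm (fst (snd (p k)) - m0) < 1 / real (Suc k)"
      "\<And>k. norm (fst (snd (snd (p k)))) = 1"
      "\<And>k. I (fst (p k)) (fst (snd (p k))) (fst (snd (snd (p k)))) (snd (snd (snd (p k)))) \<ge> d"
    by metis
  define A where "A k = fst (p k)" for k
  define m where "m k = fst (snd (p k))" for k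
  define u where "u k = fst (snd (snd (p k)))" for k
  define c where "c k = snd (snd (snd (p k)))" for k
  have A: "A \<longlonglongrightarrow> A0"
  proof (rule LIM_zero_cancel, rule tendsto_norm_zero_cancel)
    show "(\<lambda>k. norm (A k - A0)) \<longlonglongrightarrow> 0"
      by (rule tendsto_sandwich[OF _ _ tendsto_const LIMSEQ_inverse_real_of_nat])
        (use p(1) in \<open>auto simp: A_def inverse_eq_divide intro!: always_eventually less_imp_le\<close>)
  qed
  have m: "m \<longlonglongrightarrow> m0"
  proof (rule LIM_zero_cancel, rule tendsto_norm_zero_cancel)
    show "(\<lambda>k. norm (m k - m0)) \<longlonglongrightarrow> 0"
      by (rule tendsto_sandwich[OF _ _ tendsto_const LIMSEQ_inverse_real_of_nat])
        (use p(2) in \<open>auto simp: m_def inverse_eq_divide intro!: always_eventually less_imp_le\<close>)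
  qed
  have "\<forall>k. u k \<in> sphere 0 1" using p(3) by (simp add: u_def)
  then obtain l s1 where l: "l \<in> sphere 0 1" "strict_mono (s1::nat \<Rightarrow> nat)" "(u \<circ> s1) \<longlonglongrightarrow> l"
    using compact_imp_seq_compact[OF compact_sphere] unfolding seq_compact_def by metis
  obtain t s2 where t: "strict_mono (s2::nat \<Rightarrow> nat)" "((\<lambda>k. ereal (c (s1 k))) \<circ> s2) \<longlonglongrightarrow> t"
    using compact_complete_linorder[of "\<lambda>k. ereal (c (s1 k))"] by blast
  define s where "s k = s1 (s2 k)" for k
  have smono: "strict_mono s" using l(2) t(1) by (auto simp: s_def strict_mono_def)
  have As: "(\<lambda>k. A (s k)) \<longlonglongrightarrow> A0" and ms: "(\<lambda>k. m (s k)) \<longlonglongrightarrow> m0"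
    using LIMSEQ_subseq_LIMSEQ[OF A smono] LIMSEQ_subseq_LIMSEQ[OF m smono] by (simp_all add: o_def)
  have us: "(\<lambda>k. u (s k)) \<longlonglongrightarrow> l"
    using LIMSEQ_subseq_LIMSEQ[OF l(3) t(1)] by (simp add: o_def s_def)
  have cs: "(\<lambda>k. ereal (c (s k))) \<longlonglongrightarrow> t" using t(2) by (simp add: o_def s_def)
  have mv: "(\<lambda>k. B k *v z k) \<longlonglongrightarrow> B0 *v z0" if "B \<longlonglongrightarrow> B0" "z \<longlonglongrightarrow> z0"
    for B :: "nat \<Rightarrow> real^'d^'d" and z B0 z0
    unfolding matrix_vector_mult_def using that by (intro tendsto_intros)
  have lim1: "(\<lambda>k. u (s k) \<bullet> (A (s k) *v (y - m (s k)))) \<longlonglongrightarrow> l \<bullet> (A0 *v (y - m0))" for y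
    by (intro tendsto_intros us mv As ms)
  have lim2: "(\<lambda>k. u (s k) \<bullet> (A0 *v (y - m0))) \<longlonglongrightarrow> l \<bullet> (A0 *v (y - m0))" for y
    by (intro tendsto_intros us)
  define h where "h k = (theta_halfspace (u k) (c k) (A k) (m k), theta_halfspace (u k) (c k) A0 m0)" for k
  \<comment> \<open>Both linear expressions converge to the same number, which lies strictly on one
    side of the limit \<open>t\<close> of the thresholds; a level in between eventually decides both
    memberships alike.\<close>
  have conv: "(\<lambda>k. (g y)\<^sup>2 * indicator (hsym (h (s k))) y) \<longlonglongrightarrow> 0" if "ereal (l \<bullet> (A0 *v (y - m0))) \<noteq> t" for y
  proof (rule tendsto_eventually)
    have e1: "(\<lambda>k. ereal (u (s k) \<bullet> (A (s k) *v (y - m (s k))))) \<longlonglongrightarrow> ereal (l \<bullet> (A0 *v (y - m0)))"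
      and e2: "(\<lambda>k. ereal (u (s k) \<bullet> (A0 *v (y - m0)))) \<longlonglongrightarrow> ereal (l \<bullet> (A0 *v (y - m0)))"
      using lim1 lim2 by (auto intro: tendsto_ereal)
    have "\<forall>\<^sub>F k in sequentially. (c (s k) \<le> u (s k) \<bullet> (A (s k) *v (y - m (s k)))) = (c (s k) \<le> u (s k) \<bullet> (A0 *v (y - m0)))"
    proof (cases "ereal (l \<bullet> (A0 *v (y - m0))) < t")
      case True
      then obtain b where b: "ereal (l \<bullet> (A0 *v (y - m0))) < b" "b < t" using dense by blast
      from order_tendstoD(2)[OF e1 b(1)] order_tendstoD(2)[OF e2 b(1)] order_tendstoD(1)[OF cs b(2)]
      show ?thesis
      proof eventually_elim
        case (elim k)
        then have "ereal (u (s k) \<bullet> (A (s k) *v (y - m (s k)))) < ereal (c (s k))"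
          "ereal (u (s k) \<bullet> (A0 *v (y - m0))) < ereal (c (s k))" by (blast intro: less_trans)+
        then show ?case by auto
      qed
    next
      case False
      then have "t < ereal (l \<bullet> (A0 *v (y - m0)))" using that by auto
      then obtain b where b: "b < ereal (l \<bullet> (A0 *v (y - m0)))" "t < b" using dense by blast
      from order_tendstoD(1)[OF e1 b(1)] order_tendstoD(1)[OF e2 b(1)] order_tendstoD(2)[OF cs b(2)]
      show ?thesis
      proof eventually_elim
        case (elim k)
        then have "ereal (u (s k) \<bullet> (A (s k) *v (y - m (s k)))) > ereal (c (s k))"
          "ereal (u (s k) \<bullet> (A0 *v (y - m0))) > ereal (c (s k))" by (blast intro: less_trans)+
        then show ?case by auto
      qed
    qed
    then show "\<forall>\<^sub>F k in sequentially. (g y)\<^sup>2 * indicator (hsym (h (s k))) y = 0"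
      by eventually_elim (auto simp: h_def hsym_def mem_theta_halfspace)
  qed
  have null: "AE y in P. ereal (l \<bullet> (A0 *v (y - m0))) \<noteq> t"
  proof (cases "\<exists>b. t = ereal b")
    case True
    then obtain b where b: "t = ereal b" by blast
    define a where "a = transpose A0 *v l"
    \<comment> \<open>Invertibility of \<open>A0\<close> keeps the limiting normal nonzero, so the
      exceptional set is a genuine hyperplane. For infinite \<open>t\<close> there are no
      exceptional points.\<close>
    have "a \<noteq> 0"
    proof
      assume "a = 0"
      then have "l \<bullet> (A0 *v x) = 0" for x by (metis a_def inner_zero_left transpose_mult_inner)
      moreover obtain B where "A0 ** B = mat 1" using A0 by (auto simp: invertible_def)
      then have "A0 *v (B *v l) = l" by (simp add: matrix_vector_mul_assoc)
      ultimately have "l \<bullet> l = 0" by metis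
      then show False using l(1) by auto
    qed
    then have "negligible {y. a \<bullet> y = b + l \<bullet> (A0 *v m0)}" by (intro negligible_hyperplane) auto
    then have "{y. a \<bullet> y = b + l \<bullet> (A0 *v m0)} \<in> null_sets lebesgue"
      by (simp add: negligible_iff_null_sets)
    moreover have hp: "{y. a \<bullet> y = b + l \<bullet> (A0 *v m0)} \<in> sets borel" by measurable
    ultimately have "{y. a \<bullet> y = b + l \<bullet> (A0 *v m0)} \<in> null_sets lborel"
      by (simp add: null_sets_def emeasure_completion)
    then have "{y. a \<bullet> y = b + l \<bullet> (A0 *v m0)} \<in> null_sets P"
      using ac by (auto simp: absolutely_continuous_def)
    then show ?thesis
    proof (rule AE_I')
      show "{y \<in> space P. \<not> ereal (l \<bullet> (A0 *v (y - m0))) \<noteq> t} \<subseteq> {y. a \<bullet> y = b + l \<bullet> (A0 *v m0)}"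
        by (auto simp: b a_def dot_lmul_matrix matrix_vector_mult_diff_distrib inner_diff_right)
    qed
  qed auto
  have "(\<lambda>k. \<integral>y. (g y)\<^sup>2 * indicator (hsym (h (s k))) y \<partial>P) \<longlonglongrightarrow> (\<integral>y. 0 \<partial>P)"
  proof (rule integral_dominated_convergence[where w = "\<lambda>y. (g y)\<^sup>2"])
    show "AE y in P. (\<lambda>k. (g y)\<^sup>2 * indicator (hsym (h (s k))) y) \<longlonglongrightarrow> 0"
      using null by eventually_elim (rule conv)
  qed (use g in \<open>auto simp: indicator_def\<close>)
  then have "\<forall>\<^sub>F k in sequentially. (\<integral>y. (g y)\<^sup>2 * indicator (hsym (h (s k))) y \<partial>P) < d"
    by (intro order_tendstoD) (use d in auto)
  then obtain k where "(\<integral>y. (g y)\<^sup>2 * indicator (hsym (h (s k))) y \<partial>P) < d"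
    using eventually_happens trivial_limit_sequentially by blast
  then show False
    using p(4)[of "s k"] by (simp add: I_def h_def A_def m_def u_def c_def)
qed

section \<open>The empirical process of an i.i.d. sample\<close>

locale iid_sample = prob_space M + law: euclidean_law P
  for M :: "'w measure" and P :: "(real^'d) measure" +
  fixes X :: "nat \<Rightarrow> 'w \<Rightarrow> real^'d"
  assumes X_measurable [measurable]: "\<And>i. X i \<in> borel_measurable M"
    and X_indep: "indep_vars (\<lambda>_. borel) X UNIV"
    and X_distr: "\<And>i. distr M borel (X i) = P"
begin

text \<open>By independence the first \<open>n\<close> variables have the product law, so
  exceptional events found on \<open>sample n\<close> pull back with the same probability.\<close>

lemma sample_event:
  assumes "n \<ge> 1" and E: "E \<in> sets (law.sample n)"
  obtains B where "B \<in> sets M" "measure M B = measure (law.sample n) E"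
    "\<And>\<omega>. \<omega> \<in> space M - B \<Longrightarrow> (\<lambda>i\<in>{..<n}. X i \<omega>) \<in> space (law.sample n) - E"
proof -
  define Y where "Y \<omega> = (\<lambda>i\<in>{..<n}. X i \<omega>)" for \<omega>
  have ne: "{..<n} \<noteq> {}" using assms(1) by (simp add: lessThan_empty_iff)
  have "indep_vars (\<lambda>_. borel) X {..<n}" using X_indep by (rule indep_vars_subset) simp
  then have d: "distr M (PiM {..<n} (\<lambda>_. borel)) Y = law.sample n"
    using indep_vars_iff_distr_eq_PiM'[OF ne, where M' = "\<lambda>_. borel" and X = X] X_measurable X_distr
    by (simp add: law.sample_def Y_def[abs_def])
  have Y: "Y \<in> measurable M (PiM {..<n} (\<lambda>_. borel))"
    unfolding Y_def[abs_def] by (intro measurable_restrict X_measurable)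
  have E': "E \<in> sets (PiM {..<n} (\<lambda>_. borel))" using E d by (metis sets_distr)
  have sp: "space (law.sample n) = space (PiM {..<n} (\<lambda>_. borel))" using d by (metis space_distr)
  show ?thesis
  proof (rule that[of "Y -` E \<inter> space M"])
    show "Y -` E \<inter> space M \<in> sets M" using Y E' by (rule measurable_sets)
    show "measure M (Y -` E \<inter> space M) = measure (law.sample n) E"
      using measure_distr[OF Y E'] d by simp
    show "(\<lambda>i\<in>{..<n}. X i \<omega>) \<in> space (law.sample n) - E" if "\<omega> \<in> space M - (Y -` E \<inter> space M)" for \<omega>
      using that measurable_space[OF Y, of \<omega>] by (auto simp: sp Y_def)
  qed
qed

lemma centred_sum_restrict: "law.centred_sum n f (\<lambda>i\<in>{..<n}. X i \<omega>) = law.centred_sum n f (\<lambda>i. X i \<omega>)"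
  by (simp add: law.centred_sum_def)

lemma emp_proc_eq_centred_sum:
  assumes "n \<ge> 1"
  shows "emp_proc P X n \<omega> f = law.centred_sum n f (\<lambda>i. X i \<omega>) / sqrt (real n)"
proof -
  have n: "sqrt (real n) * sqrt (real n) = real n" "sqrt (real n) > 0" using assms by auto
  have "emp_proc P X n \<omega> f = sqrt (real n) * law.centred_sum n f (\<lambda>i. X i \<omega>) / real n"
    using assms by (simp add: emp_proc_def law.centred_sum_def field_simps)
  also have "\<dots> = law.centred_sum n f (\<lambda>i. X i \<omega>) / sqrt (real n)"
  proof -
    have "s * c / (s * s) = c / s" if "s > 0" for s c :: real using that by simp
    from this[OF n(2)] show ?thesis by (simp only: n(1))
  qed
  finally show ?thesis .
qed

lemma law_of_large_numbers:
  fixes f :: "real^'d \<Rightarrow> real"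
  assumes f: "integrable P f" and e: "e > 0"
  shows "whp (\<lambda>n \<omega>. \<bar>(1 / real n) * (\<Sum>i<n. f (X i \<omega>)) - (\<integral>x. f x \<partial>P)\<bar> \<le> e)"
  unfolding whp_def
proof (intro allI impI)
  fix \<alpha> :: real assume \<alpha>: "\<alpha> > 0"
  obtain n0 where n0: "\<And>n. n \<ge> n0 \<Longrightarrow> (\<integral>x. \<bar>law.centred_sum n f x\<bar> \<partial>law.sample n) \<le> (e * \<alpha>) * real n"
    using law.centred_sum_mean_small[OF f, of "e * \<alpha>"] e \<alpha> by auto
  show "\<exists>n0. \<forall>n\<ge>n0. \<exists>B\<in>sets M. measure M B \<le> \<alpha> \<and>
      (\<forall>\<omega>\<in>space M - B. \<bar>(1 / real n) * (\<Sum>i<n. f (X i \<omega>)) - (\<integral>x. f x \<partial>P)\<bar> \<le> e)"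
  proof (intro exI[of _ "max n0 1"] allI impI)
    fix n assume n: "n \<ge> max n0 1"
    then have n1: "n \<ge> 1" "real n > 0" by auto
    interpret S: prob_space "law.sample n" by (rule law.prob_space_sample)
    define E where "E = {x \<in> space (law.sample n). \<exists>c\<in>{()}. \<bar>law.centred_sum n f x\<bar> > e * real n}"
    have A: "(\<integral>x. (MAX c\<in>A. \<bar>law.centred_sum n f x\<bar>) \<partial>law.sample n) \<le> e * \<alpha> * real n"
      if "A \<noteq> {}" for A :: "unit set"
      using n0[of n] n that by (simp add: image_constant_conv)
    have E: "E \<in> sets (law.sample n)" "measure (law.sample n) E \<le> (e * \<alpha> * real n) / (e * real n)"
      unfolding E_def
      by (rule S.prob_Ex_countable_gt_le[where Y = "\<lambda>_ x. \<bar>law.centred_sum n f x\<bar>", OF _ _ _ A];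
          use n1 e \<alpha> f law.centred_sum_integrable in auto)+
    have mE: "measure (law.sample n) E \<le> \<alpha>" using E(2) e n1(2) by simp
    obtain B where "B \<in> sets M" "measure M B = measure (law.sample n) E"
        "\<And>\<omega>. \<omega> \<in> space M - B \<Longrightarrow> (\<lambda>i\<in>{..<n}. X i \<omega>) \<in> space (law.sample n) - E"
      by (rule sample_event[OF n1(1) E(1)]) (rule that)
    note B = this(1) this(2)[THEN ord_eq_le_trans, OF mE] this(3)
    have "\<bar>(1 / real n) * (\<Sum>i<n. f (X i \<omega>)) - (\<integral>x. f x \<partial>P)\<bar> \<le> e" if "\<omega> \<in> space M - B" for \<omega>
    proof -
      have "\<bar>law.centred_sum n f (\<lambda>i. X i \<omega>)\<bar> \<le> e * real n"
        using B(3)[OF that] by (auto simp: E_def centred_sum_restrict not_less)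
      moreover have "(1 / real n) * (\<Sum>i<n. f (X i \<omega>)) - (\<integral>x. f x \<partial>P) = law.centred_sum n f (\<lambda>i. X i \<omega>) / real n"
        using n1 by (simp add: law.centred_sum_def field_simps)
      ultimately show ?thesis using n1 by (simp add: abs_divide field_simps)
    qed
    then show "\<exists>B\<in>sets M. measure M B \<le> \<alpha> \<and>
        (\<forall>\<omega>\<in>space M - B. \<bar>(1 / real n) * (\<Sum>i<n. f (X i \<omega>)) - (\<integral>x. f x \<partial>P)\<bar> \<le> e)"
      using B by blast
  qed
qed

lemma process_bounded_in_probability:
  fixes g :: "real^'d \<Rightarrow> real"
  assumes [measurable]: "g \<in> borel_measurable borel" and g: "integrable P (\<lambda>x. (g x)\<^sup>2)"
  shows "tight_family (\<lambda>C n \<omega>. \<forall>h. \<bar>emp_proc P X n \<omega> (hdiff g h)\<bar> \<le> C)"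
  unfolding tight_family_def
proof (intro allI impI)
  fix \<alpha> :: real assume \<alpha>: "\<alpha> > 0"
  define K where "K = 80 * half_const TYPE(real^'d) * sqrt (\<integral>y. (g y)\<^sup>2 \<partial>P)"
  have K: "K \<ge> 0" using chain_const_ge[of "DIM(real^'d) + 1"] by (simp add: K_def)
  \<comment> \<open>Markov's inequality leaves probability \<open>K / C\<close>, below
    \<open>\<alpha>\<close>; the \<open>+ 1\<close> keeps \<open>C\<close> positive. The radius
    bound used next, the second moment plus 1, is met by every pair.\<close>
  define C where "C = (K + 1) / \<alpha>"
  have C: "C > 0" using K \<alpha> by (simp add: C_def)
  have "\<exists>B\<in>sets M. measure M B \<le> \<alpha> \<and> (\<forall>\<omega>\<in>space M - B. \<forall>h. \<bar>emp_proc P X n \<omega> (hdiff g h)\<bar> \<le> C)"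
    if n: "n \<ge> 1" for n
  proof -
    have sn: "sqrt (real n) > 0" using n by simp
    have le: "(\<integral>y. (g y)\<^sup>2 * indicator (hsym h) y \<partial>P) < (\<integral>y. (g y)\<^sup>2 \<partial>P) + 1" for h
    proof -
      have "(\<integral>y. (g y)\<^sup>2 * indicator (hsym h) y \<partial>P) \<le> (\<integral>y. (g y)\<^sup>2 \<partial>P)"
        using g by (intro integral_mono law.hsym_square_integrable) (auto simp: indicator_def)
      then show ?thesis by linarith
    qed
    obtain E where E: "E \<in> sets (law.sample n)"
        "measure (law.sample n) E \<le> (K * sqrt (real n)) / (C * sqrt (real n))"
        "\<And>x h. x \<in> space (law.sample n) - E \<Longrightarrow>
          (\<integral>y. (g y)\<^sup>2 * indicator (hsym h) y \<partial>P) < (\<integral>y. (g y)\<^sup>2 \<partial>P) + 1 \<Longrightarrow>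
          \<bar>law.centred_sum n (hdiff g h) x\<bar> \<le> C * sqrt (real n)"
    proof (rule law.uniform_event[OF assms(1) g, of "(\<integral>y. (g y)\<^sup>2 \<partial>P) + 1" n "K * sqrt (real n)" "C * sqrt (real n)"])
      show "(\<integral>x. (MAX h\<in>PP. \<bar>law.centred_sum n (hdiff g h) x\<bar>) \<partial>law.sample n) \<le> K * sqrt (real n)"
        if "finite PP" "PP \<noteq> {}" for PP
        unfolding K_def by (rule law.uniform_maximal_inequality[OF assms(1) g that])
    qed (use C K sn in auto)
    have "measure (law.sample n) E \<le> \<alpha>"
    proof -
      have "(K * sqrt (real n)) / (C * sqrt (real n)) = K / C" using sn by simp
      also have "\<dots> = \<alpha> * (K / (K + 1))" using K \<alpha> by (simp add: C_def field_simps)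
      also have "\<dots> \<le> \<alpha> * 1" using K \<alpha> by (intro mult_left_mono) auto
      finally show ?thesis using E(2) by linarith
    qed
    note mE = this
    obtain B where "B \<in> sets M" "measure M B = measure (law.sample n) E"
        "\<And>\<omega>. \<omega> \<in> space M - B \<Longrightarrow> (\<lambda>i\<in>{..<n}. X i \<omega>) \<in> space (law.sample n) - E"
      by (rule sample_event[OF n E(1)]) (rule that)
    note B = this(1) this(2)[THEN ord_eq_le_trans, OF mE] this(3)
    have "\<bar>emp_proc P X n \<omega> (hdiff g h)\<bar> \<le> C" if "\<omega> \<in> space M - B" for \<omega> h
      using E(3)[OF B(3)[OF that] le] sn
      by (simp add: emp_proc_eq_centred_sum[OF n] centred_sum_restrict abs_divide field_simps)
    then show ?thesis using B by blast
  qed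
  then show "\<exists>C>0. \<exists>n0. \<forall>n\<ge>n0. \<exists>B\<in>sets M. measure M B \<le> \<alpha> \<and>
      (\<forall>\<omega>\<in>space M - B. \<forall>h. \<bar>emp_proc P X n \<omega> (hdiff g h)\<bar> \<le> C)"
    using C by blast
qed

text \<open>Equicontinuity in mean at tolerance \<open>e * \<alpha>\<close>, then Markov's
  inequality at level \<open>e\<close>. The radius thus depends on \<open>\<alpha>\<close> but not
  on \<open>n\<close>, which is the form of \<open>tight_family\<close>.\<close>

lemma process_equicontinuous_in_probability:
  fixes g :: "real^'d \<Rightarrow> real"
  assumes [measurable]: "g \<in> borel_measurable borel" and g: "integrable P (\<lambda>x. (g x)\<^sup>2)" and e: "e > 0"
  shows "tight_family (\<lambda>d n \<omega>. \<forall>h. (\<integral>y. (g y)\<^sup>2 * indicator (hsym h) y \<partial>P) < d \<longrightarrow>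
    \<bar>emp_proc P X n \<omega> (hdiff g h)\<bar> \<le> e)"
  unfolding tight_family_def
proof (intro allI impI)
  fix \<alpha> :: real assume \<alpha>: "\<alpha> > 0"
  have e\<alpha>: "e * \<alpha> > 0" using e \<alpha> by simp
  obtain d n0 where d: "d > 0" and n0: "\<And>n PP. n \<ge> n0 \<Longrightarrow> finite PP \<Longrightarrow> PP \<noteq> {} \<Longrightarrow>
      (\<And>h. h \<in> PP \<Longrightarrow> (\<integral>y. (g y)\<^sup>2 * indicator (hsym h) y \<partial>P) < d) \<Longrightarrow>
      (\<integral>x. (MAX h\<in>PP. \<bar>law.centred_sum n (hdiff g h) x\<bar>) \<partial>law.sample n) \<le> (e * \<alpha>) * sqrt (real n)"
  proof (rule law.equicontinuity_in_mean[OF assms(1) g e\<alpha>])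
    fix d n0
    assume *: "d > 0" "\<And>n PP. n \<ge> n0 \<Longrightarrow> finite PP \<Longrightarrow> PP \<noteq> {} \<Longrightarrow>
      (\<And>h. h \<in> PP \<Longrightarrow> (\<integral>y. (g y)\<^sup>2 * indicator (hsym h) y \<partial>P) < d) \<Longrightarrow>
      (\<integral>x. (MAX h\<in>PP. \<bar>law.centred_sum n (hdiff g h) x\<bar>) \<partial>law.sample n) \<le> (e * \<alpha>) * sqrt (real n)"
    show thesis by (rule that[OF *])
  qed
  have "\<exists>B\<in>sets M. measure M B \<le> \<alpha> \<and> (\<forall>\<omega>\<in>space M - B. \<forall>h.
      (\<integral>y. (g y)\<^sup>2 * indicator (hsym h) y \<partial>P) < d \<longrightarrow> \<bar>emp_proc P X n \<omega> (hdiff g h)\<bar> \<le> e)"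
    if "n \<ge> max n0 1" for n
  proof -
    have n: "n \<ge> 1" "n \<ge> n0" using that by auto
    have sn: "sqrt (real n) > 0" using n by simp
    obtain E where E: "E \<in> sets (law.sample n)"
        "measure (law.sample n) E \<le> ((e * \<alpha>) * sqrt (real n)) / (e * sqrt (real n))"
        "\<And>x h. x \<in> space (law.sample n) - E \<Longrightarrow>
          (\<integral>y. (g y)\<^sup>2 * indicator (hsym h) y \<partial>P) < d \<Longrightarrow>
          \<bar>law.centred_sum n (hdiff g h) x\<bar> \<le> e * sqrt (real n)"
      by (rule law.uniform_event[OF assms(1) g, of d n "(e * \<alpha>) * sqrt (real n)" "e * sqrt (real n)"])
        (use n0[OF n(2)] e \<alpha> sn in auto)
    have "measure (law.sample n) E \<le> \<alpha>" using E(2) e sn by simp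
    note mE = this
    obtain B where "B \<in> sets M" "measure M B = measure (law.sample n) E"
        "\<And>\<omega>. \<omega> \<in> space M - B \<Longrightarrow> (\<lambda>i\<in>{..<n}. X i \<omega>) \<in> space (law.sample n) - E"
      by (rule sample_event[OF n(1) E(1)]) (rule that)
    note B = this(1) this(2)[THEN ord_eq_le_trans, OF mE] this(3)
    have "\<bar>emp_proc P X n \<omega> (hdiff g h)\<bar> \<le> e"
      if "\<omega> \<in> space M - B" "(\<integral>y. (g y)\<^sup>2 * indicator (hsym h) y \<partial>P) < d" for \<omega> h
      using E(3)[OF B(3)[OF that(1)] that(2)] sn
      by (simp add: emp_proc_eq_centred_sum[OF n(1)] centred_sum_restrict abs_divide field_simps)
    then show ?thesis using B by blast
  qed
  then show "\<exists>d>0. \<exists>n0. \<forall>n\<ge>n0. \<exists>B\<in>sets M. measure M B \<le> \<alpha> \<and> (\<forall>\<omega>\<in>space M - B. \<forall>h.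
      (\<integral>y. (g y)\<^sup>2 * indicator (hsym h) y \<partial>P) < d \<longrightarrow> \<bar>emp_proc P X n \<omega> (hdiff g h)\<bar> \<le> e)"
    using d by blast
qed

end

section \<open>Consistency of the empirical mean and covariance\<close>

lemma outer_prod_self_mult: "outer_prod y y *v x = (y \<bullet> x) *\<^sub>R y"
  by (simp add: outer_prod_def matrix_vector_mult_def inner_vec_def vec_eq_iff sum_distrib_left mult_ac)

lemma psd_mat_emp_cov: "psd_mat (emp_cov X n \<omega>)"
  unfolding psd_mat_def
proof (intro conjI allI)
  show "transpose (emp_cov X n \<omega>) = emp_cov X n \<omega>"
    by (simp add: emp_cov_def transpose_def outer_prod_def vec_eq_iff mult.commute)
  fix x
  define Y where "Y i = X i \<omega> - emp_mean X n \<omega>" for i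
  have sum: "(\<Sum>i\<in>S. outer_prod (Y i) (Y i)) *v x = (\<Sum>i\<in>S. (Y i \<bullet> x) *\<^sub>R Y i)" if "finite S" for S
    using that by (induction S rule: finite_induct) (simp_all add: matrix_vector_mult_add_rdistrib outer_prod_self_mult)
  have "emp_cov X n \<omega> *v x = (1 / real n) *\<^sub>R (\<Sum>i<n. (Y i \<bullet> x) *\<^sub>R Y i)"
    unfolding emp_cov_def Y_def[symmetric] by (simp only: scaleR_matrix_vector_assoc[symmetric] sum finite_lessThan)
  then have "x \<bullet> (emp_cov X n \<omega> *v x) = (1 / real n) * (\<Sum>i<n. (Y i \<bullet> x) * (Y i \<bullet> x))"
    by (simp add: inner_sum_right inner_commute)
  then show "0 \<le> x \<bullet> (emp_cov X n \<omega> *v x)" by (simp add: sum_nonneg)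
qed

context euclidean_law
begin

lemma bound_by_norm_square_integrable:
  fixes f :: "'a \<Rightarrow> real"
  assumes "integrable P (\<lambda>x. (norm x)\<^sup>2)" and [measurable]: "f \<in> borel_measurable borel"
    and "\<And>x. \<bar>f x\<bar> \<le> c * (1 + (norm x)\<^sup>2)"
  shows "integrable P f"
proof (rule Bochner_Integration.integrable_bound)
  show "integrable P (\<lambda>x. c * (1 + (norm x)\<^sup>2))" using assms(1) by simp
  show "AE x in P. norm (f x) \<le> norm (c * (1 + (norm x)\<^sup>2))"
    using assms(3) by (intro AE_I2) (metis abs_ge_self order_trans real_norm_def)
qed simp

end

lemma vec_product_integrable:
  fixes P :: "(real^'d) measure"
  assumes "euclidean_law P" and sq: "integrable P (\<lambda>x. (norm x)\<^sup>2)"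
  shows "integrable P (\<lambda>x. x $ i)" "integrable P (\<lambda>x. x $ i * x $ j)" "integrable P (\<lambda>x. (x $ i)\<^sup>2)"
    "mean_vec P $ i = (\<integral>x. x $ i \<partial>P)"
proof -
  interpret euclidean_law P by fact
  have one: "a \<le> 1 + a\<^sup>2" for a :: real
  proof -
    have "2 * a \<le> 1 + a\<^sup>2" using zero_le_power2[of "a - 1"] by (simp add: power2_diff)
    then show ?thesis using zero_le_power2[of a] by linarith
  qed
  show "integrable P (\<lambda>x. x $ i)"
    by (rule bound_by_norm_square_integrable[OF sq, where c = 1]) (auto intro: order_trans[OF component_le_norm_cart one])
  show ij: "integrable P (\<lambda>x. x $ i * x $ j)" for j
  proof (rule bound_by_norm_square_integrable[OF sq, where c = 1])
    fix x :: "real^'d"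
    have "\<bar>x $ i * x $ j\<bar> \<le> norm x * norm x"
      unfolding abs_mult by (intro mult_mono component_le_norm_cart) auto
    then show "\<bar>x $ i * x $ j\<bar> \<le> 1 * (1 + (norm x)\<^sup>2)" by (simp add: power2_eq_square)
  qed simp
  show "integrable P (\<lambda>x. (x $ i)\<^sup>2)" using ij[of i] by (simp add: power2_eq_square)
  have "integrable P (\<lambda>x. x)"
  proof (rule Bochner_Integration.integrable_bound)
    show "integrable P (\<lambda>x. 1 + (norm x)\<^sup>2)" using sq by simp
  qed (auto intro!: AE_I2 simp: abs_of_nonneg one)
  then show "mean_vec P $ i = (\<integral>x. x $ i \<partial>P)"
    unfolding mean_vec_def by (simp add: integral_bounded_linear[OF bounded_linear_vec_nth, symmetric])
qed

lemma cov_mat_entry: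
  fixes P :: "(real^'d) measure"
  assumes "euclidean_law P" and sq: "integrable P (\<lambda>x. (norm x)\<^sup>2)"
  shows "cov_mat P $ i $ j = (\<integral>x. x $ i * x $ j \<partial>P) - (\<integral>x. x $ i \<partial>P) * (\<integral>x. x $ j \<partial>P)"
    "integrable P (\<lambda>x. (x $ i - mean_vec P $ i) * (x $ j - mean_vec P $ j))"
proof -
  interpret euclidean_law P by fact
  note int = vec_product_integrable[OF assms]
  have eq: "(x $ i - mean_vec P $ i) * (x $ j - mean_vec P $ j)
      = x $ i * x $ j - mean_vec P $ j * x $ i - mean_vec P $ i * x $ j + mean_vec P $ i * mean_vec P $ j" for x
    by (simp add: algebra_simps)
  show "integrable P (\<lambda>x. (x $ i - mean_vec P $ i) * (x $ j - mean_vec P $ j))"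
    unfolding eq using int by simp
  have "cov_mat P $ i $ j = (\<integral>x. x $ i * x $ j - mean_vec P $ j * x $ i - mean_vec P $ i * x $ j + mean_vec P $ i * mean_vec P $ j \<partial>P)"
    by (simp add: cov_mat_def eq)
  also have "\<dots> = (\<integral>x. x $ i * x $ j \<partial>P) - mean_vec P $ j * (\<integral>x. x $ i \<partial>P) - mean_vec P $ i * (\<integral>x. x $ j \<partial>P)
      + mean_vec P $ i * mean_vec P $ j"
    using int by (simp add: prob_space)
  finally show "cov_mat P $ i $ j = (\<integral>x. x $ i * x $ j \<partial>P) - (\<integral>x. x $ i \<partial>P) * (\<integral>x. x $ j \<partial>P)"
    by (simp add: int(4))
qed

lemma psd_mat_cov_mat:
  fixes P :: "(real^'d) measure"
  assumes "euclidean_law P" and sq: "integrable P (\<lambda>x. (norm x)\<^sup>2)"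
  shows "psd_mat (cov_mat P)"
  unfolding psd_mat_def
proof (intro conjI allI)
  show "transpose (cov_mat P) = cov_mat P"
    by (simp add: cov_mat_def transpose_def vec_eq_iff mult.commute)
  fix v :: "real^'d"
  define Y where "Y x i = x $ i - mean_vec P $ i" for x i
  have int: "integrable P (\<lambda>x. Y x i * Y x j)" for i j
    unfolding Y_def by (rule cov_mat_entry(2)[OF assms])
  have "v \<bullet> (cov_mat P *v v) = (\<Sum>i\<in>UNIV. \<Sum>j\<in>UNIV. \<integral>x. v $ i * v $ j * (Y x i * Y x j) \<partial>P)"
    by (simp add: inner_vec_def matrix_vector_mult_def cov_mat_def Y_def sum_distrib_left mult_ac)
  also have "\<dots> = (\<integral>x. (\<Sum>i\<in>UNIV. \<Sum>j\<in>UNIV. v $ i * v $ j * (Y x i * Y x j)) \<partial>P)"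
    using int by (subst Bochner_Integration.integral_sum; simp add: Bochner_Integration.integral_sum)
  also have "\<dots> = (\<integral>x. (\<Sum>i\<in>UNIV. v $ i * Y x i) * (\<Sum>j\<in>UNIV. v $ j * Y x j) \<partial>P)"
    by (simp add: sum_product mult_ac)
  also have "\<dots> \<ge> 0" by (intro Bochner_Integration.integral_nonneg) simp
  finally show "0 \<le> v \<bullet> (cov_mat P *v v)" .
qed

text \<open>Second moment minus product of first moments, mirroring the entries of
  \<open>cov_mat\<close>; consistency thereby reduces to the law of large numbers for coordinates
  and their products.\<close>

lemma emp_cov_entry:
  assumes "n \<ge> 1"
  shows "emp_cov X n \<omega> $ i $ j = (1 / real n) * (\<Sum>k<n. X k \<omega> $ i * X k \<omega> $ j)
    - ((1 / real n) * (\<Sum>k<n. X k \<omega> $ i)) * ((1 / real n) * (\<Sum>k<n. X k \<omega> $ j))"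
proof -
  define a where "a = (\<Sum>k<n. X k \<omega> $ i)"
  define b where "b = (\<Sum>k<n. X k \<omega> $ j)"
  have m: "emp_mean X n \<omega> $ i = a / real n" "emp_mean X n \<omega> $ j = b / real n"
    by (simp_all add: emp_mean_def a_def b_def)
  have "emp_cov X n \<omega> $ i $ j = (1 / real n) * (\<Sum>k<n. (X k \<omega> $ i - a / real n) * (X k \<omega> $ j - b / real n))"
    by (simp add: emp_cov_def outer_prod_def m)
  also have "(\<Sum>k<n. (X k \<omega> $ i - a / real n) * (X k \<omega> $ j - b / real n))
      = (\<Sum>k<n. X k \<omega> $ i * X k \<omega> $ j) - (a / real n) * b - a * (b / real n) + real n * (a / real n * (b / real n))"
  proof -
    have "(X k \<omega> $ i - a / real n) * (X k \<omega> $ j - b / real n) = X k \<omega> $ i * X k \<omega> $ j - (a / real n) * X k \<omega> $ j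
        - X k \<omega> $ i * (b / real n) + a / real n * (b / real n)" for k
      by (simp add: algebra_simps)
    then show ?thesis
      by (simp only: sum.distrib sum_subtractf sum_distrib_left[symmetric] sum_distrib_right[symmetric]
          a_def[symmetric] b_def[symmetric] sum_constant card_lessThan) (simp add: mult_ac)
  qed
  also have "real n * (a / real n * (b / real n)) = a * (b / real n)" using assms by simp
  finally show ?thesis by (simp add: a_def[symmetric] b_def[symmetric] right_diff_distrib)
qed

context iid_sample
begin

lemma emp_mean_consistent:
  assumes sq: "integrable P (\<lambda>x. (norm x)\<^sup>2)" and e: "e > 0"
  shows "whp (\<lambda>n \<omega>. norm (emp_mean X n \<omega> - mean_vec P) < e)"
proof -
  note int = vec_product_integrable[OF law.euclidean_law_axioms sq]
  define e' where "e' = e / (2 * real CARD('d))"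
  have e': "e' > 0" using e by (simp add: e'_def)
  have "whp (\<lambda>n \<omega>. \<forall>i\<in>UNIV. \<bar>(1 / real n) * (\<Sum>k<n. X k \<omega> $ i) - (\<integral>x. x $ i \<partial>P)\<bar> \<le> e')"
    by (intro whp_ball_finite law_of_large_numbers int e') simp
  then show ?thesis
  proof (rule whp_mono)
    fix n \<omega> assume A: "\<forall>i\<in>UNIV. \<bar>(1 / real n) * (\<Sum>k<n. X k \<omega> $ i) - (\<integral>x. x $ i \<partial>P)\<bar> \<le> e'"
    have "norm (emp_mean X n \<omega> - mean_vec P) \<le> (\<Sum>i\<in>UNIV. \<bar>(emp_mean X n \<omega> - mean_vec P) $ i\<bar>)"
      by (rule norm_le_l1_cart)
    also have "\<dots> \<le> (\<Sum>i\<in>(UNIV::'d set). e')"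
      using A by (intro sum_mono) (simp add: emp_mean_def int(4))
    also have "\<dots> = e / 2" by (simp add: e'_def)
    also have "\<dots> < e" using e by simp
    finally show "norm (emp_mean X n \<omega> - mean_vec P) < e" .
  qed
qed

lemma emp_cov_consistent:
  assumes sq: "integrable P (\<lambda>x. (norm x)\<^sup>2)" and e: "e > 0"
  shows "whp (\<lambda>n \<omega>. norm (emp_cov X n \<omega> - cov_mat P) < e)"
proof -
  note int = vec_product_integrable[OF law.euclidean_law_axioms sq]
  define N where "N = real CARD('d)"
  define b where "b = (\<Sum>i\<in>UNIV. \<bar>\<integral>x. x $ i \<partial>P\<bar>)"
  have N: "N > 0" by (simp add: N_def)
  have b: "\<bar>\<integral>x. x $ i \<partial>P\<bar> \<le> b" for i
    unfolding b_def using member_le_sum[of i UNIV "\<lambda>i. \<bar>\<integral>x. x $ i \<partial>P\<bar>"] by simp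
  have b0: "b \<ge> 0" unfolding b_def by (intro sum_nonneg) simp
  define e1 where "e1 = e / (2 * (N * N))"
  have e1: "e1 > 0" using e N by (simp add: e1_def)
  \<comment> \<open>The error in an entry is at most \<open>|r| + |p| |q| + b |p| + b |q|\<close>;
    with all deviations at most \<open>e'\<close> and \<open>e' \<le> 1\<close> this is at most
    \<open>e' * (2 + 2 * b)\<close>.\<close>
  define e' where "e' = min 1 (e1 / (2 + 2 * b))"
  have e': "e' > 0" "e' \<le> 1" "e' * (2 + 2 * b) \<le> e1"
  proof -
    have "e' * (2 + 2 * b) \<le> e1 / (2 + 2 * b) * (2 + 2 * b)"
      using b0 by (intro mult_right_mono) (auto simp: e'_def)
    then show "e' * (2 + 2 * b) \<le> e1" using b0 by simp
  qed (use e1 b0 in \<open>auto simp: e'_def\<close>)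
  have "whp (\<lambda>n \<omega>. (\<forall>i\<in>UNIV. \<bar>(1 / real n) * (\<Sum>k<n. X k \<omega> $ i) - (\<integral>x. x $ i \<partial>P)\<bar> \<le> e') \<and>
      (\<forall>i\<in>UNIV. \<forall>j\<in>UNIV. \<bar>(1 / real n) * (\<Sum>k<n. X k \<omega> $ i * X k \<omega> $ j) - (\<integral>x. x $ i * x $ j \<partial>P)\<bar> \<le> e'))"
    by (intro whp_conj whp_ball_finite finite_class.finite_UNIV law_of_large_numbers int e')
  then show ?thesis
  proof (rule whp_mono[where N = 1])
    fix n :: nat and \<omega> assume n: "n \<ge> 1" and
      A: "(\<forall>i\<in>UNIV. \<bar>(1 / real n) * (\<Sum>k<n. X k \<omega> $ i) - (\<integral>x. x $ i \<partial>P)\<bar> \<le> e') \<and>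
        (\<forall>i\<in>UNIV. \<forall>j\<in>UNIV. \<bar>(1 / real n) * (\<Sum>k<n. X k \<omega> $ i * X k \<omega> $ j) - (\<integral>x. x $ i * x $ j \<partial>P)\<bar> \<le> e')"
    have "\<bar>(emp_cov X n \<omega> - cov_mat P) $ i $ j\<bar> \<le> e1" for i j
    proof -
      define p where "p = (1 / real n) * (\<Sum>k<n. X k \<omega> $ i) - (\<integral>x. x $ i \<partial>P)"
      define q where "q = (1 / real n) * (\<Sum>k<n. X k \<omega> $ j) - (\<integral>x. x $ j \<partial>P)"
      define r where "r = (1 / real n) * (\<Sum>k<n. X k \<omega> $ i * X k \<omega> $ j) - (\<integral>x. x $ i * x $ j \<partial>P)"
      have pqr: "\<bar>p\<bar> \<le> e'" "\<bar>q\<bar> \<le> e'" "\<bar>r\<bar> \<le> e'" using A by (auto simp: p_def q_def r_def)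
      have "(emp_cov X n \<omega> - cov_mat P) $ i $ j
          = r - (p * q + p * (\<integral>x. x $ j \<partial>P) + (\<integral>x. x $ i \<partial>P) * q)"
      proof -
        have "(c - x * y) - (c0 - x0 * y0) = (c - c0) - ((x - x0) * (y - y0) + (x - x0) * y0 + x0 * (y - y0))"
          for c c0 x x0 y y0 :: real by (simp add: algebra_simps)
        then show ?thesis
          unfolding vector_minus_component emp_cov_entry[OF n] p_def q_def r_def
            cov_mat_entry(1)[OF law.euclidean_law_axioms sq] .
      qed
      also have "\<bar>\<dots>\<bar> \<le> \<bar>r\<bar> + (\<bar>p\<bar> * \<bar>q\<bar> + \<bar>p\<bar> * \<bar>\<integral>x. x $ j \<partial>P\<bar> + \<bar>\<integral>x. x $ i \<partial>P\<bar> * \<bar>q\<bar>)"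
        unfolding abs_mult[symmetric] by linarith
      also have "\<dots> \<le> e' + (e' * 1 + e' * b + b * e')"
      proof -
        have "\<bar>q\<bar> \<le> 1" using pqr(2) e'(2) by linarith
        then have "\<bar>p\<bar> * \<bar>q\<bar> \<le> e' * 1" using pqr(1) e'(1) by (intro mult_mono) simp_all
        moreover have "\<bar>p\<bar> * \<bar>\<integral>x. x $ j \<partial>P\<bar> \<le> e' * b" using pqr(1) e'(1) b[of j] by (intro mult_mono) simp_all
        moreover have "\<bar>\<integral>x. x $ i \<partial>P\<bar> * \<bar>q\<bar> \<le> b * e'" using pqr(2) b0 b[of i] by (intro mult_mono) simp_all
        ultimately show ?thesis using pqr(3) by linarith
      qed
      also have "\<dots> = e' * (2 + 2 * b)" by (simp add: algebra_simps)
      finally show ?thesis using e'(3) by linarith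
    qed
    then have "norm (emp_cov X n \<omega> - cov_mat P) \<le> (\<Sum>i\<in>(UNIV::'d set). \<Sum>j\<in>(UNIV::'d set). e1)"
      by (intro order_trans[OF norm_matrix_le_sum_entries] sum_mono)
    also have "\<dots> = e / 2" using N by (simp add: e1_def N_def)
    also have "\<dots> < e" using e by simp
    finally show "norm (emp_cov X n \<omega> - cov_mat P) < e" .
  qed
qed

end

section \<open>Decomposition of the process\<close>

text \<open>A basis of the affine functions: \<open>None\<close> indexes the constant and
  \<open>Some j\<close> a coordinate. It reduces all affine weights to \<open>CARD('d) + 1\<close>
  fixed ones, the parameters entering only through the coefficients
  \<open>theta_coef\<close>.\<close>

definition coord_fun :: "'d option \<Rightarrow> real^'d \<Rightarrow> real" where
  "coord_fun k x = (case k of None \<Rightarrow> 1 | Some j \<Rightarrow> x $ j)"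

definition theta_coef :: "real^'d^'d \<Rightarrow> real^'d \<Rightarrow> real^'d \<Rightarrow> 'd option \<Rightarrow> real" where
  "theta_coef A m w k = (case k of None \<Rightarrow> - (w \<bullet> (A *v m)) | Some j \<Rightarrow> (transpose A *v w) $ j)"

lemma sum_option_UNIV:
  fixes f :: "'k::finite option \<Rightarrow> real"
  shows "(\<Sum>k\<in>UNIV. f k) = f None + (\<Sum>j\<in>UNIV. f (Some j))"
  by (simp add: UNIV_option_conv sum.reindex)

lemma theta_coef_linear: "(\<Sum>k\<in>UNIV. theta_coef A m w k * coord_fun k x) = w \<bullet> (A *v (x - m))"
proof -
  have "(\<Sum>j\<in>UNIV. (transpose A *v w) $ j * x $ j) = w \<bullet> (A *v x)"
    using transpose_mult_inner[of A w x] by (simp add: inner_vec_def)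
  then show ?thesis
    by (simp add: sum_option_UNIV theta_coef_def coord_fun_def matrix_vector_mult_diff_distrib inner_diff_right)
qed

definition empty_halfspace :: "(real^'d) \<times> real" where
  "empty_halfspace = (0, 1)"

text \<open>With affine factors \<open>a\<close>, \<open>a0\<close> and indicators \<open>i\<close>,
  \<open>i0\<close> this is \<open>a i - a0 i0 = (a - a0) i + a0 (i - i0)\<close>, expanded in the
  basis \<open>coord_fun\<close>. In the second part the coefficients involve only the limiting
  parameters.\<close>

lemma f_theta_eta_diff:
  fixes A A0 :: "real^'d^'d" and u v :: "real^'d"
  defines "w \<equiv> v - (v \<bullet> u) *\<^sub>R u"
  shows "f_theta_eta (u, v, c) (A, m) x - f_theta_eta (u, v, c) (A0, m0) x
    = (\<Sum>k\<in>UNIV. (theta_coef A m w k - theta_coef A0 m0 w k)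
          * hdiff (coord_fun k) (theta_halfspace u c A m, empty_halfspace) x
        + theta_coef A0 m0 w k
          * hdiff (coord_fun k) (theta_halfspace u c A m, theta_halfspace u c A0 m0) x)"
proof -
  define i where "i = (indicator (halfspace (theta_halfspace u c A m)) x :: real)"
  define i0 where "i0 = (indicator (halfspace (theta_halfspace u c A0 m0)) x :: real)"
  have f: "f_theta_eta (u, v, c) (A, m) x = w \<bullet> (A *v (x - m)) * i"
    "f_theta_eta (u, v, c) (A0, m0) x = w \<bullet> (A0 *v (x - m0)) * i0"
    by (simp_all add: f_theta_eta_def w_def i_def i0_def indicator_def mem_theta_halfspace)
  have h: "hdiff (coord_fun k) (theta_halfspace u c A m, empty_halfspace) x = coord_fun k x * i"
    "hdiff (coord_fun k) (theta_halfspace u c A m, theta_halfspace u c A0 m0) x = coord_fun k x * (i - i0)" for k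
    by (simp_all add: hdiff_def i_def i0_def empty_halfspace_def halfspace_def)
  have "(\<Sum>k\<in>UNIV. (theta_coef A m w k - theta_coef A0 m0 w k) * (coord_fun k x * i)
        + theta_coef A0 m0 w k * (coord_fun k x * (i - i0)))
      = (\<Sum>k\<in>UNIV. theta_coef A m w k * coord_fun k x) * i - (\<Sum>k\<in>UNIV. theta_coef A0 m0 w k * coord_fun k x) * i0"
    unfolding sum_distrib_right sum_subtractf[symmetric] by (intro sum.cong) (auto simp: algebra_simps)
  then show ?thesis by (simp add: f h theta_coef_linear)
qed

lemma norm_project_le_1:
  assumes "norm u = 1" "norm v = 1"
  shows "norm (v - (v \<bullet> u) *\<^sub>R u) \<le> 1"
proof -
  have "u \<bullet> u = 1" "v \<bullet> v = 1" using assms by (simp_all add: dot_square_norm)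
  then have "(norm (v - (v \<bullet> u) *\<^sub>R u))\<^sup>2 = 1 - (v \<bullet> u)\<^sup>2"
    unfolding power2_norm_eq_inner inner_diff_left inner_diff_right inner_scaleR_left inner_scaleR_right
      inner_commute[of u v] by (simp add: power2_eq_square)
  also have "\<dots> \<le> 1\<^sup>2" by simp
  finally show ?thesis by (rule power2_le_imp_le) simp
qed

text \<open>Each coefficient pairs \<open>w\<close>, up to sign, with \<open>A *v m\<close> or with
  a column of \<open>A\<close>, so Cauchy-Schwarz gives bounds free of \<open>w\<close> and hence
  uniform in \<theta>.\<close>

lemma theta_coef_bound:
  assumes "norm w \<le> 1"
  shows "\<bar>theta_coef A m w k - theta_coef A0 m0 w k\<bar> \<le> norm (A - A0) + norm (A *v m - A0 *v m0)"
    "\<bar>theta_coef A m w k\<bar> \<le> norm A + norm (A *v m)"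
proof -
  have cs: "\<bar>w \<bullet> y\<bar> \<le> norm y" for y
    using order_trans[OF Cauchy_Schwarz_ineq2 mult_right_mono[OF assms]] by simp
  have comp: "(transpose B *v w) $ j = w \<bullet> (B *v axis j 1)" for B :: "real^'a^'a" and j
    using transpose_mult_inner[of B w "axis j 1"] by (simp add: inner_axis)
  have ax: "\<bar>w \<bullet> (B *v axis j 1)\<bar> \<le> norm B" for B :: "real^'a^'a" and j
    using cs[of "B *v axis j 1"] norm_matrix_vector_le[of B "axis j 1"] by simp
  show "\<bar>theta_coef A m w k - theta_coef A0 m0 w k\<bar> \<le> norm (A - A0) + norm (A *v m - A0 *v m0)"
  proof (cases k)
    case None
    have eq: "theta_coef A m w k - theta_coef A0 m0 w k = - (w \<bullet> (A *v m - A0 *v m0))"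
      by (simp add: None theta_coef_def inner_diff_right)
    show ?thesis unfolding eq abs_minus_cancel by (rule add_increasing[OF norm_ge_zero cs])
  next
    case (Some j)
    have eq: "theta_coef A m w k - theta_coef A0 m0 w k = w \<bullet> ((A - A0) *v axis j 1)"
      by (simp add: Some theta_coef_def comp matrix_vector_mult_diff_rdistrib inner_diff_right del: transpose_matrix_vector)
    show ?thesis unfolding eq by (rule add_increasing2[OF norm_ge_zero ax])
  qed
  show "\<bar>theta_coef A m w k\<bar> \<le> norm A + norm (A *v m)"
  proof (cases k)
    case None
    have eq: "theta_coef A m w k = - (w \<bullet> (A *v m))" by (simp add: None theta_coef_def)
    show ?thesis unfolding eq abs_minus_cancel by (rule add_increasing[OF norm_ge_zero cs])
  next
    case (Some j)
    have eq: "theta_coef A m w k = w \<bullet> (A *v axis j 1)"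
      by (simp add: Some theta_coef_def comp del: transpose_matrix_vector)
    show ?thesis unfolding eq by (rule add_increasing2[OF norm_ge_zero ax])
  qed
qed

lemma coord_fun_measurable [measurable]: "coord_fun k \<in> borel_measurable borel"
  unfolding coord_fun_def[abs_def] by (cases k) simp_all

lemma emp_proc_sum:
  assumes "finite S" "\<And>k. k \<in> S \<Longrightarrow> integrable P (f k)"
  shows "emp_proc P X n \<omega> (\<lambda>x. \<Sum>k\<in>S. f k x) = (\<Sum>k\<in>S. emp_proc P X n \<omega> (f k))"
proof -
  have "(\<Sum>i<n. \<Sum>k\<in>S. f k (X i \<omega>)) = (\<Sum>k\<in>S. \<Sum>i<n. f k (X i \<omega>))" by (rule sum.swap)
  then show ?thesis using assms
    by (simp add: emp_proc_def Bochner_Integration.integral_sum sum_distrib_left[symmetric]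
        sum_divide_distrib[symmetric] sum_subtractf)
qed

lemma emp_proc_lincomb:
  assumes "integrable P f" "integrable P g"
  shows "emp_proc P X n \<omega> (\<lambda>x. a * f x + b * g x) = a * emp_proc P X n \<omega> f + b * emp_proc P X n \<omega> g"
  using assms by (simp add: emp_proc_def sum.distrib sum_distrib_left[symmetric] algebra_simps)

lemma Theta_nonempty: "Theta \<noteq> ({} :: ((real^'d) \<times> (real^'d) \<times> real) set)"
proof -
  have "(axis undefined 1, axis undefined 1, 0) \<in> (Theta :: ((real^'d) \<times> (real^'d) \<times> real) set)"
    by (simp add: Theta_def)
  then show ?thesis by blast
qed

section \<open>Assembly of the convergence statement\<close>

context iid_sample
begin

text \<open>A deterministic estimate at one sample point. Each of the \<open>CARD('d) + 1\<close>
  weights contributes \<open>e\<close> for the change of coefficients and \<open>e\<close> for the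
  change of half-space.\<close>

lemma process_difference_bound:
  fixes A A0 :: "real^'d^'d"
  assumes g: "\<And>k. integrable P (\<lambda>x. (coord_fun k x)\<^sup>2)"
    and u: "norm u = 1" and v: "norm v = 1"
    and K: "\<And>k h. \<bar>emp_proc P X n \<omega> (hdiff (coord_fun k) h)\<bar> \<le> C k"
    and \<kappa>: "\<And>k. (norm (A - A0) + norm (A *v m - A0 *v m0)) * C k \<le> e"
    and eq: "\<And>k. \<bar>emp_proc P X n \<omega> (hdiff (coord_fun k) (theta_halfspace u c A m, theta_halfspace u c A0 m0))\<bar> \<le> e'"
    and e': "(norm A0 + norm (A0 *v m0)) * e' \<le> e"
  shows "\<bar>emp_proc P X n \<omega> (\<lambda>x. f_theta_eta (u, v, c) (A, m) x - f_theta_eta (u, v, c) (A0, m0) x)\<bar>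
    \<le> 2 * e * (real CARD('d) + 1)"
proof -
  define w where "w = v - (v \<bullet> u) *\<^sub>R u"
  have w: "norm w \<le> 1" unfolding w_def by (rule norm_project_le_1[OF u v])
  define h1 where "h1 = (theta_halfspace u c A m, empty_halfspace :: (real^'d) \<times> real)"
  define h2 where "h2 = (theta_halfspace u c A m, theta_halfspace u c A0 m0)"
  define a where "a k = theta_coef A m w k - theta_coef A0 m0 w k" for k
  define b where "b k = theta_coef A0 m0 w k" for k
  have int: "integrable P (hdiff (coord_fun k) h)" for k h
    by (intro law.hdiff_integrable g) simp
  have "emp_proc P X n \<omega> (\<lambda>x. f_theta_eta (u, v, c) (A, m) x - f_theta_eta (u, v, c) (A0, m0) x)
      = emp_proc P X n \<omega> (\<lambda>x. \<Sum>k\<in>UNIV. a k * hdiff (coord_fun k) h1 x + b k * hdiff (coord_fun k) h2 x)"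
    unfolding f_theta_eta_diff a_def b_def h1_def h2_def w_def ..
  also have "\<dots> = (\<Sum>k\<in>UNIV. a k * emp_proc P X n \<omega> (hdiff (coord_fun k) h1) + b k * emp_proc P X n \<omega> (hdiff (coord_fun k) h2))"
    using int by (subst emp_proc_sum) (auto simp: emp_proc_lincomb)
  also have "\<bar>\<dots>\<bar> \<le> (\<Sum>k\<in>(UNIV::'d option set). e + e)"
  proof (rule order_trans[OF sum_abs sum_mono])
    fix k :: "'d option"
    have "\<bar>a k * emp_proc P X n \<omega> (hdiff (coord_fun k) h1)\<bar> \<le> (norm (A - A0) + norm (A *v m - A0 *v m0)) * C k"
      unfolding abs_mult a_def by (intro mult_mono theta_coef_bound w K) auto
    moreover have "\<bar>b k * emp_proc P X n \<omega> (hdiff (coord_fun k) h2)\<bar> \<le> (norm A0 + norm (A0 *v m0)) * e'"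
      unfolding abs_mult b_def h2_def by (intro mult_mono theta_coef_bound w eq) auto
    ultimately show "\<bar>a k * emp_proc P X n \<omega> (hdiff (coord_fun k) h1) + b k * emp_proc P X n \<omega> (hdiff (coord_fun k) h2)\<bar> \<le> e + e"
      using \<kappa>[of k] e' by linarith
  qed
  also have "\<dots> = 2 * e * (real CARD('d) + 1)" by (simp add: card_option)
  finally show ?thesis .
qed

end

theorem theorem3p1:
  fixes M :: "'w measure" and X :: "nat \<Rightarrow> 'w \<Rightarrow> real^'d" and P :: "(real^'d) measure"
  assumes "prob_space M"
    and "\<And>i. X i \<in> borel_measurable M"
    and "prob_space.indep_vars M (\<lambda>_. borel) X UNIV"
    and "\<And>i. distr M borel (X i) = P"
    and "elliptically_symmetric P"
    and "absolutely_continuous lborel P"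
    and "integrable P (\<lambda>x. (norm x)\<^sup>2)"
    and "invertible (cov_mat P)"
  shows "\<forall>\<epsilon>>0. (\<lambda>n. outer_prob M {\<omega> \<in> space M.
            (SUP \<theta>\<in>Theta. \<bar>emp_proc P X n \<omega>
               (\<lambda>x. f_theta_eta \<theta> (mat_inv_sqrt (emp_cov X n \<omega>), emp_mean X n \<omega>) x
                    - f_theta_eta \<theta> (mat_inv_sqrt (cov_mat P), mean_vec P) x)\<bar>) > \<epsilon>})
          \<longlonglongrightarrow> 0"
proof (intro allI impI)
  fix \<epsilon> :: real assume \<epsilon>: "\<epsilon> > 0"
  interpret M: prob_space M by fact
  have "prob_space P" using M.prob_space_distr[OF assms(2)] assms(4) by metis
  moreover have "sets P = sets borel" using assms(4) by (metis sets_distr)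
  ultimately interpret law: euclidean_law P
    by (auto simp: euclidean_law_def euclidean_law_axioms_def)
  interpret iid_sample M P X
    using assms by unfold_locales auto
  note sq = assms(7)
  note int = vec_product_integrable[OF law.euclidean_law_axioms sq]
  define A0 where "A0 = mat_inv_sqrt (cov_mat P)"
  define m0 where "m0 = mean_vec P"
  define A where "A n \<omega> = mat_inv_sqrt (emp_cov X n \<omega>)" for n \<omega>
  define m where "m n \<omega> = emp_mean X n \<omega>" for n \<omega>
  have psd: "psd_mat (cov_mat P)" by (rule psd_mat_cov_mat[OF law.euclidean_law_axioms sq])
  have A0: "invertible A0" unfolding A0_def by (rule invertible_mat_inv_sqrt[OF psd assms(8)])
  have g: "integrable P (\<lambda>x. (coord_fun k x)\<^sup>2)" for k
    using int(3) by (cases k) (auto simp: coord_fun_def)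
  have A_cons: "M.whp (\<lambda>n \<omega>. norm (A n \<omega> - A0) < r)" if r: "r > 0" for r
  proof -
    obtain d where d: "d > 0"
      "\<And>S. psd_mat S \<Longrightarrow> norm (S - cov_mat P) < d \<Longrightarrow> norm (mat_inv_sqrt S - mat_inv_sqrt (cov_mat P)) < r"
      using mat_inv_sqrt_continuous[OF psd assms(8) r] by metis
    show ?thesis
      by (rule M.whp_mono[OF emp_cov_consistent[OF sq d(1)]])
        (unfold A_def A0_def, rule d(2)[OF psd_mat_emp_cov])
  qed
  have m_cons: "M.whp (\<lambda>n \<omega>. norm (m n \<omega> - m0) < r)" if "r > 0" for r
    unfolding m_def m0_def by (rule emp_mean_consistent[OF sq that])
  define \<kappa> where "\<kappa> n \<omega> = norm (A n \<omega> - A0) + norm (A n \<omega> *v m n \<omega> - A0 *v m0)" for n \<omega>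
  have \<kappa>: "M.whp (\<lambda>n \<omega>. \<kappa> n \<omega> < r)" if r: "r > 0" for r
  proof -
    \<comment> \<open>Expanding \<open>A m - A0 m0\<close> around the limits bounds
      \<open>\<kappa>\<close> by \<open>r1 * (2 + |m0| + |A0|)\<close> provided
      \<open>r1 \<le> 1\<close>, which the extra \<open>r\<close> in the denominator
      ensures.\<close>
    define r1 where "r1 = r / (2 + norm m0 + norm A0 + r)"
    have den: "2 + norm m0 + norm A0 + r > 0" using r by (simp add: add_pos_nonneg)
    have r1: "r1 > 0" "r1 \<le> 1" using r den by (auto simp: r1_def field_simps)
    show ?thesis
    proof (rule M.whp_mono[OF M.whp_conj[OF A_cons[OF r1(1)] m_cons[OF r1(1)]]])
      fix n \<omega> assume B: "norm (A n \<omega> - A0) < r1 \<and> norm (m n \<omega> - m0) < r1"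
      have "A n \<omega> *v m n \<omega> - A0 *v m0 = (A n \<omega> - A0) *v m0 + (A n \<omega> - A0) *v (m n \<omega> - m0) + A0 *v (m n \<omega> - m0)"
        by (simp add: matrix_vector_mult_diff_rdistrib matrix_vector_mult_diff_distrib)
      then have "norm (A n \<omega> *v m n \<omega> - A0 *v m0)
          \<le> norm (A n \<omega> - A0) * norm m0 + norm (A n \<omega> - A0) * norm (m n \<omega> - m0) + norm A0 * norm (m n \<omega> - m0)"
        using norm_matrix_vector_le by (metis (no_types, lifting) norm_triangle_mono)
      also have "\<dots> \<le> r1 * norm m0 + r1 * 1 + norm A0 * r1"
        using B r1 by (intro add_mono mult_mono) auto
      finally have "\<kappa> n \<omega> < r1 * (2 + norm m0 + norm A0)" using B by (simp add: \<kappa>_def algebra_simps)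
      also have "\<dots> \<le> r1 * (2 + norm m0 + norm A0 + r)" using r r1 by (intro mult_left_mono) auto
      also have "\<dots> = r" using den by (simp add: r1_def)
      finally show "\<kappa> n \<omega> < r" .
    qed
  qed
  define e where "e = \<epsilon> / (2 * (real CARD('d) + 1))"
  have e: "e > 0" using \<epsilon> by (simp add: e_def add_nonneg_pos)
  define a0 where "a0 = norm A0 + norm (A0 *v m0)"
  have a0: "a0 \<ge> 0" by (simp add: a0_def)
  define e' where "e' = e / (a0 + 1)"
  have e': "e' > 0" "a0 * e' \<le> e"
    using e a0 by (auto simp: e'_def field_simps)
  \<comment> \<open>A bounded factor times a vanishing one: \<open>C\<close> comes from tightness,
    and afterwards consistency pushes the change of coefficients below \<open>e / C\<close>.\<close>
  have small: "M.whp (\<lambda>n \<omega>. \<exists>C>0. (\<forall>h. \<bar>emp_proc P X n \<omega> (hdiff (coord_fun k) h)\<bar> \<le> C) \<and> \<kappa> n \<omega> < e / C)" for k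
    using g e by (intro M.tight_family_whp process_bounded_in_probability \<kappa>) auto
  \<comment> \<open>Here the estimated parameters are plugged in: the radius \<open>d\<close> serves
    all pairs of half-spaces, and consistency puts the random pairs within it for all
    \<open>u\<close> and \<open>c\<close> simultaneously.\<close>
  have equi: "M.whp (\<lambda>n \<omega>. \<exists>d>0. (\<forall>h. (\<integral>y. (coord_fun k y)\<^sup>2 * indicator (hsym h) y \<partial>P) < d \<longrightarrow>
        \<bar>emp_proc P X n \<omega> (hdiff (coord_fun k) h)\<bar> \<le> e')
      \<and> (\<forall>u c. norm u = 1 \<longrightarrow> (\<integral>y. (coord_fun k y)\<^sup>2 *
          indicator (hsym (theta_halfspace u c (A n \<omega>) (m n \<omega>), theta_halfspace u c A0 m0)) y \<partial>P) < d))" for k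
  proof (rule M.tight_family_whp)
    show "M.tight_family (\<lambda>d n \<omega>. \<forall>h. (\<integral>y. (coord_fun k y)\<^sup>2 * indicator (hsym h) y \<partial>P) < d \<longrightarrow>
        \<bar>emp_proc P X n \<omega> (hdiff (coord_fun k) h)\<bar> \<le> e')"
      by (intro process_equicontinuous_in_probability g e') simp
    fix d :: real assume d: "d > 0"
    obtain r where r: "r > 0" "\<And>A m u c. norm (A - A0) < r \<Longrightarrow> norm (m - m0) < r \<Longrightarrow> norm u = 1 \<Longrightarrow>
        (\<integral>y. (coord_fun k y)\<^sup>2 * indicator (hsym (theta_halfspace u c A m, theta_halfspace u c A0 m0)) y \<partial>P) < d"
    proof (rule theta_halfspace_uniform_continuity[OF law.euclidean_law_axioms assms(6) coord_fun_measurable g A0 d])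
      fix r
      assume *: "r > 0" "\<And>A m u c. norm (A - A0) < r \<Longrightarrow> norm (m - m0) < r \<Longrightarrow> norm u = 1 \<Longrightarrow>
        (\<integral>y. (coord_fun k y)\<^sup>2 * indicator (hsym (theta_halfspace u c A m, theta_halfspace u c A0 m0)) y \<partial>P) < d"
      show thesis by (rule that[OF *])
    qed
    show "M.whp (\<lambda>n \<omega>. \<forall>u c. norm u = 1 \<longrightarrow> (\<integral>y. (coord_fun k y)\<^sup>2 *
          indicator (hsym (theta_halfspace u c (A n \<omega>) (m n \<omega>), theta_halfspace u c A0 m0)) y \<partial>P) < d)"
      by (rule M.whp_mono[OF M.whp_conj[OF A_cons[OF r(1)] m_cons[OF r(1)]]]) (use r(2) in auto)
  qed
  have "M.whp (\<lambda>n \<omega>. \<not> (SUP \<theta>\<in>Theta. \<bar>emp_proc P X n \<omega>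
      (\<lambda>x. f_theta_eta \<theta> (A n \<omega>, m n \<omega>) x - f_theta_eta \<theta> (A0, m0) x)\<bar>) > \<epsilon>)"
  proof (rule M.whp_mono[OF M.whp_conj[OF M.whp_ball_finite[OF finite_class.finite_UNIV small]
          M.whp_ball_finite[OF finite_class.finite_UNIV equi]]])
    fix n \<omega>
    assume *: "(\<forall>k\<in>UNIV. \<exists>C>0. (\<forall>h. \<bar>emp_proc P X n \<omega> (hdiff (coord_fun k) h)\<bar> \<le> C) \<and> \<kappa> n \<omega> < e / C) \<and>
      (\<forall>k\<in>UNIV. \<exists>d>0. (\<forall>h. (\<integral>y. (coord_fun k y)\<^sup>2 * indicator (hsym h) y \<partial>P) < d \<longrightarrow>
          \<bar>emp_proc P X n \<omega> (hdiff (coord_fun k) h)\<bar> \<le> e')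
        \<and> (\<forall>u c. norm u = 1 \<longrightarrow> (\<integral>y. (coord_fun k y)\<^sup>2 *
            indicator (hsym (theta_halfspace u c (A n \<omega>) (m n \<omega>), theta_halfspace u c A0 m0)) y \<partial>P) < d))"
    then have "\<forall>k. \<exists>C>0. (\<forall>h. \<bar>emp_proc P X n \<omega> (hdiff (coord_fun k) h)\<bar> \<le> C) \<and> \<kappa> n \<omega> < e / C" by blast
    then obtain C where C: "\<And>k. C k > 0" "\<And>k h. \<bar>emp_proc P X n \<omega> (hdiff (coord_fun k) h)\<bar> \<le> C k" "\<And>k. \<kappa> n \<omega> < e / C k"
      by metis
    have \<kappa>C: "\<kappa> n \<omega> * C k \<le> e" for k using C(1,3)[of k] by (simp add: field_simps)
    have close: "\<bar>emp_proc P X n \<omega> (hdiff (coord_fun k) (theta_halfspace u c (A n \<omega>) (m n \<omega>), theta_halfspace u c A0 m0))\<bar> \<le> e'"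
      if "norm u = 1" for k u c
      using * that by blast
    have "\<bar>emp_proc P X n \<omega> (\<lambda>x. f_theta_eta \<theta> (A n \<omega>, m n \<omega>) x - f_theta_eta \<theta> (A0, m0) x)\<bar> \<le> \<epsilon>"
      if \<theta>: "\<theta> \<in> Theta" for \<theta>
    proof -
      obtain u v c where uvc: "\<theta> = (u, v, c)" "norm u = 1" "norm v = 1" using \<theta> by (auto simp: Theta_def)
      have "\<bar>emp_proc P X n \<omega> (\<lambda>x. f_theta_eta (u, v, c) (A n \<omega>, m n \<omega>) x - f_theta_eta (u, v, c) (A0, m0) x)\<bar>
          \<le> 2 * e * (real CARD('d) + 1)"
        by (rule process_difference_bound[OF g uvc(2,3) C(2) \<kappa>C[unfolded \<kappa>_def] close[OF uvc(2)] e'(2)[unfolded a0_def]])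
      also have "\<dots> = \<epsilon>" by (simp add: e_def field_simps add_nonneg_eq_0_iff)
      finally show ?thesis by (simp add: uvc(1))
    qed
    \<comment> \<open>At these sample points the values are bounded by \<epsilon> and
      \<open>Theta\<close> is nonempty, so the real supremum is a genuine least upper bound; points
      where it might not be belong to the exceptional set.\<close>
    then have "(SUP \<theta>\<in>Theta. \<bar>emp_proc P X n \<omega>
        (\<lambda>x. f_theta_eta \<theta> (A n \<omega>, m n \<omega>) x - f_theta_eta \<theta> (A0, m0) x)\<bar>) \<le> \<epsilon>"
      by (intro cSUP_least Theta_nonempty)
    then show "\<not> (SUP \<theta>\<in>Theta. \<bar>emp_proc P X n \<omega>
        (\<lambda>x. f_theta_eta \<theta> (A n \<omega>, m n \<omega>) x - f_theta_eta \<theta> (A0, m0) x)\<bar>) > \<epsilon>" by simp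
  qed
  from M.whp_imp_outer_prob_tendsto_0[OF this]
  show "(\<lambda>n. outer_prob M {\<omega> \<in> space M.
            (SUP \<theta>\<in>Theta. \<bar>emp_proc P X n \<omega>
               (\<lambda>x. f_theta_eta \<theta> (mat_inv_sqrt (emp_cov X n \<omega>), emp_mean X n \<omega>) x
                    - f_theta_eta \<theta> (mat_inv_sqrt (cov_mat P), mean_vec P) x)\<bar>) > \<epsilon>})
          \<longlonglongrightarrow> 0"
    by (simp add: A_def m_def A0_def m0_def)
qed

end
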